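(* Let $\langle i_X:\mathcal M X\to\mathcal P X\leftarrow\mathcal M'X:i'_X;\ X\in\mathcal C\rangle$ be a temporal doctrine. The functors $\underline{\rm hom}_X$, $\underline{\rm nat}_X$ and $\underline{\rm nat}'_X$ enrich $\mathcal P X$, $\mathcal M X$ and $\mathcal M'X$, respectively, in $\mathcal B1$. Moreover, for every $X\in\mathcal C$ and every map $f:X\to Y$ in $\mathcal C$, there are isomorphisms in $\mathcal B1$, natural in all the variables (which range over the categories indicated by the types of the functors): $$\underline{\rm hom}_X(f^*Q,P)\cong\underline{\rm hom}_Y(Q,\Pi_fP),\qquad \underline{\rm hom}_X(P,f^*Q)\cong\underline{\rm hom}_Y(\Sigma_fP,Q)$$ $$\underline{\rm meets}_X(f^*Q,P)\cong\underline{\rm meets}_Y(Q,\Sigma_fP),\qquad \underline{\rm meets}_X(P,f^*Q)\cong\underline{\rm meets}_Y(\Sigma_fP,Q)$$ $$\underline{\rm nat}_X(M,\Box_XP)\cong\underline{\rm hom}_X(i_XM,P),\qquad \underline{\rm nat}'_X(N,\Box'_XP)\cong\underline{\rm hom}_X(i'_XN,P)$$ $$\underline{\rm nat}_X(\Diamond_XP,M)\cong\underline{\rm hom}_X(P,i_XM),\qquad \underline{\rm nat}'_X(\Diamond'_XP,N)\cong\underline{\rm hom}_X(P,i'_XN)$$ $$\underline{\rm ten}_X(N,\Diamond_XP)\cong\underline{\rm meets}_X(i'_XN,P),\qquad \underline{\rm ten}_X(\Diamond'_XP,M)\cong\underline{\rm meets}_X(P,i_XM)$$ $$\underline{\rm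 nat}_X(f\cdot M,L)\cong\underline{\rm nat}_Y(M,\forall_fL),\qquad \underline{\rm nat}'_X(f'\cdot O,N)\cong\underline{\rm nat}'_Y(O,\forall'_fN)$$ $$\underline{\rm nat}_X(L,f\cdot M)\cong\underline{\rm nat}_Y(\exists_fL,M),\qquad \underline{\rm nat}'_X(N,f'\cdot O)\cong\underline{\rm nat}'_Y(\exists'_fN,O)$$ $$\underline{\rm ten}_X(f'\cdot N,L)\cong\underline{\rm ten}_Y(N,\exists_fL),\qquad \underline{\rm ten}_X(N,f\cdot M)\cong\underline{\rm ten}_Y(\exists'_fN,M)$$
   Context: A temporal doctrine $\langle i_X:\mathcal M X\to\mathcal P X\leftarrow\mathcal M'X:i'_X;\ X\in\mathcal C\rangle$ consists of a category $\mathcal C$, three $\mathcal C$-indexed categories $\mathcal M,\mathcal P,\mathcal M'$ (pseudofunctors $\mathcal C^{op}\to\mathbf{Cat}$), and two indexed functors $i:\mathcal M\to\mathcal P$, $i':\mathcal M'\to\mathcal P$. The substitution functors along $f:X\to Y$ are written $f\cdot(-):\mathcal M Y\to\mathcal M X$, $f'\cdot(-):\mathcal M'Y\to\mathcal M'X$, $f^*:\mathcal P Y\to\mathcal P X$; thus $i_X(f\cdot M)\cong f^*i_Y M$ and $i'_X(f'\cdot N)\cong f^*i'_Y N$, coherently. $\mathcal B X:=\mathcal M X\times_{\mathcal P X}\mathcal M'X$ denotes the indexed pullback of $i$ and $i'$ (equalities up to the coherent isomorphisms), with projections $j_X:\mathcal B X\to\mathcal M X$, $j'_X:\mathcal B X\to\mathcal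 M'X$, and $b_X:=i_Xj_X=i'_Xj'_X:\mathcal B X\to\mathcal P X$. The axioms are: (A1) $\mathcal C$ has a terminal object $1$. (A2) Each $\mathcal P X$ is cartesian closed, with terminal object $1_X$, products $P\times_X Q$ and exponentials $P\Rightarrow Q$. (A3) Each $f^*$ has left and right adjoints $\Sigma_f\dashv f^*\dashv\Pi_f$. (A4) $i_X$ and $i'_X$ have left and right adjoints: $\Diamond_X\dashv i_X\dashv\Box_X$, $\Diamond'_X\dashv i'_X\dashv\Box'_X$. (A5) (comprehension) The canonical functor $c_X:\mathcal C/X\to\mathcal P X$, sending $f:T\to X$ to $\Sigma_f1_T$, has a right adjoint $k_X:\mathcal P X\to\mathcal C/X$. (B1) $i_X$ and $i'_X$ are fully faithful. (B2) (Frobenius law) $\Sigma_fP\times_YQ\cong\Sigma_f(P\times_Xf^*Q)$ canonically, naturally in $P\in\mathcal P X$, $Q\in\mathcal P Y$, for every $f:X\to Y$. (B3) (mixed Frobenius laws) The units of $\Diamond_X\dashv i_X$ and $\Diamond'_X\dashv i'_X$ induce isomorphisms $\Diamond_X(P\times_Xi'_XN)\cong\Diamond_X(i_X\Diamond_XP\times_Xi'_XN)$ and $\Diamond'_X(P\times_Xi_XM)\cong\Diamond'_X(i'_X\Diamond'_XP\times_Xi_XM)$, natural in $P\in\mathcal P X$, $M\in\mathcal M X$, $N\in\mathcal M'X$. (B4) $j_1:\mathcal B1\to\mathcal M1$ and $j'_1:\mathcal B1\to\mathcal M'1$ are isomorphisms. (B5) Each $k_X$ is fully faithful. Derived notation.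 For $f:X\to Y$, $f\cdot(-)$ has left adjoint $\exists_f:=\Diamond_Y\Sigma_fi_X$ and right adjoint $\forall_f:=\Box_Y\Pi_fi_X$, and $f'\cdot(-)$ has left adjoint $\exists'_f:=\Diamond'_Y\Sigma_fi'_X$ and right adjoint $\forall'_f:=\Box'_Y\Pi_fi'_X$. An object $X$ used as an index of a quantifier denotes the map $X\to1$. The functor $X^*b_1:\mathcal B1\to\mathcal P X$ has left adjoint $\underline{\rm coend}_X\cong j_1^{-1}\exists_X\Diamond_X$ and right adjoint $\underline{\rm end}_X\cong j_1^{-1}\forall_X\Box_X$. For $P,Q\in\mathcal P X$, $L,M\in\mathcal M X$, $N,O\in\mathcal M'X$ put $\underline{\rm meets}_X(P,Q):=\underline{\rm coend}_X(P\times_XQ)$, $\underline{\rm hom}_X(P,Q):=\underline{\rm end}_X(P\Rightarrow Q)$, $\underline{\rm ten}_X(N,M):=\underline{\rm meets}_X(i'_XN,i_XM)$, $\underline{\rm nat}_X(L,M):=\underline{\rm hom}_X(i_XL,i_XM)$, $\underline{\rm nat}'_X(N,O):=\underline{\rm hom}_X(i'_XN,i'_XO)$, all objects of $\mathcal B1$. That a functor $H:\mathcal A^{op}\times\mathcal A\to\mathcal B1$ enriches $\mathcal A$ in $\mathcal B1$ means that it gives the hom-objects of a $\mathcal B1$-category (with respect to the cartesian structure) whose underlying ordinary category is $\mathcal A$; in particular $\mathcal B1(\mathtt{true},H(A,A'))\cong\mathcal A(A,A')$, with $\mathtt{true}$ the terminal object of $\mathcal B1$. *)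

theory Defs
  imports Main
begin

section \<open>Categories, functors, adjunctions\<close>

record ('o, 'a) cat =
  Obj :: "'o set"
  Arr :: "'a set"
  Dom :: "'a \<Rightarrow> 'o"
  Cod :: "'a \<Rightarrow> 'o"
  Idn :: "'o \<Rightarrow> 'a"
  Cmp :: "'a \<Rightarrow> 'a \<Rightarrow> 'a"  (infixr "\<cdot>\<index>" 70)

definition hom :: "('o, 'a) cat \<Rightarrow> 'o \<Rightarrow> 'o \<Rightarrow> 'a set" where
  "hom C a b = {f \<in> Arr C. Dom C f = a \<and> Cod C f = b}"

locale category =
  fixes C :: "('o, 'a) cat" (structure)
  assumes dom_obj: "f \<in> Arr C \<Longrightarrow> Dom C f \<in> Obj C"
    and cod_obj: "f \<in> Arr C \<Longrightarrow> Cod C f \<in> Obj C"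
    and id_hom: "a \<in> Obj C \<Longrightarrow> Idn C a \<in> hom C a a"
    and cmp_hom: "f \<in> hom C a b \<Longrightarrow> g \<in> hom C b c \<Longrightarrow> g \<cdot> f \<in> hom C a c"
    and id_left: "f \<in> hom C a b \<Longrightarrow> Idn C b \<cdot> f = f"
    and id_right: "f \<in> hom C a b \<Longrightarrow> f \<cdot> Idn C a = f"
    and assoc: "f \<in> hom C a b \<Longrightarrow> g \<in> hom C b c \<Longrightarrow> h \<in> hom C c d
      \<Longrightarrow> (h \<cdot> g) \<cdot> f = h \<cdot> (g \<cdot> f)"

definition is_iso :: "('o, 'a) cat \<Rightarrow> 'a \<Rightarrow> bool" where
  "is_iso C f \<longleftrightarrow> f \<in> Arr C \<and>
     (\<exists>g \<in> hom C (Cod C f) (Dom C f).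
        g \<cdot>\<^bsub>C\<^esub> f = Idn C (Dom C f) \<and> f \<cdot>\<^bsub>C\<^esub> g = Idn C (Cod C f))"

definition terminal :: "('o, 'a) cat \<Rightarrow> 'o \<Rightarrow> bool" where
  "terminal C t \<longleftrightarrow> t \<in> Obj C \<and> (\<forall>a \<in> Obj C. \<exists>!f. f \<in> hom C a t)"

definition bang :: "('o, 'a) cat \<Rightarrow> 'o \<Rightarrow> 'o \<Rightarrow> 'a" where
  "bang C t a = (THE f. f \<in> hom C a t)"

definition op_cat :: "('o, 'a) cat \<Rightarrow> ('o, 'a) cat" where
  "op_cat C = \<lparr>Obj = Obj C, Arr = Arr C, Dom = Cod C, Cod = Dom C, Idn = Idn C,
     Cmp = (\<lambda>g f. f \<cdot>\<^bsub>C\<^esub> g)\<rparr>"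

definition prod_cat :: "('o, 'a) cat \<Rightarrow> ('p, 'b) cat \<Rightarrow> ('o \<times> 'p, 'a \<times> 'b) cat"
    (infixr "\<times>\<^sub>c" 80) where
  "C \<times>\<^sub>c D = \<lparr>Obj = Obj C \<times> Obj D, Arr = Arr C \<times> Arr D,
     Dom = map_prod (Dom C) (Dom D), Cod = map_prod (Cod C) (Cod D),
     Idn = map_prod (Idn C) (Idn D),
     Cmp = (\<lambda>(g, g') (f, f'). (g \<cdot>\<^bsub>C\<^esub> f, g' \<cdot>\<^bsub>D\<^esub> f'))\<rparr>"

record ('o, 'a, 'p, 'b) fctr =
  fob :: "'o \<Rightarrow> 'p"
  far :: "'a \<Rightarrow> 'b"

definition is_functor :: "('o, 'a) cat \<Rightarrow> ('p, 'b) cat \<Rightarrow> ('o, 'a, 'p, 'b) fctr \<Rightarrow> bool" where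
  "is_functor C D F \<longleftrightarrow> category C \<and> category D \<and>
     (\<forall>a \<in> Obj C. fob F a \<in> Obj D) \<and>
     (\<forall>a b. \<forall>f \<in> hom C a b. far F f \<in> hom D (fob F a) (fob F b)) \<and>
     (\<forall>a \<in> Obj C. far F (Idn C a) = Idn D (fob F a)) \<and>
     (\<forall>a b c. \<forall>f \<in> hom C a b. \<forall>g \<in> hom C b c.
        far F (g \<cdot>\<^bsub>C\<^esub> f) = far F g \<cdot>\<^bsub>D\<^esub> far F f)"

definition idf :: "('o, 'a, 'o, 'a) fctr" where
  "idf = \<lparr>fob = (\<lambda>a. a), far = (\<lambda>f. f)\<rparr>"

definition fcomp :: "('p, 'b, 'q, 'c) fctr \<Rightarrow> ('o, 'a, 'p, 'b) fctr \<Rightarrow> ('o, 'a, 'q, 'c) fctr"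
    (infixr "\<circ>\<^sub>f" 75) where
  "G \<circ>\<^sub>f F = \<lparr>fob = fob G \<circ> fob F, far = far G \<circ> far F\<rparr>"

text \<open>As the action of a functor does not change under passage to opposite categories,
  \<open>F \<times>\<^sub>f G\<close> also serves as a functor between products involving \<open>op_cat\<close>.\<close>

definition fprod :: "('o, 'a, 'p, 'b) fctr \<Rightarrow> ('o2, 'a2, 'p2, 'b2) fctr
    \<Rightarrow> ('o \<times> 'o2, 'a \<times> 'a2, 'p \<times> 'p2, 'b \<times> 'b2) fctr"  (infixr "\<times>\<^sub>f" 80) where
  "F \<times>\<^sub>f G = \<lparr>fob = map_prod (fob F) (fob G), far = map_prod (far F) (far G)\<rparr>"

definition fully_faithful ::
  "('o, 'a) cat \<Rightarrow> ('p, 'b) cat \<Rightarrow> ('o, 'a, 'p, 'b) fctr \<Rightarrow> bool" where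
  "fully_faithful C D F \<longleftrightarrow> is_functor C D F \<and>
     (\<forall>a \<in> Obj C. \<forall>b \<in> Obj C. bij_betw (far F) (hom C a b) (hom D (fob F a) (fob F b)))"

definition nat_trans :: "('o, 'a) cat \<Rightarrow> ('p, 'b) cat \<Rightarrow> ('o, 'a, 'p, 'b) fctr
    \<Rightarrow> ('o, 'a, 'p, 'b) fctr \<Rightarrow> ('o \<Rightarrow> 'b) \<Rightarrow> bool" where
  "nat_trans C D F G \<tau> \<longleftrightarrow> is_functor C D F \<and> is_functor C D G \<and>
     (\<forall>a \<in> Obj C. \<tau> a \<in> hom D (fob F a) (fob G a)) \<and>
     (\<forall>a b. \<forall>f \<in> hom C a b. \<tau> b \<cdot>\<^bsub>D\<^esub> far F f = far G f \<cdot>\<^bsub>D\<^esub> \<tau> a)"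

definition nat_iso :: "('o, 'a) cat \<Rightarrow> ('p, 'b) cat \<Rightarrow> ('o, 'a, 'p, 'b) fctr
    \<Rightarrow> ('o, 'a, 'p, 'b) fctr \<Rightarrow> ('o \<Rightarrow> 'b) \<Rightarrow> bool" where
  "nat_iso C D F G \<tau> \<longleftrightarrow> nat_trans C D F G \<tau> \<and> (\<forall>a \<in> Obj C. is_iso D (\<tau> a))"

definition nat_isomorphic :: "('o, 'a) cat \<Rightarrow> ('p, 'b) cat \<Rightarrow> ('o, 'a, 'p, 'b) fctr
    \<Rightarrow> ('o, 'a, 'p, 'b) fctr \<Rightarrow> bool" where
  "nat_isomorphic C D F G \<longleftrightarrow> (\<exists>\<tau>. nat_iso C D F G \<tau>)"

definition equivalence ::
  "('o, 'a) cat \<Rightarrow> ('p, 'b) cat \<Rightarrow> ('o, 'a, 'p, 'b) fctr \<Rightarrow> bool" where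
  "equivalence C D F \<longleftrightarrow> is_functor C D F \<and>
     (\<exists>G. is_functor D C G \<and> nat_isomorphic C C (G \<circ>\<^sub>f F) idf \<and> nat_isomorphic D D (F \<circ>\<^sub>f G) idf)"

text \<open>\<open>adjunction C D F G \<eta> \<epsilon>\<close>: the functor \<open>F\<close> from \<open>C\<close> to \<open>D\<close> is left adjoint to \<open>G\<close>,
  with unit \<open>\<eta>\<close> and counit \<open>\<epsilon>\<close>.\<close>

definition adjunction :: "('o, 'a) cat \<Rightarrow> ('p, 'b) cat \<Rightarrow> ('o, 'a, 'p, 'b) fctr
    \<Rightarrow> ('p, 'b, 'o, 'a) fctr \<Rightarrow> ('o \<Rightarrow> 'a) \<Rightarrow> ('p \<Rightarrow> 'b) \<Rightarrow> bool" where
  "adjunction C D F G \<eta> \<epsilon> \<longleftrightarrow> is_functor C D F \<and> is_functor D C G \<and>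
     nat_trans C C idf (G \<circ>\<^sub>f F) \<eta> \<and> nat_trans D D (F \<circ>\<^sub>f G) idf \<epsilon> \<and>
     (\<forall>a \<in> Obj C. \<epsilon> (fob F a) \<cdot>\<^bsub>D\<^esub> far F (\<eta> a) = Idn D (fob F a)) \<and>
     (\<forall>b \<in> Obj D. far G (\<epsilon> b) \<cdot>\<^bsub>C\<^esub> \<eta> (fob G b) = Idn C (fob G b))"

definition adjoint :: "('o, 'a) cat \<Rightarrow> ('p, 'b) cat \<Rightarrow> ('o, 'a, 'p, 'b) fctr
    \<Rightarrow> ('p, 'b, 'o, 'a) fctr \<Rightarrow> bool" where
  "adjoint C D F G \<longleftrightarrow> (\<exists>\<eta> \<epsilon>. adjunction C D F G \<eta> \<epsilon>)"

text \<open>An object over \<open>X\<close> is an arrow with codomain \<open>X\<close>; an arrow \<open>(f, u, g)\<close> of the slice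
  is a factorization \<open>f = g \<cdot> u\<close>.\<close>

definition slice :: "('o, 'a) cat \<Rightarrow> 'o \<Rightarrow> ('a, 'a \<times> 'a \<times> 'a) cat" where
  "slice C X = \<lparr>Obj = {f \<in> Arr C. Cod C f = X},
     Arr = {(f, u, g). f \<in> Arr C \<and> Cod C f = X \<and> g \<in> Arr C \<and> Cod C g = X \<and>
              u \<in> hom C (Dom C f) (Dom C g) \<and> g \<cdot>\<^bsub>C\<^esub> u = f},
     Dom = (\<lambda>(f, u, g). f), Cod = (\<lambda>(f, u, g). g),
     Idn = (\<lambda>f. (f, Idn C (Dom C f), f)),
     Cmp = (\<lambda>(g, v, h) (f, u, g'). (f, v \<cdot>\<^bsub>C\<^esub> u, h))\<rparr>"

text \<open>The pullback of categories with equality of objects replaced by a specified isomorphism.\<close>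

definition pseudo_pullback :: "('o1, 'a1) cat \<Rightarrow> ('o2, 'a2) cat \<Rightarrow> ('p, 'b) cat
    \<Rightarrow> ('o1, 'a1, 'p, 'b) fctr \<Rightarrow> ('o2, 'a2, 'p, 'b) fctr
    \<Rightarrow> ('o1 \<times> 'o2 \<times> 'b, ('o1 \<times> 'o2 \<times> 'b) \<times> ('a1 \<times> 'a2) \<times> ('o1 \<times> 'o2 \<times> 'b)) cat" where
  "pseudo_pullback C1 C2 D F G =
    (let Ob = {(m, n, \<phi>). m \<in> Obj C1 \<and> n \<in> Obj C2 \<and> \<phi> \<in> hom D (fob F m) (fob G n) \<and> is_iso D \<phi>}
     in \<lparr>Obj = Ob,
         Arr = {((m, n, \<phi>), (u, v), (m', n', \<phi>')).
                  (m, n, \<phi>) \<in> Ob \<and> (m', n', \<phi>') \<in> Ob \<and> u \<in> hom C1 m m' \<and> v \<in> hom C2 n n' \<and>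
                  \<phi>' \<cdot>\<^bsub>D\<^esub> far F u = far G v \<cdot>\<^bsub>D\<^esub> \<phi>},
         Dom = (\<lambda>(s, w, t). s), Cod = (\<lambda>(s, w, t). t),
         Idn = (\<lambda>(m, n, \<phi>). ((m, n, \<phi>), (Idn C1 m, Idn C2 n), (m, n, \<phi>))),
         Cmp = (\<lambda>(s', (u', v'), t') (s, (u, v), t). (s, (u' \<cdot>\<^bsub>C1\<^esub> u, v' \<cdot>\<^bsub>C2\<^esub> v), t'))\<rparr>)"


section \<open>Cartesian (closed) structure and enrichment\<close>

record ('o, 'a) cart =
  tm :: 'o
  prd :: "'o \<Rightarrow> 'o \<Rightarrow> 'o"
  pr1 :: "'o \<Rightarrow> 'o \<Rightarrow> 'a"
  pr2 :: "'o \<Rightarrow> 'o \<Rightarrow> 'a"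

record ('o, 'a) ccart = "('o, 'a) cart" +
  expo :: "'o \<Rightarrow> 'o \<Rightarrow> 'o"
  ev :: "'o \<Rightarrow> 'o \<Rightarrow> 'a"

definition cartesian :: "('o, 'a) cat \<Rightarrow> ('o, 'a, 'z) cart_scheme \<Rightarrow> bool" where
  "cartesian C S \<longleftrightarrow> category C \<and> terminal C (tm S) \<and>
     (\<forall>a \<in> Obj C. \<forall>b \<in> Obj C. prd S a b \<in> Obj C \<and>
        pr1 S a b \<in> hom C (prd S a b) a \<and> pr2 S a b \<in> hom C (prd S a b) b \<and>
        (\<forall>c \<in> Obj C. \<forall>f \<in> hom C c a. \<forall>g \<in> hom C c b.
           \<exists>!h. h \<in> hom C c (prd S a b) \<and> pr1 S a b \<cdot>\<^bsub>C\<^esub> h = f \<and> pr2 S a b \<cdot>\<^bsub>C\<^esub> h = g))"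

definition tup :: "('o, 'a) cat \<Rightarrow> ('o, 'a, 'z) cart_scheme \<Rightarrow> 'a \<Rightarrow> 'a \<Rightarrow> 'a" where
  "tup C S f g = (THE h. h \<in> hom C (Dom C f) (prd S (Cod C f) (Cod C g)) \<and>
     pr1 S (Cod C f) (Cod C g) \<cdot>\<^bsub>C\<^esub> h = f \<and> pr2 S (Cod C f) (Cod C g) \<cdot>\<^bsub>C\<^esub> h = g)"

definition prd_map :: "('o, 'a) cat \<Rightarrow> ('o, 'a, 'z) cart_scheme \<Rightarrow> 'a \<Rightarrow> 'a \<Rightarrow> 'a" where
  "prd_map C S f g = tup C S (f \<cdot>\<^bsub>C\<^esub> pr1 S (Dom C f) (Dom C g)) (g \<cdot>\<^bsub>C\<^esub> pr2 S (Dom C f) (Dom C g))"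

definition prd_fun :: "('o, 'a) cat \<Rightarrow> ('o, 'a, 'z) cart_scheme \<Rightarrow> ('o \<times> 'o, 'a \<times> 'a, 'o, 'a) fctr" where
  "prd_fun C S = \<lparr>fob = (\<lambda>(a, b). prd S a b), far = (\<lambda>(f, g). prd_map C S f g)\<rparr>"

text \<open>\<open>expo S a b\<close> is the exponential \<open>a \<Rightarrow> b\<close>, with evaluation \<open>(a \<Rightarrow> b) \<times> a \<rightarrow> b\<close>.\<close>

definition cartesian_closed :: "('o, 'a) cat \<Rightarrow> ('o, 'a) ccart \<Rightarrow> bool" where
  "cartesian_closed C S \<longleftrightarrow> cartesian C S \<and>
     (\<forall>a \<in> Obj C. \<forall>b \<in> Obj C. expo S a b \<in> Obj C \<and>
        ev S a b \<in> hom C (prd S (expo S a b) a) b \<and>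
        (\<forall>c \<in> Obj C. \<forall>f \<in> hom C (prd S c a) b.
           \<exists>!h. h \<in> hom C c (expo S a b) \<and> ev S a b \<cdot>\<^bsub>C\<^esub> prd_map C S h (Idn C a) = f))"

text \<open>The transpose \<open>c \<rightarrow> (a \<Rightarrow> b)\<close> of \<open>f : c \<times> a \<rightarrow> b\<close>.\<close>

definition curry_arr :: "('o, 'a) cat \<Rightarrow> ('o, 'a) ccart \<Rightarrow> 'o \<Rightarrow> 'o \<Rightarrow> 'a \<Rightarrow> 'a" where
  "curry_arr C S c a f = (THE h. h \<in> hom C c (expo S a (Cod C f)) \<and>
     ev S a (Cod C f) \<cdot>\<^bsub>C\<^esub> prd_map C S h (Idn C a) = f)"

text \<open>The exponential as a functor on \<open>op_cat C \<times>\<^sub>c C\<close>: arrows \<open>p : a' \<rightarrow> a\<close> and \<open>q : b \<rightarrow> b'\<close>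
  of \<open>C\<close> give \<open>(a \<Rightarrow> b) \<rightarrow> (a' \<Rightarrow> b')\<close>.\<close>

definition exp_fun :: "('o, 'a) cat \<Rightarrow> ('o, 'a) ccart \<Rightarrow> ('o \<times> 'o, 'a \<times> 'a, 'o, 'a) fctr" where
  "exp_fun C S = \<lparr>fob = (\<lambda>(a, b). expo S a b),
     far = (\<lambda>(p, q). let e = expo S (Cod C p) (Dom C q) in
        curry_arr C S e (Dom C p)
          (q \<cdot>\<^bsub>C\<^esub> ev S (Cod C p) (Dom C q) \<cdot>\<^bsub>C\<^esub> prd_map C S (Idn C e) p))\<rparr>"

text \<open>A category enriched in the cartesian monoidal category \<open>(V, S)\<close>, with objects \<open>Ob\<close>,
  hom-objects \<open>H a b\<close>, compositions \<open>m a b c : H b c \<times> H a b \<rightarrow> H a c\<close> and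
  identities \<open>e a : 1 \<rightarrow> H a a\<close>.\<close>

definition enriched_category :: "('v, 'w) cat \<Rightarrow> ('v, 'w) cart \<Rightarrow> 'o set \<Rightarrow> ('o \<Rightarrow> 'o \<Rightarrow> 'v)
    \<Rightarrow> ('o \<Rightarrow> 'o \<Rightarrow> 'o \<Rightarrow> 'w) \<Rightarrow> ('o \<Rightarrow> 'w) \<Rightarrow> bool" where
  "enriched_category V S Ob H m e \<longleftrightarrow> cartesian V S \<and>
     (\<forall>a \<in> Ob. \<forall>b \<in> Ob. H a b \<in> Obj V) \<and>
     (\<forall>a \<in> Ob. e a \<in> hom V (tm S) (H a a)) \<and>
     (\<forall>a \<in> Ob. \<forall>b \<in> Ob. \<forall>c \<in> Ob. m a b c \<in> hom V (prd S (H b c) (H a b)) (H a c)) \<and>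
     (\<forall>a \<in> Ob. \<forall>b \<in> Ob.
        m a b b \<cdot>\<^bsub>V\<^esub> prd_map V S (e b) (Idn V (H a b)) = pr2 S (tm S) (H a b) \<and>
        m a a b \<cdot>\<^bsub>V\<^esub> prd_map V S (Idn V (H a b)) (e a) = pr1 S (H a b) (tm S)) \<and>
     (\<forall>a \<in> Ob. \<forall>b \<in> Ob. \<forall>c \<in> Ob. \<forall>d \<in> Ob.
        let p = pr1 S (prd S (H c d) (H b c)) (H a b);
            assoc = tup V S (pr1 S (H c d) (H b c) \<cdot>\<^bsub>V\<^esub> p)
              (tup V S (pr2 S (H c d) (H b c) \<cdot>\<^bsub>V\<^esub> p) (pr2 S (prd S (H c d) (H b c)) (H a b)))
        in m a b d \<cdot>\<^bsub>V\<^esub> prd_map V S (m b c d) (Idn V (H a b)) =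
           m a c d \<cdot>\<^bsub>V\<^esub> prd_map V S (Idn V (H c d)) (m a b c) \<cdot>\<^bsub>V\<^esub> assoc)"

text \<open>The functor \<open>H\<close> on \<open>op_cat A \<times>\<^sub>c A\<close> enriches \<open>A\<close> in \<open>V\<close>: its values are the hom-objects of
  a \<open>V\<close>-category, \<open>\<theta>\<close> is an isomorphism, identical on objects, from \<open>A\<close> to the underlying
  category of the latter (with arrows \<open>1 \<rightarrow> H a b\<close>), and \<open>H (p, q)\<close> is the operation
  \<open>h \<mapsto> q \<cdot> h \<cdot> p\<close> of the \<open>V\<close>-category.  The cartesian structure of \<open>V\<close>, unique up to unique
  isomorphism, is part of what is asserted to exist.\<close>

definition enriches :: "('v, 'w) cat \<Rightarrow> ('o, 'a) cat \<Rightarrow> ('o \<times> 'o, 'a \<times> 'a, 'v, 'w) fctr \<Rightarrow> bool" where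
  "enriches V A H \<longleftrightarrow> is_functor (op_cat A \<times>\<^sub>c A) V H \<and>
     (\<exists>S m e \<theta>. enriched_category V S (Obj A) (\<lambda>a b. fob H (a, b)) m e \<and>
        (\<forall>a \<in> Obj A. \<forall>b \<in> Obj A. bij_betw \<theta> (hom A a b) (hom V (tm S) (fob H (a, b)))) \<and>
        (\<forall>a \<in> Obj A. \<theta> (Idn A a) = e a) \<and>
        (\<forall>a b c. \<forall>f \<in> hom A a b. \<forall>g \<in> hom A b c.
           \<theta> (g \<cdot>\<^bsub>A\<^esub> f) = m a b c \<cdot>\<^bsub>V\<^esub> tup V S (\<theta> g) (\<theta> f)) \<and>
        (\<forall>a' a b b'. \<forall>p \<in> hom A a' a. \<forall>q \<in> hom A b b'.
           let h = fob H (a, b); t = bang V (tm S) h in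
           far H (p, q) = m a' a b' \<cdot>\<^bsub>V\<^esub>
             tup V S (m a b b' \<cdot>\<^bsub>V\<^esub> tup V S (\<theta> q \<cdot>\<^bsub>V\<^esub> t) (Idn V h)) (\<theta> p \<cdot>\<^bsub>V\<^esub> t)))"


section \<open>Indexed categories and indexed functors\<close>

text \<open>A pseudofunctor from \<open>op_cat C\<close> to categories.  For \<open>f : X \<rightarrow> Y\<close> and \<open>g : Y \<rightarrow> Z\<close>,
  the structural isomorphisms are \<open>ucell X M : M \<rightarrow> id\<^sub>X \<cdot> M\<close> and
  \<open>ccell f g M : f \<cdot> (g \<cdot> M) \<rightarrow> (g \<cdot> f) \<cdot> M\<close>.\<close>

record ('c, 'h, 'o, 'a) icat =
  fib :: "'c \<Rightarrow> ('o, 'a) cat"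
  sub :: "'h \<Rightarrow> ('o, 'a, 'o, 'a) fctr"
  ucell :: "'c \<Rightarrow> 'o \<Rightarrow> 'a"
  ccell :: "'h \<Rightarrow> 'h \<Rightarrow> 'o \<Rightarrow> 'a"

definition indexed_category :: "('c, 'h) cat \<Rightarrow> ('c, 'h, 'o, 'a) icat \<Rightarrow> bool" where
  "indexed_category C M \<longleftrightarrow> category C \<and>
     (\<forall>X \<in> Obj C. category (fib M X)) \<and>
     (\<forall>X Y. \<forall>f \<in> hom C X Y. is_functor (fib M Y) (fib M X) (sub M f)) \<and>
     (\<forall>X \<in> Obj C. nat_iso (fib M X) (fib M X) idf (sub M (Idn C X)) (ucell M X)) \<and>
     (\<forall>X Y Z. \<forall>f \<in> hom C X Y. \<forall>g \<in> hom C Y Z.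
        nat_iso (fib M Z) (fib M X) (sub M f \<circ>\<^sub>f sub M g) (sub M (g \<cdot>\<^bsub>C\<^esub> f)) (ccell M f g)) \<and>
     (\<forall>X Y. \<forall>f \<in> hom C X Y. \<forall>A \<in> Obj (fib M Y).
        ccell M (Idn C X) f A \<cdot>\<^bsub>fib M X\<^esub> ucell M X (fob (sub M f) A) = Idn (fib M X) (fob (sub M f) A) \<and>
        ccell M f (Idn C Y) A \<cdot>\<^bsub>fib M X\<^esub> far (sub M f) (ucell M Y A) = Idn (fib M X) (fob (sub M f) A)) \<and>
     (\<forall>W X Y Z. \<forall>f \<in> hom C W X. \<forall>g \<in> hom C X Y. \<forall>h \<in> hom C Y Z. \<forall>A \<in> Obj (fib M Z).
        ccell M (g \<cdot>\<^bsub>C\<^esub> f) h A \<cdot>\<^bsub>fib M W\<^esub> ccell M f g (fob (sub M h) A) =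
        ccell M f (h \<cdot>\<^bsub>C\<^esub> g) A \<cdot>\<^bsub>fib M W\<^esub> far (sub M f) (ccell M g h A))"

text \<open>A pseudonatural transformation: functors \<open>i\<^sub>X\<close> with isomorphisms
  \<open>scell f A : i\<^sub>X (f \<cdot> A) \<rightarrow> f\<^sup>* (i\<^sub>Y A)\<close> for \<open>f : X \<rightarrow> Y\<close>.\<close>

record ('c, 'h, 'o, 'a, 'p, 'b) ifun =
  at_ob :: "'c \<Rightarrow> ('o, 'a, 'p, 'b) fctr"
  scell :: "'h \<Rightarrow> 'o \<Rightarrow> 'b"

definition indexed_functor :: "('c, 'h) cat \<Rightarrow> ('c, 'h, 'o, 'a) icat \<Rightarrow> ('c, 'h, 'p, 'b) icat
    \<Rightarrow> ('c, 'h, 'o, 'a, 'p, 'b) ifun \<Rightarrow> bool" where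
  "indexed_functor C M P I \<longleftrightarrow>
     (\<forall>X \<in> Obj C. is_functor (fib M X) (fib P X) (at_ob I X)) \<and>
     (\<forall>X Y. \<forall>f \<in> hom C X Y.
        nat_iso (fib M Y) (fib P X) (at_ob I X \<circ>\<^sub>f sub M f) (sub P f \<circ>\<^sub>f at_ob I Y) (scell I f)) \<and>
     (\<forall>X \<in> Obj C. \<forall>A \<in> Obj (fib M X).
        scell I (Idn C X) A \<cdot>\<^bsub>fib P X\<^esub> far (at_ob I X) (ucell M X A) = ucell P X (fob (at_ob I X) A)) \<and>
     (\<forall>X Y Z. \<forall>f \<in> hom C X Y. \<forall>g \<in> hom C Y Z. \<forall>A \<in> Obj (fib M Z).
        scell I (g \<cdot>\<^bsub>C\<^esub> f) A \<cdot>\<^bsub>fib P X\<^esub> far (at_ob I X) (ccell M f g A) =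
        ccell P f g (fob (at_ob I Z) A) \<cdot>\<^bsub>fib P X\<^esub> far (sub P f) (scell I g A)
          \<cdot>\<^bsub>fib P X\<^esub> scell I f (fob (sub M g) A))"


section \<open>Temporal doctrines\<close>

text \<open>Adjoints are chosen functors.  Units and counits are part of the data only where
  an axiom refers to them: \<open>\<Sigma>\<^sub>f \<stileturn> f\<^sup>*\<close> and the units of the reflections \<open>\<Diamond>\<close>, \<open>\<Diamond>'\<close>.\<close>

record ('c, 'h, 'p, 'q, 'm, 'n, 'k, 'l) doctrine =
  base :: "('c, 'h) cat"
  one_ob :: 'c
  PI :: "('c, 'h, 'p, 'q) icat"
  MI :: "('c, 'h, 'm, 'n) icat"
  MI' :: "('c, 'h, 'k, 'l) icat"
  inc :: "('c, 'h, 'm, 'n, 'p, 'q) ifun"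
  inc' :: "('c, 'h, 'k, 'l, 'p, 'q) ifun"
  cc :: "'c \<Rightarrow> ('p, 'q) ccart"
  Sig :: "'h \<Rightarrow> ('p, 'q, 'p, 'q) fctr"
  Sig_unit :: "'h \<Rightarrow> 'p \<Rightarrow> 'q"
  Sig_counit :: "'h \<Rightarrow> 'p \<Rightarrow> 'q"
  Pii :: "'h \<Rightarrow> ('p, 'q, 'p, 'q) fctr"
  Dia :: "'c \<Rightarrow> ('p, 'q, 'm, 'n) fctr"
  Dia_unit :: "'c \<Rightarrow> 'p \<Rightarrow> 'q"
  Dia_counit :: "'c \<Rightarrow> 'm \<Rightarrow> 'n"
  Box :: "'c \<Rightarrow> ('p, 'q, 'm, 'n) fctr"
  Dia' :: "'c \<Rightarrow> ('p, 'q, 'k, 'l) fctr"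
  Dia'_unit :: "'c \<Rightarrow> 'p \<Rightarrow> 'q"
  Dia'_counit :: "'c \<Rightarrow> 'k \<Rightarrow> 'l"
  Box' :: "'c \<Rightarrow> ('p, 'q, 'k, 'l) fctr"
  compr :: "'c \<Rightarrow> ('p, 'q, 'h, 'h \<times> 'h \<times> 'h) fctr"

abbreviation PP where "PP D X \<equiv> fib (PI D) X"
abbreviation MM where "MM D X \<equiv> fib (MI D) X"
abbreviation MM' where "MM' D X \<equiv> fib (MI' D) X"
abbreviation pull where "pull D f \<equiv> sub (PI D) f"
abbreviation act where "act D f \<equiv> sub (MI D) f"
abbreviation act' where "act' D f \<equiv> sub (MI' D) f"
abbreviation i_fun where "i_fun D X \<equiv> at_ob (inc D) X"
abbreviation i'_fun where "i'_fun D X \<equiv> at_ob (inc' D) X"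

definition BB where
  "BB D X = pseudo_pullback (MM D X) (MM' D X) (PP D X) (i_fun D X) (i'_fun D X)"

definition j_fun :: "('o1 \<times> 'o2 \<times> 'b, ('o1 \<times> 'o2 \<times> 'b) \<times> ('a1 \<times> 'a2) \<times> ('o1 \<times> 'o2 \<times> 'b), 'o1, 'a1) fctr" where
  "j_fun = \<lparr>fob = (\<lambda>(m, n, \<phi>). m), far = (\<lambda>(s, (u, v), t). u)\<rparr>"

definition j'_fun :: "('o1 \<times> 'o2 \<times> 'b, ('o1 \<times> 'o2 \<times> 'b) \<times> ('a1 \<times> 'a2) \<times> ('o1 \<times> 'o2 \<times> 'b), 'o2, 'a2) fctr" where
  "j'_fun = \<lparr>fob = (\<lambda>(m, n, \<phi>). n), far = (\<lambda>(s, (u, v), t). v)\<rparr>"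

text \<open>Of the two canonically isomorphic composites \<open>i\<^sub>X j\<^sub>X\<close> and \<open>i'\<^sub>X j'\<^sub>X\<close>, \<open>b\<^sub>X\<close> is taken to be
  the first.\<close>

definition b_fun where "b_fun D X = i_fun D X \<circ>\<^sub>f j_fun"

text \<open>For \<open>g \<cdot> u = f\<close> with \<open>u : T \<rightarrow> S\<close>, the functor \<open>c\<^sub>X\<close> gives the transpose \<open>\<Sigma>\<^sub>f 1\<^sub>T \<rightarrow> \<Sigma>\<^sub>g 1\<^sub>S\<close> of
  \<open>1\<^sub>T \<cong> u\<^sup>* 1\<^sub>S \<rightarrow> u\<^sup>* g\<^sup>* \<Sigma>\<^sub>g 1\<^sub>S \<cong> f\<^sup>* \<Sigma>\<^sub>g 1\<^sub>S\<close>.  The isomorphism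
  \<open>1\<^sub>T \<cong> u\<^sup>* 1\<^sub>S\<close> is the unique arrow between these terminal objects.\<close>

definition c_ob where
  "c_ob D f = fob (Sig D f) (tm (cc D (Dom (base D) f)))"

definition c_arr where
  "c_arr D f u g =
    (let T = Dom (base D) f; S = Dom (base D) g; P = PP D T in
     Sig_counit D f (c_ob D g) \<cdot>\<^bsub>PP D (Cod (base D) f)\<^esub>
     far (Sig D f)
       (ccell (PI D) u g (c_ob D g) \<cdot>\<^bsub>P\<^esub> far (pull D u) (Sig_unit D g (tm (cc D S)))
          \<cdot>\<^bsub>P\<^esub> bang P (fob (pull D u) (tm (cc D S))) (tm (cc D T))))"

definition c_fun where
  "c_fun D = \<lparr>fob = c_ob D, far = (\<lambda>(f, u, g). c_arr D f u g)\<rparr>"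

text \<open>The canonical arrow \<open>\<Sigma>\<^sub>f (P \<times> f\<^sup>* Q) \<rightarrow> \<Sigma>\<^sub>f P \<times> Q\<close>.\<close>

definition frobenius where
  "frobenius D f P Q =
    (let X = Dom (base D) f; Y = Cod (base D) f; fQ = fob (pull D f) Q in
     tup (PP D Y) (cc D Y)
       (far (Sig D f) (pr1 (cc D X) P fQ))
       (Sig_counit D f Q \<cdot>\<^bsub>PP D Y\<^esub> far (Sig D f) (pr2 (cc D X) P fQ)))"

locale temporal_doctrine =
  fixes D :: "('c, 'h, 'p, 'q, 'm, 'n, 'k, 'l) doctrine"
  assumes base_category: "category (base D)"
    and P_indexed: "indexed_category (base D) (PI D)"
    and M_indexed: "indexed_category (base D) (MI D)"
    and M'_indexed: "indexed_category (base D) (MI' D)"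
    and i_indexed: "indexed_functor (base D) (MI D) (PI D) (inc D)"
    and i'_indexed: "indexed_functor (base D) (MI' D) (PI D) (inc' D)"
    and A1: "terminal (base D) (one_ob D)"
    and A2: "X \<in> Obj (base D) \<Longrightarrow> cartesian_closed (PP D X) (cc D X)"
    and A3_Sig: "f \<in> hom (base D) X Y
      \<Longrightarrow> adjunction (PP D X) (PP D Y) (Sig D f) (pull D f) (Sig_unit D f) (Sig_counit D f)"
    and A3_Pi: "f \<in> hom (base D) X Y \<Longrightarrow> adjoint (PP D Y) (PP D X) (pull D f) (Pii D f)"
    and A4_Dia: "X \<in> Obj (base D)
      \<Longrightarrow> adjunction (PP D X) (MM D X) (Dia D X) (i_fun D X) (Dia_unit D X) (Dia_counit D X)"
    and A4_Box: "X \<in> Obj (base D) \<Longrightarrow> adjoint (MM D X) (PP D X) (i_fun D X) (Box D X)"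
    and A4_Dia': "X \<in> Obj (base D)
      \<Longrightarrow> adjunction (PP D X) (MM' D X) (Dia' D X) (i'_fun D X) (Dia'_unit D X) (Dia'_counit D X)"
    and A4_Box': "X \<in> Obj (base D) \<Longrightarrow> adjoint (MM' D X) (PP D X) (i'_fun D X) (Box' D X)"
    and A5: "X \<in> Obj (base D) \<Longrightarrow> adjoint (slice (base D) X) (PP D X) (c_fun D) (compr D X)"
    and B1: "X \<in> Obj (base D) \<Longrightarrow> fully_faithful (MM D X) (PP D X) (i_fun D X)"
    and B1': "X \<in> Obj (base D) \<Longrightarrow> fully_faithful (MM' D X) (PP D X) (i'_fun D X)"
    and B2: "f \<in> hom (base D) X Y \<Longrightarrow> P \<in> Obj (PP D X) \<Longrightarrow> Q \<in> Obj (PP D Y)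
      \<Longrightarrow> is_iso (PP D Y) (frobenius D f P Q)"
    and B3: "X \<in> Obj (base D) \<Longrightarrow> P \<in> Obj (PP D X) \<Longrightarrow> N \<in> Obj (MM' D X)
      \<Longrightarrow> is_iso (MM D X) (far (Dia D X)
            (prd_map (PP D X) (cc D X) (Dia_unit D X P) (Idn (PP D X) (fob (i'_fun D X) N))))"
    and B3': "X \<in> Obj (base D) \<Longrightarrow> P \<in> Obj (PP D X) \<Longrightarrow> M \<in> Obj (MM D X)
      \<Longrightarrow> is_iso (MM' D X) (far (Dia' D X)
            (prd_map (PP D X) (cc D X) (Dia'_unit D X P) (Idn (PP D X) (fob (i_fun D X) M))))"
    \<comment> \<open>As \<open>BB\<close> is a pullback up to isomorphism, its projections can be invertible only up to
        isomorphism.\<close>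
    and B4: "equivalence (BB D (one_ob D)) (MM D (one_ob D)) j_fun"
    and B4': "equivalence (BB D (one_ob D)) (MM' D (one_ob D)) j'_fun"
    and B5: "X \<in> Obj (base D) \<Longrightarrow> fully_faithful (PP D X) (slice (base D) X) (compr D X)"

text \<open>\<open>\<exists>\<^sub>f\<close>, \<open>\<forall>\<^sub>f\<close>, \<open>\<exists>'\<^sub>f\<close>, \<open>\<forall>'\<^sub>f\<close>\<close>

definition Exf where
  "Exf D f = Dia D (Cod (base D) f) \<circ>\<^sub>f Sig D f \<circ>\<^sub>f i_fun D (Dom (base D) f)"
definition Allf where
  "Allf D f = Box D (Cod (base D) f) \<circ>\<^sub>f Pii D f \<circ>\<^sub>f i_fun D (Dom (base D) f)"
definition Exf' where
  "Exf' D f = Dia' D (Cod (base D) f) \<circ>\<^sub>f Sig D f \<circ>\<^sub>f i'_fun D (Dom (base D) f)"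
definition Allf' where
  "Allf' D f = Box' D (Cod (base D) f) \<circ>\<^sub>f Pii D f \<circ>\<^sub>f i'_fun D (Dom (base D) f)"

text \<open>\<open>B1\<close> and the functor \<open>X\<^sup>* b\<^sub>1\<close>, with a left adjoint \<open>coend\<^sub>X\<close> and a right adjoint \<open>end\<^sub>X\<close>.
  In a temporal doctrine these adjoints exist, since \<open>X\<^sup>* i\<^sub>1 \<cong> i\<^sub>X (X \<cdot> _)\<close>: they are
  \<open>j\<^sub>1\<^sup>-\<^sup>1 \<exists>\<^sub>X \<Diamond>\<^sub>X\<close> and \<open>j\<^sub>1\<^sup>-\<^sup>1 \<forall>\<^sub>X \<box>\<^sub>X\<close>, with \<open>j\<^sub>1\<^sup>-\<^sup>1\<close> a quasi-inverse of \<open>j\<^sub>1\<close>.\<close>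

abbreviation B_one where "B_one D \<equiv> BB D (one_ob D)"

definition Xb where
  "Xb D X = pull D (bang (base D) (one_ob D) X) \<circ>\<^sub>f b_fun D (one_ob D)"

definition coend_fun where
  "coend_fun D X = (SOME F. adjoint (PP D X) (B_one D) F (Xb D X))"

definition end_fun where
  "end_fun D X = (SOME G. adjoint (B_one D) (PP D X) (Xb D X) G)"

definition meets where
  "meets D X = coend_fun D X \<circ>\<^sub>f prd_fun (PP D X) (cc D X)"

definition homs where
  "homs D X = end_fun D X \<circ>\<^sub>f exp_fun (PP D X) (cc D X)"

definition ten where
  "ten D X = meets D X \<circ>\<^sub>f (i'_fun D X \<times>\<^sub>f i_fun D X)"

definition nats where
  "nats D X = homs D X \<circ>\<^sub>f (i_fun D X \<times>\<^sub>f i_fun D X)"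

definition nats' where
  "nats' D X = homs D X \<circ>\<^sub>f (i'_fun D X \<times>\<^sub>f i'_fun D X)"

end

theory Submission
  imports Defs
begin

text \<open>Write \<open>V = \<B>1\<close> and \<open>U = X\<^sup>* b\<^sub>1 : V \<rightarrow> \<P>X\<close>. As \<open>end\<^sub>X\<close> is right adjoint to \<open>U\<close>, there are natural
  bijections \<open>V (v, hom\<^sub>X (P, Q)) \<cong> \<P>X (U v \<times> P, Q)\<close>; likewise \<open>V (meets\<^sub>X (P, Q), v) \<cong> \<P>X (P \<times> Q, U v)\<close>.
  By the Yoneda lemma, each isomorphism of the proposition reduces to a natural bijection between
  hom-sets in the fibres. These come from the adjunctions, the Frobenius laws, and two facts
  about \<open>U\<close>: it is compatible with substitution, and it factors up to isomorphism through both \<open>i\<^sub>X\<close>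
  and \<open>i'\<^sub>X\<close>. Because of the latter, the objects \<open>U v \<times> i\<^sub>X M\<close> lie in the replete image of \<open>i\<^sub>X\<close>,
  as this image is reflective and hence closed under products, and the mixed Frobenius laws apply to \<open>U v \<times> P\<close>.

  The enrichment exists because the functors \<open>U v \<times> _\<close> form comonads, natural in \<open>v\<close>, whose coKleisli
  composition is represented by the objects \<open>hom\<^sub>X (P, Q)\<close>; the underlying category is \<open>\<P>X\<close> since
  \<open>U\<close> preserves the terminal object.\<close>

section \<open>Categories, functors and natural isomorphisms\<close>

text \<open>\<open>coend_fun\<close> and \<open>end_fun\<close> are arbitrary choices of adjoints,
  and \<open>j_fun\<close> is invertible only up to isomorphism, so no formula for them can be
  unfolded: every comparison has to go through universal properties. Hence the calculus of natural
  bijections \<open>prof_iso\<close> between hom-sets C(L j, R k) and C'(L' j, R' k). In it,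
  transposition along an adjunction, application of a fully faithful functor and replacement of a
  functor by an isomorphic one are steps of the same kind, and they compose without any manipulation
  of units and counits.

  The two factorizations of \<open>U\<close> have different tasks. For \<Diamond> the one through
  the other inclusion is needed, as a mixed law speaks of a factor in the image of that inclusion;
  for \<box> it is the one through the same inclusion.

  The isomorphisms for quantifiers require no new argument: \<exists> and \<forall> are composites,
  so pasting change of fibre with the isomorphisms over the codomain suffices.

  The comonad structure of U v \<times> _ uses only projections and tuples, so the laws of the
  enrichment reduce to equations between tuples.\<close>

lemma ex1_eqI: "\<exists>!x. P x \<Longrightarrow> P a \<Longrightarrow> P b \<Longrightarrow> a = b"
  by blast

lemma in_hom: "f \<in> hom C a b \<longleftrightarrow> f \<in> Arr C \<and> Dom C f = a \<and> Cod C f = b"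
  by (simp add: hom_def)

context category
begin

declare dom_obj [simp] cod_obj [simp]

lemma id_arr [simp]:
  assumes "a \<in> Obj C"
  shows "Idn C a \<in> Arr C" "Dom C (Idn C a) = a" "Cod C (Idn C a) = a"
  using id_hom[OF assms] by (simp_all add: in_hom)

lemma cmp_arr [simp]:
  assumes "f \<in> Arr C" "g \<in> Arr C" "Cod C f = Dom C g"
  shows "g \<cdot> f \<in> Arr C" "Dom C (g \<cdot> f) = Dom C f" "Cod C (g \<cdot> f) = Cod C g"
  using cmp_hom[of f "Dom C f" "Dom C g" g "Cod C g"] assms by (simp_all add: in_hom)

lemma cmp_id_left [simp]: "f \<in> Arr C \<Longrightarrow> Cod C f = b \<Longrightarrow> Idn C b \<cdot> f = f"
  using id_left[of f "Dom C f" b] by (simp add: in_hom)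

lemma cmp_id_right [simp]: "f \<in> Arr C \<Longrightarrow> Dom C f = a \<Longrightarrow> f \<cdot> Idn C a = f"
  using id_right[of f a "Cod C f"] by (simp add: in_hom)

lemma cmp_assoc [simp]:
  "f \<in> Arr C \<Longrightarrow> g \<in> Arr C \<Longrightarrow> h \<in> Arr C \<Longrightarrow> Cod C f = Dom C g \<Longrightarrow> Cod C g = Dom C h
    \<Longrightarrow> (h \<cdot> g) \<cdot> f = h \<cdot> (g \<cdot> f)"
  using assoc[of f "Dom C f" "Dom C g" g "Dom C h" h "Cod C h"] by (simp add: in_hom)

text \<open>Composites are normalized to the right by \<open>cmp_assoc\<close>, so an equation
  between binary composites no longer matches inside a longer one. The tail \<open>x\<close> makes
  it usable there; \<open>cmp_eq_assoc1\<close> is the variant with a single arrow on the right-hand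
  side.\<close>

lemma cmp_eq_assoc:
  assumes "g \<cdot> f = k \<cdot> h" "f \<in> Arr C" "g \<in> Arr C" "h \<in> Arr C" "k \<in> Arr C"
    "Cod C f = Dom C g" "Cod C h = Dom C k" "x \<in> Arr C" "Cod C x = Dom C f"
  shows "g \<cdot> (f \<cdot> x) = k \<cdot> (h \<cdot> x)"
proof -
  have "Dom C h = Dom C f" using assms cmp_arr(2)[of f g] cmp_arr(2)[of h k] by simp
  then show ?thesis
    using assms cmp_assoc[of x f g] cmp_assoc[of x h k] by simp
qed

lemma cmp_eq_assoc1:
  assumes "g \<cdot> f = k" "f \<in> Arr C" "g \<in> Arr C" "Cod C f = Dom C g" "x \<in> Arr C" "Cod C x = Dom C f"
  shows "g \<cdot> (f \<cdot> x) = k \<cdot> x"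
  using assms cmp_assoc[of x f g] by simp

end

lemma is_isoE:
  assumes "is_iso C f"
  obtains g where "g \<in> Arr C" "f \<in> Arr C" "Dom C g = Cod C f" "Cod C g = Dom C f"
    "g \<cdot>\<^bsub>C\<^esub> f = Idn C (Dom C f)" "f \<cdot>\<^bsub>C\<^esub> g = Idn C (Cod C f)"
  using assms by (auto simp: is_iso_def in_hom)

lemma is_isoI:
  assumes "f \<in> Arr C" "g \<in> Arr C" "Dom C g = Cod C f" "Cod C g = Dom C f"
    "g \<cdot>\<^bsub>C\<^esub> f = Idn C (Dom C f)" "f \<cdot>\<^bsub>C\<^esub> g = Idn C (Cod C f)"
  shows "is_iso C f"
  using assms by (auto simp: is_iso_def in_hom)

lemma (in category) is_iso_cmp:
  assumes "is_iso C f" "is_iso C g" "Cod C f = Dom C g"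
  shows "is_iso C (g \<cdot> f)"
proof -
  obtain f' where f: "f' \<in> Arr C" "f \<in> Arr C" "Dom C f' = Cod C f" "Cod C f' = Dom C f"
    "f' \<cdot> f = Idn C (Dom C f)" "f \<cdot> f' = Idn C (Cod C f)" using assms(1) by (rule is_isoE)
  obtain g' where g: "g' \<in> Arr C" "g \<in> Arr C" "Dom C g' = Cod C g" "Cod C g' = Dom C g"
    "g' \<cdot> g = Idn C (Dom C g)" "g \<cdot> g' = Idn C (Cod C g)" using assms(2) by (rule is_isoE)
  show ?thesis
    using f g assms(3) cmp_eq_assoc1[OF g(5), of f] cmp_eq_assoc1[OF f(6), of g']
    by (intro is_isoI[of _ _ "f' \<cdot> g'"]) simp_all
qed

lemma (in category) is_iso_id: "a \<in> Obj C \<Longrightarrow> is_iso C (Idn C a)"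
  by (intro is_isoI[of _ _ "Idn C a"]) simp_all

section \<open>Functors, opposite categories and products of categories\<close>

locale func =
  fixes C :: "('o, 'a) cat" and D :: "('p, 'b) cat" and F :: "('o, 'a, 'p, 'b) fctr"
  assumes is_func: "is_functor C D F"
begin

sublocale C: category C using is_func by (simp add: is_functor_def)
sublocale D: category D using is_func by (simp add: is_functor_def)

lemma fob [simp]: "a \<in> Obj C \<Longrightarrow> fob F a \<in> Obj D"
  using is_func by (simp add: is_functor_def)

lemma far [simp]:
  assumes "f \<in> Arr C"
  shows "far F f \<in> Arr D" "Dom D (far F f) = fob F (Dom C f)" "Cod D (far F f) = fob F (Cod C f)"
proof -
  have "far F f \<in> hom D (fob F (Dom C f)) (fob F (Cod C f))"
    using is_func assms unfolding is_functor_def by (auto simp: in_hom)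
  then show "far F f \<in> Arr D" "Dom D (far F f) = fob F (Dom C f)"
    "Cod D (far F f) = fob F (Cod C f)"
    by (simp_all add: in_hom)
qed

lemma far_id [simp]: "a \<in> Obj C \<Longrightarrow> far F (Idn C a) = Idn D (fob F a)"
  using is_func by (simp add: is_functor_def)

lemma far_cmp [simp]:
  "f \<in> Arr C \<Longrightarrow> g \<in> Arr C \<Longrightarrow> Cod C f = Dom C g \<Longrightarrow> far F (g \<cdot>\<^bsub>C\<^esub> f) = far F g \<cdot>\<^bsub>D\<^esub> far F f"
  using is_func unfolding is_functor_def by (auto simp: in_hom)

lemma far_square:
  assumes "g \<cdot>\<^bsub>C\<^esub> f = k \<cdot>\<^bsub>C\<^esub> h" "f \<in> Arr C" "g \<in> Arr C" "h \<in> Arr C" "k \<in> Arr C"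
    "Cod C f = Dom C g" "Cod C h = Dom C k"
  shows "far F g \<cdot>\<^bsub>D\<^esub> far F f = far F k \<cdot>\<^bsub>D\<^esub> far F h"
  using assms far_cmp by metis

lemma is_iso_far:
  assumes "is_iso C f" shows "is_iso D (far F f)"
proof -
  obtain f' where f: "f' \<in> Arr C" "f \<in> Arr C" "Dom C f' = Cod C f" "Cod C f' = Dom C f"
    "f' \<cdot>\<^bsub>C\<^esub> f = Idn C (Dom C f)" "f \<cdot>\<^bsub>C\<^esub> f' = Idn C (Cod C f)" using assms by (rule is_isoE)
  show ?thesis
    using f far_cmp[of f f'] far_cmp[of f' f] by (intro is_isoI[of _ _ "far F f'"]) simp_all
qed

end

lemma is_functorI:
  assumes "category C" "category D"
    and "\<And>a. a \<in> Obj C \<Longrightarrow> fob F a \<in> Obj D"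
    and "\<And>f. f \<in> Arr C \<Longrightarrow> far F f \<in> Arr D \<and> Dom D (far F f) = fob F (Dom C f)
      \<and> Cod D (far F f) = fob F (Cod C f)"
    and "\<And>a. a \<in> Obj C \<Longrightarrow> far F (Idn C a) = Idn D (fob F a)"
    and "\<And>f g. f \<in> Arr C \<Longrightarrow> g \<in> Arr C \<Longrightarrow> Cod C f = Dom C g
      \<Longrightarrow> far F (g \<cdot>\<^bsub>C\<^esub> f) = far F g \<cdot>\<^bsub>D\<^esub> far F f"
  shows "is_functor C D F"
  using assms unfolding is_functor_def by (auto simp: in_hom)

lemma idf_simps [simp]: "fob idf a = a" "far idf f = f"
  by (simp_all add: idf_def)

lemma fcomp_simps [simp]: "fob (G \<circ>\<^sub>f F) a = fob G (fob F a)" "far (G \<circ>\<^sub>f F) f = far G (far F f)"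
  by (simp_all add: fcomp_def)

lemma fprod_simps [simp]:
  "fob (F \<times>\<^sub>f G) (a, b) = (fob F a, fob G b)" "far (F \<times>\<^sub>f G) (f, g) = (far F f, far G g)"
  by (simp_all add: fprod_def)

text \<open>A functor is a record of two total HOL functions, so this holds as an equation, with no
  hypothesis that the arguments are functors. Composites of functors are therefore rearranged by
  \<open>simp\<close>, and isomorphisms are tracked only where the mathematics demands them.\<close>

lemma fcomp_assoc [simp]: "(H \<circ>\<^sub>f G) \<circ>\<^sub>f F = H \<circ>\<^sub>f G \<circ>\<^sub>f F"
  by (simp add: fcomp_def comp_assoc)

lemma fcomp_idf [simp]: "idf \<circ>\<^sub>f F = F" "F \<circ>\<^sub>f idf = F"
  by (simp_all add: fcomp_def idf_def comp_def)

lemma fprod_fcomp [simp]: "(F \<times>\<^sub>f G) \<circ>\<^sub>f (F' \<times>\<^sub>f G') = (F \<circ>\<^sub>f F') \<times>\<^sub>f (G \<circ>\<^sub>f G')"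
  by (simp add: fcomp_def fprod_def map_prod_compose)

lemma prod_cat_simps [simp]:
  "Obj (C \<times>\<^sub>c D) = Obj C \<times> Obj D" "Arr (C \<times>\<^sub>c D) = Arr C \<times> Arr D"
  "Dom (C \<times>\<^sub>c D) (f, g) = (Dom C f, Dom D g)" "Cod (C \<times>\<^sub>c D) (f, g) = (Cod C f, Cod D g)"
  "Idn (C \<times>\<^sub>c D) (a, b) = (Idn C a, Idn D b)"
  "(f', g') \<cdot>\<^bsub>C \<times>\<^sub>c D\<^esub> (f, g) = (f' \<cdot>\<^bsub>C\<^esub> f, g' \<cdot>\<^bsub>D\<^esub> g)"
  by (simp_all add: prod_cat_def)

lemma op_cat_simps [simp]:
  "Obj (op_cat C) = Obj C" "Arr (op_cat C) = Arr C" "Dom (op_cat C) = Cod C"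
  "Cod (op_cat C) = Dom C" "Idn (op_cat C) = Idn C" "g \<cdot>\<^bsub>op_cat C\<^esub> f = f \<cdot>\<^bsub>C\<^esub> g"
  by (simp_all add: op_cat_def)

lemma category_op_cat:
  assumes "category C" shows "category (op_cat C)"
proof -
  interpret category C by fact
  show ?thesis by unfold_locales (auto simp: in_hom)
qed

lemma category_prod_cat:
  assumes "category C" "category D" shows "category (C \<times>\<^sub>c D)"
proof -
  interpret C: category C by fact
  interpret D: category D by fact
  show ?thesis by unfold_locales (auto simp: in_hom)
qed

lemma is_functor_idf: "category C \<Longrightarrow> is_functor C C idf"
  by (rule is_functorI) auto

lemma is_functor_fcomp:
  assumes "is_functor C D F" "is_functor D E G" shows "is_functor C E (G \<circ>\<^sub>f F)"
proof -
  interpret F: func C D F by unfold_locales fact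
  interpret G: func D E G by unfold_locales fact
  show ?thesis by (rule is_functorI) (simp_all add: F.C.category_axioms G.D.category_axioms)
qed

lemma is_functor_fprod:
  assumes "is_functor C D F" "is_functor C' D' G" shows "is_functor (C \<times>\<^sub>c C') (D \<times>\<^sub>c D') (F \<times>\<^sub>f G)"
proof -
  interpret F: func C D F by unfold_locales fact
  interpret G: func C' D' G by unfold_locales fact
  show ?thesis
    by (rule is_functorI)
      (auto simp: F.C.category_axioms G.D.category_axioms F.D.category_axioms G.C.category_axioms
        intro!: category_prod_cat)
qed

lemma is_functor_op:
  assumes "is_functor C D F" shows "is_functor (op_cat C) (op_cat D) F"
proof -
  interpret F: func C D F by unfold_locales fact
  show ?thesis
    by (rule is_functorI) (auto simp: F.C.category_axioms F.D.category_axioms intro!: category_op_cat)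
qed

lemma is_functorD: "is_functor C D F \<Longrightarrow> category C" "is_functor C D F \<Longrightarrow> category D"
  by (simp_all add: is_functor_def)

section \<open>Calculus of natural isomorphisms\<close>

lemma nat_transD:
  assumes "nat_trans C D F G \<tau>"
  shows "is_functor C D F" "is_functor C D G"
    "a \<in> Obj C \<Longrightarrow> \<tau> a \<in> Arr D" "a \<in> Obj C \<Longrightarrow> Dom D (\<tau> a) = fob F a"
    "a \<in> Obj C \<Longrightarrow> Cod D (\<tau> a) = fob G a"
    "f \<in> Arr C \<Longrightarrow> \<tau> (Cod C f) \<cdot>\<^bsub>D\<^esub> far F f = far G f \<cdot>\<^bsub>D\<^esub> \<tau> (Dom C f)"
  using assms unfolding nat_trans_def by (auto simp: in_hom)

lemma nat_isomorphicI:
  assumes "is_functor C D F" "is_functor C D G"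
    "\<And>a. a \<in> Obj C \<Longrightarrow> Dom D (\<tau> a) = fob F a"
    "\<And>a. a \<in> Obj C \<Longrightarrow> Cod D (\<tau> a) = fob G a"
    "\<And>a. a \<in> Obj C \<Longrightarrow> is_iso D (\<tau> a)"
    "\<And>f. f \<in> Arr C \<Longrightarrow> \<tau> (Cod C f) \<cdot>\<^bsub>D\<^esub> far F f = far G f \<cdot>\<^bsub>D\<^esub> \<tau> (Dom C f)"
  shows "nat_isomorphic C D F G"
  using assms unfolding nat_isomorphic_def nat_iso_def nat_trans_def
  by (auto simp: in_hom intro!: exI[of _ \<tau>] dest: is_isoE)

lemma nat_isomorphicE:
  assumes "nat_isomorphic C D F G"
  obtains \<tau> where "nat_trans C D F G \<tau>" "\<And>a. a \<in> Obj C \<Longrightarrow> is_iso D (\<tau> a)"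
  using assms unfolding nat_isomorphic_def nat_iso_def by blast

lemma nat_isomorphicD:
  assumes "nat_isomorphic C D F G" shows "is_functor C D F" "is_functor C D G"
  using assms by (auto elim!: nat_isomorphicE dest: nat_transD)

lemma nat_isomorphic_inverse:
  assumes "nat_isomorphic C D F G"
  obtains \<tau> \<sigma> where "nat_trans C D F G \<tau>" "nat_trans C D G F \<sigma>"
    "\<And>a. a \<in> Obj C \<Longrightarrow> \<sigma> a \<cdot>\<^bsub>D\<^esub> \<tau> a = Idn D (fob F a)"
    "\<And>a. a \<in> Obj C \<Longrightarrow> \<tau> a \<cdot>\<^bsub>D\<^esub> \<sigma> a = Idn D (fob G a)"
proof -
  obtain \<tau> where \<tau>: "nat_trans C D F G \<tau>" and iso: "\<And>a. a \<in> Obj C \<Longrightarrow> is_iso D (\<tau> a)"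
    using assms by (rule nat_isomorphicE) blast
  interpret F: func C D F by unfold_locales (rule nat_transD[OF \<tau>])
  interpret G: func C D G by unfold_locales (rule nat_transD[OF \<tau>])
  note [simp] = nat_transD(3-5)[OF \<tau>]
  have "\<exists>s. s \<in> Arr D \<and> Dom D s = fob G a \<and> Cod D s = fob F a \<and>
      s \<cdot>\<^bsub>D\<^esub> \<tau> a = Idn D (fob F a) \<and> \<tau> a \<cdot>\<^bsub>D\<^esub> s = Idn D (fob G a)" if "a \<in> Obj C" for a
    using is_isoE[OF iso[OF that]] that by (metis nat_transD(4,5)[OF \<tau>])
  then obtain \<sigma> where \<sigma>: "\<And>a. a \<in> Obj C \<Longrightarrow> \<sigma> a \<in> Arr D \<and> Dom D (\<sigma> a) = fob G a \<and>
      Cod D (\<sigma> a) = fob F a \<and> \<sigma> a \<cdot>\<^bsub>D\<^esub> \<tau> a = Idn D (fob F a) \<and> \<tau> a \<cdot>\<^bsub>D\<^esub> \<sigma> a = Idn D (fob G a)"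
    by metis
  \<comment> \<open>Inserting \<tau> \<sigma> on the right makes the naturality square of \<tau>
    applicable, after which \<sigma> \<tau> cancels on the left.\<close>
  have "\<sigma> (Cod C f) \<cdot>\<^bsub>D\<^esub> far G f = far F f \<cdot>\<^bsub>D\<^esub> \<sigma> (Dom C f)" if f: "f \<in> Arr C" for f
  proof -
    note 1 = \<sigma>[of "Cod C f"] and 2 = \<sigma>[of "Dom C f"]
    have "\<sigma> (Cod C f) \<cdot>\<^bsub>D\<^esub> far G f = \<sigma> (Cod C f) \<cdot>\<^bsub>D\<^esub> far G f \<cdot>\<^bsub>D\<^esub> \<tau> (Dom C f) \<cdot>\<^bsub>D\<^esub> \<sigma> (Dom C f)"
      using 1 2 f by simp
    also have "\<dots> = \<sigma> (Cod C f) \<cdot>\<^bsub>D\<^esub> \<tau> (Cod C f) \<cdot>\<^bsub>D\<^esub> far F f \<cdot>\<^bsub>D\<^esub> \<sigma> (Dom C f)"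
      using 1 2 f F.D.cmp_eq_assoc[OF nat_transD(6)[OF \<tau> f], of "\<sigma> (Dom C f)"] by simp
    also have "\<dots> = far F f \<cdot>\<^bsub>D\<^esub> \<sigma> (Dom C f)"
      using 1 2 f F.D.cmp_eq_assoc1[of "\<sigma> (Cod C f)" "\<tau> (Cod C f)"] by simp
    finally show ?thesis .
  qed
  then have "nat_trans C D G F \<sigma>"
    unfolding nat_trans_def using \<sigma> F.is_func G.is_func by (auto simp: in_hom)
  then show ?thesis using that[OF \<tau>] \<sigma> by blast
qed

lemma nat_isomorphicI':
  assumes \<tau>: "nat_trans C D F G \<tau>" and \<sigma>: "nat_trans C D G F \<sigma>"
    and "\<And>a. a \<in> Obj C \<Longrightarrow> \<sigma> a \<cdot>\<^bsub>D\<^esub> \<tau> a = Idn D (fob F a)"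
    and "\<And>a. a \<in> Obj C \<Longrightarrow> \<tau> a \<cdot>\<^bsub>D\<^esub> \<sigma> a = Idn D (fob G a)"
  shows "nat_isomorphic C D F G"
  using nat_transD[OF \<tau>] nat_transD[OF \<sigma>] assms
  by (intro nat_isomorphicI[of _ _ _ _ \<tau>] is_isoI[of "\<tau> _" _ "\<sigma> _"]) auto

lemma nat_isomorphic_sym: "nat_isomorphic C D F G \<Longrightarrow> nat_isomorphic C D G F"
  by (erule nat_isomorphic_inverse) (rule nat_isomorphicI')

lemma nat_isomorphic_refl:
  assumes "is_functor C D F" shows "nat_isomorphic C D F F"
proof -
  interpret F: func C D F by unfold_locales fact
  show ?thesis
    by (rule nat_isomorphicI[of _ _ _ _ "\<lambda>a. Idn D (fob F a)"])
      (simp_all add: F.is_func F.D.is_iso_id)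
qed

lemma nat_isomorphic_trans [trans]:
  assumes "nat_isomorphic C D F G" "nat_isomorphic C D G H"
  shows "nat_isomorphic C D F H"
proof -
  obtain \<tau> where \<tau>: "nat_trans C D F G \<tau>" and i: "\<And>a. a \<in> Obj C \<Longrightarrow> is_iso D (\<tau> a)"
    using assms(1) by (rule nat_isomorphicE) blast
  obtain \<sigma> where \<sigma>: "nat_trans C D G H \<sigma>" and j: "\<And>a. a \<in> Obj C \<Longrightarrow> is_iso D (\<sigma> a)"
    using assms(2) by (rule nat_isomorphicE) blast
  interpret F: func C D F by unfold_locales (rule nat_transD[OF \<tau>])
  interpret G: func C D G by unfold_locales (rule nat_transD[OF \<tau>])
  interpret H: func C D H by unfold_locales (rule nat_transD[OF \<sigma>])
  note [simp] = nat_transD(3-5)[OF \<tau>] nat_transD(3-5)[OF \<sigma>]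
  show ?thesis
  proof (rule nat_isomorphicI[of _ _ _ _ "\<lambda>a. \<sigma> a \<cdot>\<^bsub>D\<^esub> \<tau> a"])
    fix f assume f: "f \<in> Arr C"
    show "(\<sigma> (Cod C f) \<cdot>\<^bsub>D\<^esub> \<tau> (Cod C f)) \<cdot>\<^bsub>D\<^esub> far F f = far H f \<cdot>\<^bsub>D\<^esub> \<sigma> (Dom C f) \<cdot>\<^bsub>D\<^esub> \<tau> (Dom C f)"
      using f nat_transD(6)[OF \<tau> f] F.D.cmp_eq_assoc[OF nat_transD(6)[OF \<sigma> f], of "\<tau> (Dom C f)"]
      by simp
  qed (use i j in \<open>simp_all add: F.is_func H.is_func F.D.is_iso_cmp\<close>)
qed

lemma nat_isomorphic_post:
  assumes "nat_isomorphic C D F G" "is_functor D E H"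
  shows "nat_isomorphic C E (H \<circ>\<^sub>f F) (H \<circ>\<^sub>f G)"
proof -
  obtain \<tau> where \<tau>: "nat_trans C D F G \<tau>" and i: "\<And>a. a \<in> Obj C \<Longrightarrow> is_iso D (\<tau> a)"
    using assms(1) by (rule nat_isomorphicE) blast
  interpret F: func C D F by unfold_locales (rule nat_transD[OF \<tau>])
  interpret G: func C D G by unfold_locales (rule nat_transD[OF \<tau>])
  interpret H: func D E H by unfold_locales fact
  note [simp] = nat_transD(3-5)[OF \<tau>]
  show ?thesis
  proof (rule nat_isomorphicI[of _ _ _ _ "\<lambda>a. far H (\<tau> a)"])
    fix f assume f: "f \<in> Arr C"
    show "far H (\<tau> (Cod C f)) \<cdot>\<^bsub>E\<^esub> far (H \<circ>\<^sub>f F) f = far (H \<circ>\<^sub>f G) f \<cdot>\<^bsub>E\<^esub> far H (\<tau> (Dom C f))"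
      using f H.far_square[OF nat_transD(6)[OF \<tau> f]] by simp
  qed (use i in \<open>simp_all add: is_functor_fcomp[OF F.is_func H.is_func]
    is_functor_fcomp[OF G.is_func H.is_func] H.is_iso_far\<close>)
qed

lemma nat_isomorphic_pre:
  assumes "nat_isomorphic C D F G" "is_functor B C H"
  shows "nat_isomorphic B D (F \<circ>\<^sub>f H) (G \<circ>\<^sub>f H)"
proof -
  obtain \<tau> where \<tau>: "nat_trans C D F G \<tau>" and i: "\<And>a. a \<in> Obj C \<Longrightarrow> is_iso D (\<tau> a)"
    using assms(1) by (rule nat_isomorphicE) blast
  interpret H: func B C H by unfold_locales fact
  show ?thesis
  proof (rule nat_isomorphicI[of _ _ _ _ "\<lambda>a. \<tau> (fob H a)"])
    fix f assume f: "f \<in> Arr B"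
    show "\<tau> (fob H (Cod B f)) \<cdot>\<^bsub>D\<^esub> far (F \<circ>\<^sub>f H) f = far (G \<circ>\<^sub>f H) f \<cdot>\<^bsub>D\<^esub> \<tau> (fob H (Dom B f))"
      using f nat_transD(6)[OF \<tau>, of "far H f"] by simp
  qed (use i in \<open>simp_all add: is_functor_fcomp[OF H.is_func nat_transD(1)[OF \<tau>]]
    is_functor_fcomp[OF H.is_func nat_transD(2)[OF \<tau>]] nat_transD(3-5)[OF \<tau>]\<close>)
qed

lemma nat_isomorphic_fprod:
  assumes "nat_isomorphic C D F G" "nat_isomorphic C' D' F' G'"
  shows "nat_isomorphic (C \<times>\<^sub>c C') (D \<times>\<^sub>c D') (F \<times>\<^sub>f F') (G \<times>\<^sub>f G')"
proof -
  obtain \<tau> \<sigma> where \<tau>: "nat_trans C D F G \<tau>" and \<sigma>: "nat_trans C D G F \<sigma>" and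
    i: "\<And>a. a \<in> Obj C \<Longrightarrow> \<sigma> a \<cdot>\<^bsub>D\<^esub> \<tau> a = Idn D (fob F a)"
    "\<And>a. a \<in> Obj C \<Longrightarrow> \<tau> a \<cdot>\<^bsub>D\<^esub> \<sigma> a = Idn D (fob G a)"
    using assms(1) by (rule nat_isomorphic_inverse) blast
  obtain \<tau>' \<sigma>' where \<tau>': "nat_trans C' D' F' G' \<tau>'" and \<sigma>': "nat_trans C' D' G' F' \<sigma>'" and
    i': "\<And>a. a \<in> Obj C' \<Longrightarrow> \<sigma>' a \<cdot>\<^bsub>D'\<^esub> \<tau>' a = Idn D' (fob F' a)"
    "\<And>a. a \<in> Obj C' \<Longrightarrow> \<tau>' a \<cdot>\<^bsub>D'\<^esub> \<sigma>' a = Idn D' (fob G' a)"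
    using assms(2) by (rule nat_isomorphic_inverse) blast
  have "is_iso (D \<times>\<^sub>c D') (\<tau> a, \<tau>' b)" if "a \<in> Obj C" "b \<in> Obj C'" for a b
    by (rule is_isoI[of _ _ "(\<sigma> a, \<sigma>' b)"])
      (use that in \<open>simp_all add: nat_transD(3-5)[OF \<tau>] nat_transD(3-5)[OF \<sigma>] i
        nat_transD(3-5)[OF \<tau>'] nat_transD(3-5)[OF \<sigma>'] i'\<close>)
  then show ?thesis
    by (intro nat_isomorphicI[of _ _ _ _ "\<lambda>(a, b). (\<tau> a, \<tau>' b)"])
      (auto simp: nat_transD(4-6)[OF \<tau>] nat_transD(4-6)[OF \<tau>']
        intro!: is_functor_fprod nat_transD(1,2)[OF \<tau>] nat_transD(1,2)[OF \<tau>'])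
qed

text \<open>Passing to opposites reverses components, so an isomorphism from \<open>F\<close> to
  \<open>G\<close> is now given by the inverse family \<sigma>. This serves the contravariant
  argument of the hom-objects.\<close>

lemma nat_isomorphic_op:
  assumes "nat_isomorphic C D F G" shows "nat_isomorphic (op_cat C) (op_cat D) F G"
proof -
  obtain \<tau> \<sigma> where \<tau>: "nat_trans C D F G \<tau>" and \<sigma>: "nat_trans C D G F \<sigma>" and
    i: "\<And>a. a \<in> Obj C \<Longrightarrow> \<sigma> a \<cdot>\<^bsub>D\<^esub> \<tau> a = Idn D (fob F a)"
    "\<And>a. a \<in> Obj C \<Longrightarrow> \<tau> a \<cdot>\<^bsub>D\<^esub> \<sigma> a = Idn D (fob G a)"
    using assms by (rule nat_isomorphic_inverse) blast
  show ?thesis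
  proof (rule nat_isomorphicI[of _ _ _ _ \<sigma>])
    fix a assume "a \<in> Obj (op_cat C)"
    then show "is_iso (op_cat D) (\<sigma> a)"
      by (intro is_isoI[of _ _ "\<tau> a"])
        (simp_all add: nat_transD(3-5)[OF \<tau>] nat_transD(3-5)[OF \<sigma>] i)
  qed (simp_all add: nat_transD(1,2)[OF \<tau>, THEN is_functor_op] nat_transD(3-6)[OF \<sigma>])
qed

lemma nat_isomorphic_fprod_post:
  assumes "nat_isomorphic C D F G" "nat_isomorphic C' D' F' G'" "is_functor (D \<times>\<^sub>c D') E H"
  shows "nat_isomorphic (C \<times>\<^sub>c C') E (H \<circ>\<^sub>f (F \<times>\<^sub>f F')) (H \<circ>\<^sub>f (G \<times>\<^sub>f G'))"
  by (rule nat_isomorphic_post[OF nat_isomorphic_fprod[OF assms(1,2)] assms(3)])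

section \<open>Natural bijections of hom-sets and representations\<close>

text \<open>A natural transformation between the profunctors C(L j, R k) and C'(L' j, R' k), with
  naturality in both variables in one equation. The categories \<open>C\<close> and
  \<open>C'\<close> may differ, so that transposition along an adjunction and the action of a
  functor are instances.\<close>

definition prof_map :: "('j, 'f) cat \<Rightarrow> ('k, 'g) cat
    \<Rightarrow> ('o, 'a) cat \<Rightarrow> ('j, 'f, 'o, 'a) fctr \<Rightarrow> ('k, 'g, 'o, 'a) fctr
    \<Rightarrow> ('p, 'b) cat \<Rightarrow> ('j, 'f, 'p, 'b) fctr \<Rightarrow> ('k, 'g, 'p, 'b) fctr
    \<Rightarrow> ('j \<Rightarrow> 'k \<Rightarrow> 'a \<Rightarrow> 'b) \<Rightarrow> bool" where
  "prof_map J K C L R C' L' R' \<phi> \<longleftrightarrow>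
     is_functor J C L \<and> is_functor K C R \<and> is_functor J C' L' \<and> is_functor K C' R' \<and>
     (\<forall>j \<in> Obj J. \<forall>k \<in> Obj K. \<forall>h \<in> hom C (fob L j) (fob R k). \<phi> j k h \<in> hom C' (fob L' j) (fob R' k)) \<and>
     (\<forall>p \<in> Arr J. \<forall>q \<in> Arr K. \<forall>h \<in> hom C (fob L (Cod J p)) (fob R (Dom K q)).
        \<phi> (Dom J p) (Cod K q) (far R q \<cdot>\<^bsub>C\<^esub> h \<cdot>\<^bsub>C\<^esub> far L p) =
        far R' q \<cdot>\<^bsub>C'\<^esub> \<phi> (Cod J p) (Dom K q) h \<cdot>\<^bsub>C'\<^esub> far L' p)"

definition prof_iso :: "('j, 'f) cat \<Rightarrow> ('k, 'g) cat
    \<Rightarrow> ('o, 'a) cat \<Rightarrow> ('j, 'f, 'o, 'a) fctr \<Rightarrow> ('k, 'g, 'o, 'a) fctr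
    \<Rightarrow> ('p, 'b) cat \<Rightarrow> ('j, 'f, 'p, 'b) fctr \<Rightarrow> ('k, 'g, 'p, 'b) fctr \<Rightarrow> bool" where
  "prof_iso J K C L R C' L' R' \<longleftrightarrow>
     (\<exists>\<phi> \<psi>. prof_map J K C L R C' L' R' \<phi> \<and> prof_map J K C' L' R' C L R \<psi> \<and>
       (\<forall>j \<in> Obj J. \<forall>k \<in> Obj K. \<forall>h \<in> hom C (fob L j) (fob R k). \<psi> j k (\<phi> j k h) = h) \<and>
       (\<forall>j \<in> Obj J. \<forall>k \<in> Obj K. \<forall>h \<in> hom C' (fob L' j) (fob R' k). \<phi> j k (\<psi> j k h) = h))"

lemma prof_mapD:
  assumes "prof_map J K C L R C' L' R' \<phi>"
  shows "is_functor J C L" "is_functor K C R" "is_functor J C' L'" "is_functor K C' R'"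
    and "j \<in> Obj J \<Longrightarrow> k \<in> Obj K \<Longrightarrow> h \<in> hom C (fob L j) (fob R k) \<Longrightarrow> \<phi> j k h \<in> hom C' (fob L' j) (fob R' k)"
    and "p \<in> Arr J \<Longrightarrow> q \<in> Arr K \<Longrightarrow> g \<in> hom C (fob L (Cod J p)) (fob R (Dom K q)) \<Longrightarrow>
        \<phi> (Dom J p) (Cod K q) (far R q \<cdot>\<^bsub>C\<^esub> g \<cdot>\<^bsub>C\<^esub> far L p) =
        far R' q \<cdot>\<^bsub>C'\<^esub> \<phi> (Cod J p) (Dom K q) g \<cdot>\<^bsub>C'\<^esub> far L' p"
  using assms by (simp_all add: prof_map_def)

lemma prof_isoE:
  assumes "prof_iso J K C L R C' L' R'"
  obtains \<phi> \<psi> where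
    "prof_map J K C L R C' L' R' \<phi>" "prof_map J K C' L' R' C L R \<psi>"
    "\<And>j k h. j \<in> Obj J \<Longrightarrow> k \<in> Obj K \<Longrightarrow> h \<in> hom C (fob L j) (fob R k) \<Longrightarrow> \<psi> j k (\<phi> j k h) = h"
    "\<And>j k h. j \<in> Obj J \<Longrightarrow> k \<in> Obj K \<Longrightarrow> h \<in> hom C' (fob L' j) (fob R' k) \<Longrightarrow> \<phi> j k (\<psi> j k h) = h"
  using assms unfolding prof_iso_def by metis

text \<open>Naturality of \<psi> need not be assumed: it results from applying \<psi> to the
  naturality equation of \<phi> at the arrow \<psi> h.\<close>

lemma prof_isoI:
  assumes \<phi>: "prof_map J K C L R C' L' R' \<phi>"
    and \<psi>: "\<And>j k h. j \<in> Obj J \<Longrightarrow> k \<in> Obj K \<Longrightarrow> h \<in> hom C' (fob L' j) (fob R' k)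
      \<Longrightarrow> \<psi> j k h \<in> hom C (fob L j) (fob R k)"
    and i: "\<And>j k h. j \<in> Obj J \<Longrightarrow> k \<in> Obj K \<Longrightarrow> h \<in> hom C (fob L j) (fob R k) \<Longrightarrow> \<psi> j k (\<phi> j k h) = h"
    and i': "\<And>j k h. j \<in> Obj J \<Longrightarrow> k \<in> Obj K \<Longrightarrow> h \<in> hom C' (fob L' j) (fob R' k) \<Longrightarrow> \<phi> j k (\<psi> j k h) = h"
  shows "prof_iso J K C L R C' L' R'"
proof -
  interpret L: func J C L using prof_mapD[OF \<phi>] by unfold_locales
  interpret R: func K C R using prof_mapD[OF \<phi>] by unfold_locales
  have "\<psi> (Dom J p) (Cod K q) (far R' q \<cdot>\<^bsub>C'\<^esub> h \<cdot>\<^bsub>C'\<^esub> far L' p) =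
      far R q \<cdot>\<^bsub>C\<^esub> \<psi> (Cod J p) (Dom K q) h \<cdot>\<^bsub>C\<^esub> far L p"
    if "p \<in> Arr J" "q \<in> Arr K" "h \<in> hom C' (fob L' (Cod J p)) (fob R' (Dom K q))" for p q h
  proof -
    have k: "\<psi> (Cod J p) (Dom K q) h \<in> hom C (fob L (Cod J p)) (fob R (Dom K q))"
      using \<psi> that by simp
    have "far R q \<cdot>\<^bsub>C\<^esub> \<psi> (Cod J p) (Dom K q) h \<cdot>\<^bsub>C\<^esub> far L p
        \<in> hom C (fob L (Dom J p)) (fob R (Cod K q))"
      using k that by (simp add: in_hom)
    from i[OF _ _ this] prof_mapD(6)[OF \<phi> that(1,2) k] show ?thesis
      using that i' by simp
  qed
  then have "prof_map J K C' L' R' C L R \<psi>"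
    using prof_mapD(1-4)[OF \<phi>] \<psi> by (simp add: prof_map_def)
  with \<phi> show ?thesis unfolding prof_iso_def using i i' by (intro exI[of _ \<phi>] exI[of _ \<psi>]) simp
qed

lemma prof_isoD:
  assumes "prof_iso J K C L R C' L' R'"
  shows "is_functor J C L" "is_functor K C R" "is_functor J C' L'" "is_functor K C' R'"
  using assms unfolding prof_iso_def by (auto dest: prof_mapD(1-4))

lemma prof_iso_sym: "prof_iso J K C L R C' L' R' \<Longrightarrow> prof_iso J K C' L' R' C L R"
  unfolding prof_iso_def by metis

lemma prof_iso_trans [trans]:
  assumes "prof_iso J K C L R C' L' R'" and "prof_iso J K C' L' R' C'' L'' R''"
  shows "prof_iso J K C L R C'' L'' R''"
proof -
  obtain \<phi> \<psi> where \<phi>: "prof_map J K C L R C' L' R' \<phi>" and \<psi>: "prof_map J K C' L' R' C L R \<psi>"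
    and i: "\<And>j k h. j \<in> Obj J \<Longrightarrow> k \<in> Obj K \<Longrightarrow> h \<in> hom C (fob L j) (fob R k) \<Longrightarrow> \<psi> j k (\<phi> j k h) = h"
    "\<And>j k h. j \<in> Obj J \<Longrightarrow> k \<in> Obj K \<Longrightarrow> h \<in> hom C' (fob L' j) (fob R' k) \<Longrightarrow> \<phi> j k (\<psi> j k h) = h"
    using assms(1) by (rule prof_isoE) blast
  obtain \<phi>' \<psi>' where \<phi>': "prof_map J K C' L' R' C'' L'' R'' \<phi>'" and \<psi>': "prof_map J K C'' L'' R'' C' L' R' \<psi>'"
    and i': "\<And>j k h. j \<in> Obj J \<Longrightarrow> k \<in> Obj K \<Longrightarrow> h \<in> hom C' (fob L' j) (fob R' k) \<Longrightarrow> \<psi>' j k (\<phi>' j k h) = h"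
    "\<And>j k h. j \<in> Obj J \<Longrightarrow> k \<in> Obj K \<Longrightarrow> h \<in> hom C'' (fob L'' j) (fob R'' k) \<Longrightarrow> \<phi>' j k (\<psi>' j k h) = h"
    using assms(2) by (rule prof_isoE) blast
  interpret L: func J C L using prof_mapD[OF \<phi>] by unfold_locales
  interpret R: func K C R using prof_mapD[OF \<phi>] by unfold_locales
  have "prof_map J K C L R C'' L'' R'' (\<lambda>j k h. \<phi>' j k (\<phi> j k h))"
    unfolding prof_map_def using prof_mapD[OF \<phi>] prof_mapD[OF \<phi>'] by simp
  then show ?thesis
    by (rule prof_isoI[of _ _ _ _ _ _ _ _ _ "\<lambda>j k h. \<psi> j k (\<psi>' j k h)"])
      (simp_all add: prof_mapD(5)[OF \<phi>] prof_mapD(5)[OF \<psi>] prof_mapD(5)[OF \<psi>'] i i')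
qed

text \<open>The bijection is conjugation: composition with R \<cong> R' after, and with the inverse
  of L \<cong> L' before.\<close>

lemma prof_iso_cong:
  assumes "nat_isomorphic J C L L'" "nat_isomorphic K C R R'"
  shows "prof_iso J K C L R C L' R'"
proof -
  from assms(1) obtain \<tau> \<tau>' where \<tau>: "nat_trans J C L L' \<tau>" and \<tau>': "nat_trans J C L' L \<tau>'" and i:
    "\<And>a. a \<in> Obj J \<Longrightarrow> \<tau>' a \<cdot>\<^bsub>C\<^esub> \<tau> a = Idn C (fob L a)"
    "\<And>a. a \<in> Obj J \<Longrightarrow> \<tau> a \<cdot>\<^bsub>C\<^esub> \<tau>' a = Idn C (fob L' a)"
    by (rule nat_isomorphic_inverse) blast
  from assms(2) obtain \<sigma> \<sigma>' where \<sigma>: "nat_trans K C R R' \<sigma>" and \<sigma>': "nat_trans K C R' R \<sigma>'" and k: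
    "\<And>a. a \<in> Obj K \<Longrightarrow> \<sigma>' a \<cdot>\<^bsub>C\<^esub> \<sigma> a = Idn C (fob R a)"
    "\<And>a. a \<in> Obj K \<Longrightarrow> \<sigma> a \<cdot>\<^bsub>C\<^esub> \<sigma>' a = Idn C (fob R' a)"
    by (rule nat_isomorphic_inverse) blast
  interpret L: func J C L using nat_transD(1)[OF \<tau>] by unfold_locales
  interpret L': func J C L' using nat_transD(2)[OF \<tau>] by unfold_locales
  interpret R: func K C R using nat_transD(1)[OF \<sigma>] by unfold_locales
  interpret R': func K C R' using nat_transD(2)[OF \<sigma>] by unfold_locales
  note [simp] = nat_transD(3-5)[OF \<tau>] nat_transD(3-5)[OF \<tau>'] nat_transD(3-5)[OF \<sigma>]
    nat_transD(3-5)[OF \<sigma>'] i k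
  note [simp] = L.D.cmp_eq_assoc1[OF i(1)] L.D.cmp_eq_assoc1[OF i(2)]
    L.D.cmp_eq_assoc1[OF k(1)] L.D.cmp_eq_assoc1[OF k(2)]
  show ?thesis
  proof (rule prof_isoI[of _ _ _ _ _ _ _ _ "\<lambda>j k h. \<sigma> k \<cdot>\<^bsub>C\<^esub> h \<cdot>\<^bsub>C\<^esub> \<tau>' j" "\<lambda>j k h. \<sigma>' k \<cdot>\<^bsub>C\<^esub> h \<cdot>\<^bsub>C\<^esub> \<tau> j"],
      unfold prof_map_def, intro conjI ballI)
    fix p q h assume p: "p \<in> Arr J" and q: "q \<in> Arr K"
      and h: "h \<in> hom C (fob L (Cod J p)) (fob R (Dom K q))"
    show "\<sigma> (Cod K q) \<cdot>\<^bsub>C\<^esub> (far R q \<cdot>\<^bsub>C\<^esub> h \<cdot>\<^bsub>C\<^esub> far L p) \<cdot>\<^bsub>C\<^esub> \<tau>' (Dom J p) =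
        far R' q \<cdot>\<^bsub>C\<^esub> (\<sigma> (Dom K q) \<cdot>\<^bsub>C\<^esub> h \<cdot>\<^bsub>C\<^esub> \<tau>' (Cod J p)) \<cdot>\<^bsub>C\<^esub> far L' p"
      using p q h nat_transD(6)[OF \<tau>' p]
        L.D.cmp_eq_assoc[OF nat_transD(6)[OF \<sigma> q], of "h \<cdot>\<^bsub>C\<^esub> far L p \<cdot>\<^bsub>C\<^esub> \<tau>' (Dom J p)"]
      by (simp add: in_hom)
  qed (simp_all add: L.is_func R.is_func L'.is_func R'.is_func in_hom)
qed

text \<open>The two maps are the usual transposes, mutually inverse by the triangle identities. The
  parameters \<open>L\<close> and \<open>R\<close> let source and target run through arbitrary
  functors, such as the source U v \<times> P later on.\<close>

lemma prof_iso_adjoint: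
  assumes "adjoint C D F G" "is_functor J C L" "is_functor K D R"
  shows "prof_iso J K D (F \<circ>\<^sub>f L) R C L (G \<circ>\<^sub>f R)"
proof -
  obtain \<eta> \<epsilon> where A: "adjunction C D F G \<eta> \<epsilon>" using assms(1) by (auto simp: adjoint_def)
  interpret F: func C D F using A by unfold_locales (simp add: adjunction_def)
  interpret G: func D C G using A by unfold_locales (simp add: adjunction_def)
  interpret L: func J C L by unfold_locales fact
  interpret R: func K D R by unfold_locales fact
  have \<eta>: "nat_trans C C idf (G \<circ>\<^sub>f F) \<eta>" and \<epsilon>: "nat_trans D D (F \<circ>\<^sub>f G) idf \<epsilon>"
    and tri: "\<And>a. a \<in> Obj C \<Longrightarrow> \<epsilon> (fob F a) \<cdot>\<^bsub>D\<^esub> far F (\<eta> a) = Idn D (fob F a)"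
    "\<And>b. b \<in> Obj D \<Longrightarrow> far G (\<epsilon> b) \<cdot>\<^bsub>C\<^esub> \<eta> (fob G b) = Idn C (fob G b)"
    using A by (auto simp: adjunction_def)
  note [simp] = nat_transD(3-5)[OF \<eta>, simplified] nat_transD(3-5)[OF \<epsilon>, simplified] tri
  show ?thesis
  proof (rule prof_isoI[of _ _ _ _ _ _ _ _ "\<lambda>j k h. far G h \<cdot>\<^bsub>C\<^esub> \<eta> (fob L j)"
        "\<lambda>j k h. \<epsilon> (fob R k) \<cdot>\<^bsub>D\<^esub> far F h"], unfold prof_map_def, intro conjI ballI)
    fix j k h assume j: "j \<in> Obj J" and k: "k \<in> Obj K"
      and h: "h \<in> hom D (fob (F \<circ>\<^sub>f L) j) (fob R k)"
    show "\<epsilon> (fob R k) \<cdot>\<^bsub>D\<^esub> far F (far G h \<cdot>\<^bsub>C\<^esub> \<eta> (fob L j)) = h"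
      using j k h nat_transD(6)[OF \<epsilon>, of h]
        F.D.cmp_eq_assoc[OF nat_transD(6)[OF \<epsilon>, of h], of "far F (\<eta> (fob L j))"]
      by (simp add: in_hom)
  next
    fix j k h assume j: "j \<in> Obj J" and k: "k \<in> Obj K"
      and h: "h \<in> hom C (fob L j) (fob (G \<circ>\<^sub>f R) k)"
    have "far G (\<epsilon> (fob R k)) \<cdot>\<^bsub>C\<^esub> \<eta> (fob G (fob R k)) \<cdot>\<^bsub>C\<^esub> h = h"
      using j k h F.C.cmp_eq_assoc1[OF tri(2), of "fob R k" h] by (simp add: in_hom)
    then show "far G (\<epsilon> (fob R k) \<cdot>\<^bsub>D\<^esub> far F h) \<cdot>\<^bsub>C\<^esub> \<eta> (fob L j) = h"
      using j k h nat_transD(6)[OF \<eta>, of h] by (simp add: in_hom)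
  next
    fix p q h assume p: "p \<in> Arr J" and q: "q \<in> Arr K"
      and h: "h \<in> hom D (fob (F \<circ>\<^sub>f L) (Cod J p)) (fob R (Dom K q))"
    show "far G (far R q \<cdot>\<^bsub>D\<^esub> h \<cdot>\<^bsub>D\<^esub> far (F \<circ>\<^sub>f L) p) \<cdot>\<^bsub>C\<^esub> \<eta> (fob L (Dom J p)) =
        far (G \<circ>\<^sub>f R) q \<cdot>\<^bsub>C\<^esub> (far G h \<cdot>\<^bsub>C\<^esub> \<eta> (fob L (Cod J p))) \<cdot>\<^bsub>C\<^esub> far L p"
      using p q h nat_transD(6)[OF \<eta>, of "far L p"] by (simp add: in_hom)
  qed (simp_all add: is_functor_fcomp[OF L.is_func F.is_func] is_functor_fcomp[OF R.is_func G.is_func]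
      L.is_func R.is_func in_hom)
qed

section \<open>Full faithfulness, adjunctions and equivalences in terms of natural
  bijections\<close>

lemma fully_faithfulE:
  assumes "fully_faithful C D F" "a \<in> Obj C" "b \<in> Obj C" "g \<in> hom D (fob F a) (fob F b)"
  obtains f where "f \<in> hom C a b" "far F f = g"
proof -
  have "g \<in> far F ` hom C a b"
    using assms(1-4) by (simp add: fully_faithful_def bij_betw_def)
  then show ?thesis using that by blast
qed

lemma fully_faithful_eqI:
  assumes "fully_faithful C D F" "f \<in> Arr C" "g \<in> Arr C" "Dom C f = Dom C g" "Cod C f = Cod C g"
    "far F f = far F g"
  shows "f = g"
proof -
  interpret func C D F using assms(1) by unfold_locales (simp add: fully_faithful_def)
  have "inj_on (far F) (hom C (Dom C f) (Cod C f))"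
    using assms unfolding fully_faithful_def bij_betw_def by simp
  then show ?thesis using assms(2-) by (auto simp: in_hom inj_on_def)
qed

lemma fully_faithful_fcomp:
  assumes F: "fully_faithful C D F" and G: "fully_faithful D E G"
  shows "fully_faithful C E (G \<circ>\<^sub>f F)"
proof -
  interpret F: func C D F using F by unfold_locales (simp add: fully_faithful_def)
  have "bij_betw (far G \<circ> far F) (hom C a b) (hom E (fob G (fob F a)) (fob G (fob F b)))"
    if "a \<in> Obj C" "b \<in> Obj C" for a b
    by (rule bij_betw_trans[of _ _ "hom D (fob F a) (fob F b)"])
      (use F G that in \<open>simp_all add: fully_faithful_def\<close>)
  then show ?thesis
    using F G is_functor_fcomp[of C D F E G] by (simp add: fully_faithful_def fcomp_def)
qed

lemma prof_iso_fully_faithful: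
  assumes "fully_faithful C D F" "is_functor J C L" "is_functor K C R"
  shows "prof_iso J K C L R D (F \<circ>\<^sub>f L) (F \<circ>\<^sub>f R)"
proof -
  interpret F: func C D F using assms(1) by unfold_locales (simp add: fully_faithful_def)
  interpret L: func J C L by unfold_locales fact
  interpret R: func K C R by unfold_locales fact
  have surj: "\<exists>f \<in> hom C (fob L j) (fob R k). far F f = h"
    if "j \<in> Obj J" "k \<in> Obj K" "h \<in> hom D (fob (F \<circ>\<^sub>f L) j) (fob (F \<circ>\<^sub>f R) k)" for j k h
    by (rule fully_faithfulE[OF assms(1), of "fob L j" "fob R k" h]) (use that in auto)
  define \<psi> where "\<psi> j k h = (SOME f. f \<in> hom C (fob L j) (fob R k) \<and> far F f = h)" for j k h
  have \<psi>: "\<psi> j k h \<in> hom C (fob L j) (fob R k) \<and> far F (\<psi> j k h) = h"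
    if "j \<in> Obj J" "k \<in> Obj K" "h \<in> hom D (fob (F \<circ>\<^sub>f L) j) (fob (F \<circ>\<^sub>f R) k)" for j k h
    unfolding \<psi>_def using surj[OF that] someI_ex[of "\<lambda>f. f \<in> hom C (fob L j) (fob R k) \<and> far F f = h"]
    by blast
  have \<phi>: "prof_map J K C L R D (F \<circ>\<^sub>f L) (F \<circ>\<^sub>f R) (\<lambda>_ _. far F)"
    unfolding prof_map_def
    by (simp add: in_hom L.is_func R.is_func is_functor_fcomp[OF L.is_func F.is_func]
      is_functor_fcomp[OF R.is_func F.is_func])
  show ?thesis
  proof (rule prof_isoI[OF \<phi>, of \<psi>])
    fix j k h assume j: "j \<in> Obj J" "k \<in> Obj K" and h: "h \<in> hom C (fob L j) (fob R k)"
    show "\<psi> j k (far F h) = h"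
      using \<psi>[OF j, of "far F h"] h
      by (intro fully_faithful_eqI[OF assms(1)]) (simp_all add: in_hom)
  qed (use \<psi> in blast)+
qed

text \<open>The unit and the counit are the images of identities under the two bijections. Their
  naturality compares the effect of an arrow in either variable of the bijection on an identity;
  each triangle identity says that one bijection undoes the other on an identity.\<close>

lemma adjoint_if_prof_iso:
  assumes P: "prof_iso C D D F idf C idf G"
  shows "adjoint C D F G"
proof -
  interpret F: func C D F using prof_isoD[OF P] by unfold_locales
  interpret G: func D C G using prof_isoD[OF P] by unfold_locales
  obtain \<phi> \<psi> where \<phi>: "prof_map C D D F idf C idf G \<phi>" and \<psi>: "prof_map C D C idf G D F idf \<psi>"
    and "\<And>j k h. j \<in> Obj C \<Longrightarrow> k \<in> Obj D \<Longrightarrow> h \<in> hom D (fob F j) k \<Longrightarrow> \<psi> j k (\<phi> j k h) = h"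
    "\<And>j k h. j \<in> Obj C \<Longrightarrow> k \<in> Obj D \<Longrightarrow> h \<in> hom C j (fob G k) \<Longrightarrow> \<phi> j k (\<psi> j k h) = h"
    using P by (rule prof_isoE) simp
  note a = prof_mapD(5)[OF \<phi>, simplified] prof_mapD(5)[OF \<psi>, simplified] this(3,4)
  note n = prof_mapD(6)[OF \<phi>, simplified] and n' = prof_mapD(6)[OF \<psi>, simplified]
  define \<eta> where "\<eta> a = \<phi> a (fob F a) (Idn D (fob F a))" for a
  define \<epsilon> where "\<epsilon> b = \<psi> (fob G b) b (Idn C (fob G b))" for b
  have [simp]: "\<eta> a \<in> Arr C" "Dom C (\<eta> a) = a" "Cod C (\<eta> a) = fob G (fob F a)" if "a \<in> Obj C" for a
    using a(1)[of a "fob F a" "Idn D (fob F a)"] that by (simp_all add: \<eta>_def in_hom)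
  have [simp]: "\<epsilon> b \<in> Arr D" "Dom D (\<epsilon> b) = fob F (fob G b)" "Cod D (\<epsilon> b) = b" if "b \<in> Obj D" for b
    using a(2)[of "fob G b" b "Idn C (fob G b)"] that by (simp_all add: \<epsilon>_def in_hom)
  have \<eta>n: "\<eta> (Cod C f) \<cdot>\<^bsub>C\<^esub> f = far G (far F f) \<cdot>\<^bsub>C\<^esub> \<eta> (Dom C f)" if "f \<in> Arr C" for f
    using n[of f "Idn D (fob F (Cod C f))" "Idn D (fob F (Cod C f))"]
      n[of "Idn C (Dom C f)" "far F f" "Idn D (fob F (Dom C f))"] that
      a(1)[of "Cod C f" "fob F (Cod C f)" "Idn D (fob F (Cod C f))"]
      a(1)[of "Dom C f" "fob F (Dom C f)" "Idn D (fob F (Dom C f))"]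
    by (simp add: in_hom \<eta>_def)
  have \<epsilon>n: "\<epsilon> (Cod D f) \<cdot>\<^bsub>D\<^esub> far F (far G f) = f \<cdot>\<^bsub>D\<^esub> \<epsilon> (Dom D f)" if "f \<in> Arr D" for f
    using n'[of "far G f" "Idn D (Cod D f)" "Idn C (fob G (Cod D f))"]
      n'[of "Idn C (fob G (Dom D f))" f "Idn C (fob G (Dom D f))"] that
      a(2)[of "fob G (Cod D f)" "Cod D f" "Idn C (fob G (Cod D f))"]
      a(2)[of "fob G (Dom D f)" "Dom D f" "Idn C (fob G (Dom D f))"]
    by (simp add: in_hom \<epsilon>_def)
  have t1: "\<epsilon> (fob F a) \<cdot>\<^bsub>D\<^esub> far F (\<eta> a) = Idn D (fob F a)" if "a \<in> Obj C" for a
  proof -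
    have "\<psi> a (fob F a) (\<eta> a) = \<epsilon> (fob F a) \<cdot>\<^bsub>D\<^esub> far F (\<eta> a)"
      using n'[of "\<eta> a" "Idn D (fob F a)" "Idn C (fob G (fob F a))"] that
        a(2)[of "fob G (fob F a)" "fob F a" "Idn C (fob G (fob F a))"]
      by (simp add: in_hom \<epsilon>_def)
    then show ?thesis using a(3)[of a "fob F a" "Idn D (fob F a)"] that by (simp add: \<eta>_def in_hom)
  qed
  have t2: "far G (\<epsilon> b) \<cdot>\<^bsub>C\<^esub> \<eta> (fob G b) = Idn C (fob G b)" if "b \<in> Obj D" for b
  proof -
    have "\<phi> (fob G b) b (\<epsilon> b) = far G (\<epsilon> b) \<cdot>\<^bsub>C\<^esub> \<eta> (fob G b)"
      using n[of "Idn C (fob G b)" "\<epsilon> b" "Idn D (fob F (fob G b))"] that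
        a(1)[of "fob G b" "fob F (fob G b)" "Idn D (fob F (fob G b))"]
      by (simp add: in_hom \<eta>_def)
    then show ?thesis using a(4)[of "fob G b" b "Idn C (fob G b)"] that by (simp add: \<epsilon>_def in_hom)
  qed
  have "adjunction C D F G \<eta> \<epsilon>"
    unfolding adjunction_def nat_trans_def
    using t1 t2 F.is_func G.is_func F.C.category_axioms F.D.category_axioms
      is_functor_fcomp[OF F.is_func G.is_func] is_functor_fcomp[OF G.is_func F.is_func]
    by (auto simp: in_hom \<eta>n \<epsilon>n intro: is_functor_idf)
  then show ?thesis by (auto simp: adjoint_def)
qed

lemma adjoint_iff_prof_iso: "adjoint C D F G \<longleftrightarrow> prof_iso C D D F idf C idf G"
proof
  assume A: "adjoint C D F G"
  then have "category C" "category D" by (auto simp: adjoint_def adjunction_def dest: is_functorD)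
  from prof_iso_adjoint[OF A this[THEN is_functor_idf]]
  show "prof_iso C D D F idf C idf G" by simp
qed (rule adjoint_if_prof_iso)

lemma adjoint_fcomp:
  assumes "adjoint C D F G" "adjoint D E F' G'"
  shows "adjoint C E (F' \<circ>\<^sub>f F) (G \<circ>\<^sub>f G')"
proof -
  have F: "is_functor C D F" "is_functor D E F'" "is_functor D C G" "is_functor E D G'"
    using assms by (auto simp: adjoint_def adjunction_def)
  have "prof_iso C E E (F' \<circ>\<^sub>f F) idf D F (G' \<circ>\<^sub>f idf)"
    by (intro prof_iso_adjoint assms F is_functor_idf is_functorD[OF F(2)])
  also have "prof_iso C E D F (G' \<circ>\<^sub>f idf) C idf (G \<circ>\<^sub>f G')"
    using prof_iso_adjoint[OF assms(1) is_functor_idf[OF is_functorD(1)[OF F(1)]] F(4)] by simp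
  finally show ?thesis by (rule adjoint_if_prof_iso)
qed

lemma adjoint_functors: "adjoint C D F G \<Longrightarrow> is_functor C D F" "adjoint C D F G \<Longrightarrow> is_functor D C G"
  by (auto simp: adjoint_def adjunction_def)

text \<open>An arrow h : a \<rightarrow> b can be recovered from F h, namely as \<tau> b \<cdot> G
  (F h) \<cdot> \<sigma> a.\<close>

lemma faithful_if_retract:
  assumes F: "is_functor C D F" and G: "is_functor D C G"
    and iso: "nat_isomorphic C C (G \<circ>\<^sub>f F) idf"
    and fg: "f \<in> hom C a b" "g \<in> hom C a b" "far F f = far F g"
  shows "f = g"
proof -
  interpret F: func C D F by unfold_locales fact
  interpret G: func D C G by unfold_locales fact
  obtain \<tau> \<sigma> where \<tau>: "nat_trans C C (G \<circ>\<^sub>f F) idf \<tau>" and \<sigma>: "nat_trans C C idf (G \<circ>\<^sub>f F) \<sigma>"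
    and i: "\<And>a. a \<in> Obj C \<Longrightarrow> \<sigma> a \<cdot>\<^bsub>C\<^esub> \<tau> a = Idn C (fob G (fob F a))"
    "\<And>a. a \<in> Obj C \<Longrightarrow> \<tau> a \<cdot>\<^bsub>C\<^esub> \<sigma> a = Idn C a"
    using iso by (rule nat_isomorphic_inverse) simp
  have a: "a \<in> Obj C" using fg by (auto simp: in_hom)
  note [simp] = nat_transD(3-5)[OF \<tau>, simplified] nat_transD(3-5)[OF \<sigma>, simplified]
  have "\<tau> (Cod C h) \<cdot>\<^bsub>C\<^esub> far G (far F h) \<cdot>\<^bsub>C\<^esub> \<sigma> a = h" if "h \<in> Arr C" "Dom C h = a" for h
    using F.C.cmp_eq_assoc[OF nat_transD(6)[OF \<tau>, of h], of "\<sigma> a"] that a i(2) by simp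
  from this[of f] this[of g] fg show ?thesis by (simp add: in_hom)
qed

text \<open>A preimage of g is \<tau> b \<cdot> G g \<cdot> \<sigma> a. Naturality shows only that
  its image under \<open>F\<close> and g have the same image under \<open>G\<close>; but
  \<open>G\<close> is faithful as well, because F G is isomorphic to the identity.\<close>

lemma equivalence_fully_faithful:
  assumes "equivalence C D F" shows "fully_faithful C D F"
proof -
  obtain G where F: "is_functor C D F" and G: "is_functor D C G"
    and GF: "nat_isomorphic C C (G \<circ>\<^sub>f F) idf" and FG: "nat_isomorphic D D (F \<circ>\<^sub>f G) idf"
    using assms by (auto simp: equivalence_def)
  interpret F: func C D F by unfold_locales fact
  interpret G: func D C G by unfold_locales fact
  obtain \<tau> \<sigma> where \<tau>: "nat_trans C C (G \<circ>\<^sub>f F) idf \<tau>" and \<sigma>: "nat_trans C C idf (G \<circ>\<^sub>f F) \<sigma>"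
    and i: "\<And>a. a \<in> Obj C \<Longrightarrow> \<sigma> a \<cdot>\<^bsub>C\<^esub> \<tau> a = Idn C (fob G (fob F a))"
    "\<And>a. a \<in> Obj C \<Longrightarrow> \<tau> a \<cdot>\<^bsub>C\<^esub> \<sigma> a = Idn C a"
    using GF by (rule nat_isomorphic_inverse) simp
  note [simp] = nat_transD(3-5)[OF \<tau>, simplified] nat_transD(3-5)[OF \<sigma>, simplified]
  have "\<exists>f. f \<in> hom C a b \<and> far F f = g"
    if a: "a \<in> Obj C" and b: "b \<in> Obj C" and g: "g \<in> hom D (fob F a) (fob F b)" for a b g
  proof (intro exI conjI)
    let ?f = "\<tau> b \<cdot>\<^bsub>C\<^esub> far G g \<cdot>\<^bsub>C\<^esub> \<sigma> a"
    show f: "?f \<in> hom C a b" using a b g by (simp add: in_hom)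
    have "far G (far F ?f) = far G (far F ?f) \<cdot>\<^bsub>C\<^esub> \<sigma> a \<cdot>\<^bsub>C\<^esub> \<tau> a"
      using a b g by (simp add: in_hom i)
    also have "\<dots> = \<sigma> b \<cdot>\<^bsub>C\<^esub> ?f \<cdot>\<^bsub>C\<^esub> \<tau> a"
      using F.C.cmp_eq_assoc[OF nat_transD(6)[OF \<sigma>, of ?f], of "\<tau> a"] a b g by (simp add: in_hom)
    also have "\<dots> = far G g"
      using a b g F.C.cmp_eq_assoc1[OF i(1), of b "far G g"] by (simp add: in_hom i)
    finally show "far F ?f = g"
      using faithful_if_retract[OF G F FG, of "far F ?f" "fob F a" "fob F b" g] f a b g
      by (simp add: in_hom)
  qed
  note full = this
  have "bij_betw (far F) (hom C a b) (hom D (fob F a) (fob F b))"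
    if ab: "a \<in> Obj C" "b \<in> Obj C" for a b
  proof (rule bij_betw_imageI)
    show "inj_on (far F) (hom C a b)"
      using faithful_if_retract[OF F G GF, of _ a b] by (rule inj_onI)
    show "far F ` hom C a b = hom D (fob F a) (fob F b)"
    proof (intro subset_antisym subsetI)
      fix g assume "g \<in> hom D (fob F a) (fob F b)"
      from full[OF ab this] show "g \<in> far F ` hom C a b" by blast
    qed (auto simp: in_hom)
  qed
  with F show ?thesis by (simp add: fully_faithful_def)
qed

text \<open>Any quasi-inverse is adjoint to \<open>F\<close> on both sides: full faithfulness of
  \<open>F\<close> and F G \<cong> id combine to the required bijections of hom-sets. The given
  isomorphisms need not satisfy the triangle identities; units and counits that do are produced by
  \<open>adjoint_if_prof_iso\<close>. Applied to \<open>j_fun\<close>, one side is needed for coends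
  and the other for ends.\<close>

lemma equivalence_adjoints:
  assumes "equivalence C D F"
  obtains G where "adjoint C D F G" "adjoint D C G F"
proof -
  obtain G where F: "is_functor C D F" and G: "is_functor D C G"
    and GF: "nat_isomorphic C C (G \<circ>\<^sub>f F) idf" and FG: "nat_isomorphic D D (F \<circ>\<^sub>f G) idf"
    using assms by (auto simp: equivalence_def)
  note C = is_functor_idf[OF is_functorD(1)[OF F]] and D = is_functor_idf[OF is_functorD(2)[OF F]]
  note ff = equivalence_fully_faithful[OF assms]
  have "prof_iso C D D F idf D F (F \<circ>\<^sub>f G)"
    by (intro prof_iso_cong nat_isomorphic_refl F nat_isomorphic_sym[OF FG])
  also have "prof_iso C D D F (F \<circ>\<^sub>f G) C idf G"
    using prof_iso_sym[OF prof_iso_fully_faithful[OF ff C G]] by simp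
  finally have 1: "adjoint C D F G" by (rule adjoint_if_prof_iso)
  have "prof_iso D C C G idf D (F \<circ>\<^sub>f G) F"
    using prof_iso_fully_faithful[OF ff G C] by simp
  also have "prof_iso D C D (F \<circ>\<^sub>f G) F D idf F"
    by (intro prof_iso_cong nat_isomorphic_refl F FG)
  finally have 2: "adjoint D C G F" by (rule adjoint_if_prof_iso)
  from 1 2 show ?thesis by (rule that)
qed

text \<open>Yoneda for arrows out of an object: the isomorphism and its inverse are the images of
  the identities of M' j and M j. It serves to compare left adjoints, coends in particular, which
  are determined by the arrows out of their values.\<close>

lemma nat_isomorphic_if_prof_iso:
  assumes P: "prof_iso J V V M idf V M' idf"
  shows "nat_isomorphic J V M M'"
proof -
  interpret M: func J V M using prof_isoD[OF P] by unfold_locales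
  interpret M': func J V M' using prof_isoD[OF P] by unfold_locales
  obtain \<phi> \<psi> where \<phi>: "prof_map J V V M idf V M' idf \<phi>" and \<psi>: "prof_map J V V M' idf V M idf \<psi>"
    and "\<And>j k h. j \<in> Obj J \<Longrightarrow> k \<in> Obj V \<Longrightarrow> h \<in> hom V (fob M j) k \<Longrightarrow> \<psi> j k (\<phi> j k h) = h"
    "\<And>j k h. j \<in> Obj J \<Longrightarrow> k \<in> Obj V \<Longrightarrow> h \<in> hom V (fob M' j) k \<Longrightarrow> \<phi> j k (\<psi> j k h) = h"
    using P by (rule prof_isoE) simp
  note a = prof_mapD(5)[OF \<phi>, simplified] prof_mapD(5)[OF \<psi>, simplified] this(3,4)
  note n = prof_mapD(6)[OF \<phi>, simplified] and n' = prof_mapD(6)[OF \<psi>, simplified]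
  define \<sigma> where "\<sigma> j = \<phi> j (fob M j) (Idn V (fob M j))" for j
  define \<tau> where "\<tau> j = \<psi> j (fob M' j) (Idn V (fob M' j))" for j
  have [simp]: "\<sigma> j \<in> Arr V" "Dom V (\<sigma> j) = fob M' j" "Cod V (\<sigma> j) = fob M j" if "j \<in> Obj J" for j
    using a(1)[of j "fob M j" "Idn V (fob M j)"] that by (simp_all add: \<sigma>_def in_hom)
  have [simp]: "\<tau> j \<in> Arr V" "Dom V (\<tau> j) = fob M j" "Cod V (\<tau> j) = fob M' j" if "j \<in> Obj J" for j
    using a(2)[of j "fob M' j" "Idn V (fob M' j)"] that by (simp_all add: \<tau>_def in_hom)
  have \<sigma>\<tau>: "\<sigma> j \<cdot>\<^bsub>V\<^esub> \<tau> j = Idn V (fob M j)" if j: "j \<in> Obj J" for j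
  proof -
    have "\<sigma> j \<cdot>\<^bsub>V\<^esub> \<tau> j = \<psi> j (fob M j) (\<sigma> j)"
      using n'[of "Idn J j" "\<sigma> j" "Idn V (fob M' j)"] j \<open>\<And>j. j \<in> Obj J \<Longrightarrow> Dom V (\<tau> j) = fob M j\<close>[OF j]
      by (simp add: in_hom flip: \<tau>_def)
    then show ?thesis using a(3)[of j "fob M j" "Idn V (fob M j)"] j by (simp add: \<sigma>_def in_hom)
  qed
  have \<tau>\<sigma>: "\<tau> j \<cdot>\<^bsub>V\<^esub> \<sigma> j = Idn V (fob M' j)" if j: "j \<in> Obj J" for j
  proof -
    have "\<tau> j \<cdot>\<^bsub>V\<^esub> \<sigma> j = \<phi> j (fob M' j) (\<tau> j)"
      using n[of "Idn J j" "\<tau> j" "Idn V (fob M j)"] j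
      by (simp add: in_hom flip: \<sigma>_def)
    then show ?thesis using a(4)[of j "fob M' j" "Idn V (fob M' j)"] j by (simp add: \<tau>_def in_hom)
  qed
  show ?thesis
  proof (rule nat_isomorphicI[of _ _ _ _ \<tau>])
    fix f assume f: "f \<in> Arr J"
    show "\<tau> (Cod J f) \<cdot>\<^bsub>V\<^esub> far M f = far M' f \<cdot>\<^bsub>V\<^esub> \<tau> (Dom J f)"
      using n'[of f "Idn V (fob M' (Cod J f))" "Idn V (fob M' (Cod J f))"]
        n'[of "Idn J (Dom J f)" "far M' f" "Idn V (fob M' (Dom J f))"] f
      by (simp add: in_hom flip: \<tau>_def)
  next
    fix j assume "j \<in> Obj J"
    then show "is_iso V (\<tau> j)"
      using \<sigma>\<tau> \<tau>\<sigma> by (intro is_isoI[of _ _ "\<sigma> j"]) simp_all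
  qed (simp_all add: M.is_func M'.is_func)
qed

lemma adjoint_nat_isomorphic_left:
  assumes F: "adjoint C D F G" and F': "adjoint C D F' G'" and G: "nat_isomorphic D C G G'"
  shows "nat_isomorphic C D F F'"
proof (rule nat_isomorphic_if_prof_iso)
  have C: "category C" using adjoint_functors[OF F] by (auto dest: is_functorD)
  have "prof_iso C D D F idf C idf G" using F by (simp add: adjoint_iff_prof_iso)
  also have "prof_iso C D C idf G C idf G'"
    by (intro prof_iso_cong nat_isomorphic_refl is_functor_idf C G)
  also have "prof_iso C D C idf G' D F' idf"
    using F' by (simp add: adjoint_iff_prof_iso prof_iso_sym)
  finally show "prof_iso C D D F idf D F' idf" .
qed

text \<open>The mirror image, for arrows into an object, is what hom-objects call for. Naturality is
  required of \<phi> alone, since \<phi> determines \<psi>.\<close>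

lemma yoneda_nat_isomorphic:
  assumes H: "is_functor I V H" and H': "is_functor I V H'"
    and \<phi>: "\<And>v i h. v \<in> Obj V \<Longrightarrow> i \<in> Obj I \<Longrightarrow> h \<in> hom V v (fob H i) \<Longrightarrow> \<phi> v i h \<in> hom V v (fob H' i)"
    and \<psi>: "\<And>v i h. v \<in> Obj V \<Longrightarrow> i \<in> Obj I \<Longrightarrow> h \<in> hom V v (fob H' i) \<Longrightarrow> \<psi> v i h \<in> hom V v (fob H i)"
    and \<psi>\<phi>: "\<And>v i h. v \<in> Obj V \<Longrightarrow> i \<in> Obj I \<Longrightarrow> h \<in> hom V v (fob H i) \<Longrightarrow> \<psi> v i (\<phi> v i h) = h"
    and \<phi>\<psi>: "\<And>v i h. v \<in> Obj V \<Longrightarrow> i \<in> Obj I \<Longrightarrow> h \<in> hom V v (fob H' i) \<Longrightarrow> \<phi> v i (\<psi> v i h) = h"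
    and n: "\<And>u f h. u \<in> Arr V \<Longrightarrow> f \<in> Arr I \<Longrightarrow> h \<in> hom V (Cod V u) (fob H (Dom I f)) \<Longrightarrow>
      \<phi> (Dom V u) (Cod I f) (far H f \<cdot>\<^bsub>V\<^esub> h \<cdot>\<^bsub>V\<^esub> u) = far H' f \<cdot>\<^bsub>V\<^esub> \<phi> (Cod V u) (Dom I f) h \<cdot>\<^bsub>V\<^esub> u"
  shows "nat_isomorphic I V H H'"
proof -
  interpret H: func I V H by unfold_locales fact
  interpret H': func I V H' by unfold_locales fact
  define \<tau> where "\<tau> i = \<phi> (fob H i) i (Idn V (fob H i))" for i
  define \<sigma> where "\<sigma> i = \<psi> (fob H' i) i (Idn V (fob H' i))" for i
  have \<tau> [simp]: "\<tau> i \<in> Arr V" "Dom V (\<tau> i) = fob H i" "Cod V (\<tau> i) = fob H' i" if "i \<in> Obj I" for i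
    using \<phi>[of "fob H i" i "Idn V (fob H i)"] that by (simp_all add: \<tau>_def in_hom)
  have \<sigma> [simp]: "\<sigma> i \<in> Arr V" "Dom V (\<sigma> i) = fob H' i" "Cod V (\<sigma> i) = fob H i" if "i \<in> Obj I" for i
    using \<psi>[of "fob H' i" i "Idn V (fob H' i)"] that by (simp_all add: \<sigma>_def in_hom)
  \<comment> \<open>Naturality in v, applied to the identity of H i, shows that \<phi> is
    composition with \<tau>.\<close>
  have \<phi>\<tau>: "\<phi> (Dom V h) i h = \<tau> i \<cdot>\<^bsub>V\<^esub> h" if "i \<in> Obj I" "h \<in> Arr V" "Cod V h = fob H i" for i h
    using n[of h "Idn I i" "Idn V (fob H i)"] that by (simp add: in_hom flip: \<tau>_def)
  have \<tau>\<sigma>: "\<tau> i \<cdot>\<^bsub>V\<^esub> \<sigma> i = Idn V (fob H' i)" if i: "i \<in> Obj I" for i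
    using \<phi>\<tau>[OF i, of "\<sigma> i"] i \<phi>\<psi>[of "fob H' i" i "Idn V (fob H' i)"]
    by (simp add: in_hom flip: \<sigma>_def)
  have "\<sigma> i \<cdot>\<^bsub>V\<^esub> \<tau> i = Idn V (fob H i)" if i: "i \<in> Obj I" for i
  proof -
    have "\<phi> (fob H i) i (\<sigma> i \<cdot>\<^bsub>V\<^esub> \<tau> i) = \<tau> i"
      using \<phi>\<tau>[OF i, of "\<sigma> i \<cdot>\<^bsub>V\<^esub> \<tau> i"] i H.D.cmp_eq_assoc1[OF \<tau>\<sigma>, of i "\<tau> i"] by simp
    then have "\<sigma> i \<cdot>\<^bsub>V\<^esub> \<tau> i = \<psi> (fob H i) i (\<tau> i)"
      using \<psi>\<phi>[of "fob H i" i "\<sigma> i \<cdot>\<^bsub>V\<^esub> \<tau> i"] i by (simp add: in_hom)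
    also have "\<dots> = Idn V (fob H i)"
      using \<psi>\<phi>[of "fob H i" i "Idn V (fob H i)"] i by (simp add: in_hom flip: \<tau>_def)
    finally show ?thesis .
  qed
  then have "is_iso V (\<tau> i)" if "i \<in> Obj I" for i
    using that by (intro is_isoI[of _ _ "\<sigma> i"]) (simp_all add: \<tau>\<sigma>)
  moreover have "\<tau> (Cod I f) \<cdot>\<^bsub>V\<^esub> far H f = far H' f \<cdot>\<^bsub>V\<^esub> \<tau> (Dom I f)" if "f \<in> Arr I" for f
    using n[of "Idn V (fob H (Dom I f))" f "Idn V (fob H (Dom I f))"] that
      \<phi>\<tau>[of "Cod I f" "far H f"] by (simp add: in_hom flip: \<tau>_def)
  ultimately show ?thesis
    by (intro nat_isomorphicI[of _ _ _ _ \<tau>]) (simp_all add: H H')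
qed

text \<open>By the Yoneda lemma, bijections \<open>V (v, H (a, b)) \<cong> C (L (v, a), R b)\<close> natural in all variables
  determine \<open>H\<close> up to isomorphism.\<close>

definition rep_map :: "('v, 'w) cat \<Rightarrow> ('j, 'f) cat \<Rightarrow> ('k, 'g) cat
    \<Rightarrow> ('j \<times> 'k, 'f \<times> 'g, 'v, 'w) fctr \<Rightarrow> ('o, 'a) cat
    \<Rightarrow> ('v \<times> 'j, 'w \<times> 'f, 'o, 'a) fctr \<Rightarrow> ('k, 'g, 'o, 'a) fctr
    \<Rightarrow> ('v \<Rightarrow> 'j \<Rightarrow> 'k \<Rightarrow> 'w \<Rightarrow> 'a) \<Rightarrow> ('v \<Rightarrow> 'j \<Rightarrow> 'k \<Rightarrow> 'a \<Rightarrow> 'w) \<Rightarrow> bool" where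
  "rep_map V A B H C L R \<phi> \<psi> \<longleftrightarrow> is_functor (op_cat A \<times>\<^sub>c B) V H \<and>
     is_functor (V \<times>\<^sub>c A) C L \<and> is_functor B C R \<and> category A \<and>
     (\<forall>v \<in> Obj V. \<forall>a \<in> Obj A. \<forall>b \<in> Obj B. \<forall>h \<in> hom V v (fob H (a, b)).
        \<phi> v a b h \<in> hom C (fob L (v, a)) (fob R b) \<and> \<psi> v a b (\<phi> v a b h) = h) \<and>
     (\<forall>v \<in> Obj V. \<forall>a \<in> Obj A. \<forall>b \<in> Obj B. \<forall>h \<in> hom C (fob L (v, a)) (fob R b).
        \<psi> v a b h \<in> hom V v (fob H (a, b)) \<and> \<phi> v a b (\<psi> v a b h) = h) \<and>
     (\<forall>u \<in> Arr V. \<forall>p \<in> Arr A. \<forall>q \<in> Arr B. \<forall>h \<in> hom V (Cod V u) (fob H (Cod A p, Dom B q)).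
        \<phi> (Dom V u) (Dom A p) (Cod B q) (far H (p, q) \<cdot>\<^bsub>V\<^esub> h \<cdot>\<^bsub>V\<^esub> u) =
        far R q \<cdot>\<^bsub>C\<^esub> \<phi> (Cod V u) (Cod A p) (Dom B q) h \<cdot>\<^bsub>C\<^esub> far L (u, p))"

definition hom_rep :: "('v, 'w) cat \<Rightarrow> ('j, 'f) cat \<Rightarrow> ('k, 'g) cat
    \<Rightarrow> ('j \<times> 'k, 'f \<times> 'g, 'v, 'w) fctr \<Rightarrow> ('o, 'a) cat
    \<Rightarrow> ('v \<times> 'j, 'w \<times> 'f, 'o, 'a) fctr \<Rightarrow> ('k, 'g, 'o, 'a) fctr \<Rightarrow> bool" where
  "hom_rep V A B H C L R \<longleftrightarrow> (\<exists>\<phi> \<psi>. rep_map V A B H C L R \<phi> \<psi>)"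

lemma rep_mapD:
  assumes "rep_map V A B H C L R \<phi> \<psi>"
  shows "is_functor (op_cat A \<times>\<^sub>c B) V H" "is_functor (V \<times>\<^sub>c A) C L" "is_functor B C R" "category A"
    and "v \<in> Obj V \<Longrightarrow> a \<in> Obj A \<Longrightarrow> b \<in> Obj B \<Longrightarrow> h \<in> hom V v (fob H (a, b)) \<Longrightarrow>
      \<phi> v a b h \<in> hom C (fob L (v, a)) (fob R b)"
    and "v \<in> Obj V \<Longrightarrow> a \<in> Obj A \<Longrightarrow> b \<in> Obj B \<Longrightarrow> h \<in> hom V v (fob H (a, b)) \<Longrightarrow>
      \<psi> v a b (\<phi> v a b h) = h"
    and "v \<in> Obj V \<Longrightarrow> a \<in> Obj A \<Longrightarrow> b \<in> Obj B \<Longrightarrow> g \<in> hom C (fob L (v, a)) (fob R b) \<Longrightarrow>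
      \<psi> v a b g \<in> hom V v (fob H (a, b))"
    and "v \<in> Obj V \<Longrightarrow> a \<in> Obj A \<Longrightarrow> b \<in> Obj B \<Longrightarrow> g \<in> hom C (fob L (v, a)) (fob R b) \<Longrightarrow>
      \<phi> v a b (\<psi> v a b g) = g"
    and "u \<in> Arr V \<Longrightarrow> p \<in> Arr A \<Longrightarrow> q \<in> Arr B \<Longrightarrow> k \<in> hom V (Cod V u) (fob H (Cod A p, Dom B q)) \<Longrightarrow>
      \<phi> (Dom V u) (Dom A p) (Cod B q) (far H (p, q) \<cdot>\<^bsub>V\<^esub> k \<cdot>\<^bsub>V\<^esub> u) =
      far R q \<cdot>\<^bsub>C\<^esub> \<phi> (Cod V u) (Cod A p) (Dom B q) k \<cdot>\<^bsub>C\<^esub> far L (u, p)"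
  using assms unfolding rep_map_def by simp_all

lemma hom_repD:
  assumes "hom_rep V A B H C L R"
  shows "is_functor (op_cat A \<times>\<^sub>c B) V H" "is_functor (V \<times>\<^sub>c A) C L" "is_functor B C R" "category A"
  using assms by (auto simp: hom_rep_def dest: rep_mapD)

lemma hom_rep_prof_iso:
  assumes H: "hom_rep V A B H C L R" and P: "prof_iso (V \<times>\<^sub>c A) B C L R C' L' R'"
  shows "hom_rep V A B H C' L' R'"
proof -
  obtain \<phi> \<psi> where R: "rep_map V A B H C L R \<phi> \<psi>" using H by (auto simp: hom_rep_def)
  obtain \<phi>' \<psi>' where \<phi>': "prof_map (V \<times>\<^sub>c A) B C L R C' L' R' \<phi>'"
    and \<psi>': "prof_map (V \<times>\<^sub>c A) B C' L' R' C L R \<psi>'"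
    and i: "\<And>j k h. j \<in> Obj (V \<times>\<^sub>c A) \<Longrightarrow> k \<in> Obj B \<Longrightarrow> h \<in> hom C (fob L j) (fob R k) \<Longrightarrow> \<psi>' j k (\<phi>' j k h) = h"
    "\<And>j k h. j \<in> Obj (V \<times>\<^sub>c A) \<Longrightarrow> k \<in> Obj B \<Longrightarrow> h \<in> hom C' (fob L' j) (fob R' k) \<Longrightarrow> \<phi>' j k (\<psi>' j k h) = h"
    using P by (rule prof_isoE) blast
  interpret A: category A by (rule hom_repD[OF H])
  interpret R: func B C R by unfold_locales (rule hom_repD[OF H])
  interpret H: func "op_cat A \<times>\<^sub>c B" V H by unfold_locales (rule hom_repD[OF H])
  have "rep_map V A B H C' L' R' (\<lambda>v a b h. \<phi>' (v, a) b (\<phi> v a b h)) (\<lambda>v a b h. \<psi> v a b (\<psi>' (v, a) b h))"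
    unfolding rep_map_def
  proof (intro conjI ballI)
    fix u p q h
    assume u: "u \<in> Arr V" and p: "p \<in> Arr A" and q: "q \<in> Arr B"
      and h: "h \<in> hom V (Cod V u) (fob H (Cod A p, Dom B q))"
    show "\<phi>' (Dom V u, Dom A p) (Cod B q) (\<phi> (Dom V u) (Dom A p) (Cod B q) (far H (p, q) \<cdot>\<^bsub>V\<^esub> h \<cdot>\<^bsub>V\<^esub> u)) =
      far R' q \<cdot>\<^bsub>C'\<^esub> \<phi>' (Cod V u, Cod A p) (Dom B q) (\<phi> (Cod V u) (Cod A p) (Dom B q) h) \<cdot>\<^bsub>C'\<^esub> far L' (u, p)"
      using prof_mapD(6)[OF \<phi>', of "(u, p)" q] rep_mapD(5,9)[OF R] u p q h by simp
  qed (use hom_repD[OF H] prof_isoD[OF P] in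
    \<open>simp_all add: rep_mapD(5-8)[OF R] prof_mapD(5)[OF \<phi>'] prof_mapD(5)[OF \<psi>'] i\<close>)
  then show ?thesis by (auto simp: hom_rep_def)
qed

text \<open>Substituting functors for the two arguments of a hom-object amounts to substituting them
  in \<open>L\<close> and \<open>R\<close>. The hom-objects on both sides of the isomorphisms to be
  proved arise from \<open>homs\<close> in this way.\<close>

lemma hom_rep_fcomp:
  assumes H: "hom_rep V A B H C L R" and F: "is_functor A' A F" and G: "is_functor B' B G"
  shows "hom_rep V A' B' (H \<circ>\<^sub>f (F \<times>\<^sub>f G)) C (L \<circ>\<^sub>f (idf \<times>\<^sub>f F)) (R \<circ>\<^sub>f G)"
proof -
  obtain \<phi> \<psi> where R: "rep_map V A B H C L R \<phi> \<psi>" using H by (auto simp: hom_rep_def)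
  interpret F: func A' A F by unfold_locales fact
  interpret G: func B' B G by unfold_locales fact
  have "is_functor (op_cat A' \<times>\<^sub>c B') V (H \<circ>\<^sub>f (F \<times>\<^sub>f G))"
    by (rule is_functor_fcomp[OF is_functor_fprod[OF is_functor_op[OF F] G] rep_mapD(1)[OF R]])
  moreover have "is_functor (V \<times>\<^sub>c A') C (L \<circ>\<^sub>f (idf \<times>\<^sub>f F))"
    using is_functorD(2)[OF rep_mapD(1)[OF R]]
    by (intro is_functor_fcomp[OF is_functor_fprod[OF _ F] rep_mapD(2)[OF R]] is_functor_idf)
  moreover have "is_functor B' C (R \<circ>\<^sub>f G)"
    by (rule is_functor_fcomp[OF G rep_mapD(3)[OF R]])
  moreover have
    "\<phi> (Dom V u) (fob F (Dom A' p)) (fob G (Cod B' q)) (far H (far F p, far G q) \<cdot>\<^bsub>V\<^esub> h \<cdot>\<^bsub>V\<^esub> u) =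
     far R (far G q) \<cdot>\<^bsub>C\<^esub> \<phi> (Cod V u) (fob F (Cod A' p)) (fob G (Dom B' q)) h \<cdot>\<^bsub>C\<^esub> far L (u, far F p)"
    if "u \<in> Arr V" "p \<in> Arr A'" "q \<in> Arr B'" "h \<in> hom V (Cod V u) (fob H (fob F (Cod A' p), fob G (Dom B' q)))"
    for u p q h
    using rep_mapD(9)[OF R, of u "far F p" "far G q" h] that by simp
  ultimately have "rep_map V A' B' (H \<circ>\<^sub>f (F \<times>\<^sub>f G)) C (L \<circ>\<^sub>f (idf \<times>\<^sub>f F)) (R \<circ>\<^sub>f G)
      (\<lambda>v a b. \<phi> v (fob F a) (fob G b)) (\<lambda>v a b. \<psi> v (fob F a) (fob G b))"
    unfolding rep_map_def using F.C.category_axioms by (simp add: rep_mapD(5-8)[OF R])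
  then show ?thesis by (auto simp: hom_rep_def)
qed

text \<open>As the represented hom-sets agree, \<psi>' \<phi> and \<psi> \<phi>' are mutually
  inverse bijections between V(v, H(a, b)) and V(v, H'(a, b)), to which Yoneda applies. An
  isomorphism of hom-objects thus only requires a natural bijection between arrows of
  fibres.\<close>

lemma hom_rep_unique:
  assumes H: "hom_rep V A B H C L R" and H': "hom_rep V A B H' C L R"
  shows "nat_isomorphic (op_cat A \<times>\<^sub>c B) V H H'"
proof -
  obtain \<phi> \<psi> where R: "rep_map V A B H C L R \<phi> \<psi>" using H by (auto simp: hom_rep_def)
  obtain \<phi>' \<psi>' where R': "rep_map V A B H' C L R \<phi>' \<psi>'" using H' by (auto simp: hom_rep_def)
  interpret H: func "op_cat A \<times>\<^sub>c B" V H using hom_repD[OF H] by unfold_locales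
  interpret H': func "op_cat A \<times>\<^sub>c B" V H' using hom_repD[OF H'] by unfold_locales
  interpret A: category A using hom_repD[OF H] by simp
  interpret R: func B C R using hom_repD[OF H] by unfold_locales
  note rep = rep_mapD(5-8)[OF R] rep_mapD(5-8)[OF R']
  show ?thesis
  proof (rule yoneda_nat_isomorphic[of _ _ _ _ "\<lambda>v i h. \<psi>' v (fst i) (snd i) (\<phi> v (fst i) (snd i) h)"
        "\<lambda>v i h. \<psi> v (fst i) (snd i) (\<phi>' v (fst i) (snd i) h)"])
    fix u f h
    assume u: "u \<in> Arr V" and f: "f \<in> Arr (op_cat A \<times>\<^sub>c B)"
      and h: "h \<in> hom V (Cod V u) (fob H (Dom (op_cat A \<times>\<^sub>c B) f))"
    obtain p q where pq: "f = (p, q)" "p \<in> Arr A" "q \<in> Arr B" using f by auto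
    let ?k = "\<psi>' (Cod V u) (Cod A p) (Dom B q) (\<phi> (Cod V u) (Cod A p) (Dom B q) h)"
    have h': "h \<in> hom V (Cod V u) (fob H (Cod A p, Dom B q))"
      using pq h by auto
    have f: "\<phi> (Cod V u) (Cod A p) (Dom B q) h \<in> hom C (fob L (Cod V u, Cod A p)) (fob R (Dom B q))"
      using rep u pq h' by simp
    have k: "?k \<in> hom V (Cod V u) (fob H' (Cod A p, Dom B q))"
      using rep f u pq by simp
    \<comment> \<open>The assumptions provide naturality of \<phi>' but not of \<psi>'. The latter
      is obtained by applying \<psi>' to the naturality equation of \<phi>' at
      \<open>?k\<close>.\<close>
    have "far H' (p, q) \<cdot>\<^bsub>V\<^esub> ?k \<cdot>\<^bsub>V\<^esub> u \<in> hom V (Dom V u) (fob H' (Dom A p, Cod B q))"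
      using k u pq by (simp add: in_hom)
    from rep_mapD(6)[OF R' _ _ _ this] rep_mapD(9)[OF R' u pq(2,3) k] rep_mapD(9)[OF R u pq(2,3) h']
      rep_mapD(8)[OF R' _ _ _ f]
    have "\<psi>' (Dom V u) (Dom A p) (Cod B q) (\<phi> (Dom V u) (Dom A p) (Cod B q) (far H (p, q) \<cdot>\<^bsub>V\<^esub> h \<cdot>\<^bsub>V\<^esub> u))
      = far H' (p, q) \<cdot>\<^bsub>V\<^esub> ?k \<cdot>\<^bsub>V\<^esub> u"
      using u pq by simp
    then show "\<psi>' (Dom V u) (fst (Cod (op_cat A \<times>\<^sub>c B) f)) (snd (Cod (op_cat A \<times>\<^sub>c B) f))
        (\<phi> (Dom V u) (fst (Cod (op_cat A \<times>\<^sub>c B) f)) (snd (Cod (op_cat A \<times>\<^sub>c B) f)) (far H f \<cdot>\<^bsub>V\<^esub> h \<cdot>\<^bsub>V\<^esub> u)) =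
      far H' f \<cdot>\<^bsub>V\<^esub> \<psi>' (Cod V u) (fst (Dom (op_cat A \<times>\<^sub>c B) f)) (snd (Dom (op_cat A \<times>\<^sub>c B) f))
        (\<phi> (Cod V u) (fst (Dom (op_cat A \<times>\<^sub>c B) f)) (snd (Dom (op_cat A \<times>\<^sub>c B) f)) h) \<cdot>\<^bsub>V\<^esub> u"
      using pq by simp
  qed (auto simp: H.is_func H'.is_func rep)
qed

text \<open>V(v, E H(a, b)) \<cong> C(U v, H(a, b)) \<cong> C'(L (U v, a), R b). With
  \<open>H\<close> the exponential and U \<stileturn> E the adjunction of \<open>Xb\<close> and
  \<open>end_fun\<close>, this is the representation of \<open>homs\<close>.\<close>

lemma hom_rep_adjoint:
  assumes H: "hom_rep C A B H C' L R" and adj: "adjoint V C U E"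
  shows "hom_rep V A B (E \<circ>\<^sub>f H) C' (L \<circ>\<^sub>f (U \<times>\<^sub>f idf)) R"
proof -
  obtain \<phi> \<psi> where R: "rep_map C A B H C' L R \<phi> \<psi>" using H by (auto simp: hom_rep_def)
  interpret U: func V C U by unfold_locales (rule adjoint_functors[OF adj])
  interpret E: func C V E by unfold_locales (rule adjoint_functors[OF adj])
  interpret H: func "op_cat A \<times>\<^sub>c B" C H by unfold_locales (rule rep_mapD[OF R])
  interpret A: category A by (rule rep_mapD[OF R])
  interpret R: func B C' R by unfold_locales (rule rep_mapD[OF R])
  obtain \<theta> \<kappa> where \<theta>: "prof_map V C C U idf V idf E \<theta>" and \<kappa>: "prof_map V C V idf E C U idf \<kappa>"
    and i: "\<And>j k h. j \<in> Obj V \<Longrightarrow> k \<in> Obj C \<Longrightarrow> h \<in> hom C (fob U j) k \<Longrightarrow> \<kappa> j k (\<theta> j k h) = h"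
    "\<And>j k h. j \<in> Obj V \<Longrightarrow> k \<in> Obj C \<Longrightarrow> h \<in> hom V j (fob E k) \<Longrightarrow> \<theta> j k (\<kappa> j k h) = h"
    using adj[unfolded adjoint_iff_prof_iso] by (rule prof_isoE) simp
  note a = prof_mapD(5)[OF \<theta>, simplified] prof_mapD(5)[OF \<kappa>, simplified] i
  have "rep_map V A B (E \<circ>\<^sub>f H) C' (L \<circ>\<^sub>f (U \<times>\<^sub>f idf)) R
      (\<lambda>v a b h. \<phi> (fob U v) a b (\<kappa> v (fob H (a, b)) h)) (\<lambda>v a b h. \<theta> v (fob H (a, b)) (\<psi> (fob U v) a b h))"
    unfolding rep_map_def
  proof (intro conjI ballI)
    fix u p q h
    assume u: "u \<in> Arr V" and p: "p \<in> Arr A" and q: "q \<in> Arr B"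
      and h: "h \<in> hom V (Cod V u) (fob (E \<circ>\<^sub>f H) (Cod A p, Dom B q))"
    have "\<kappa> (Dom V u) (fob H (Dom A p, Cod B q)) (far (E \<circ>\<^sub>f H) (p, q) \<cdot>\<^bsub>V\<^esub> h \<cdot>\<^bsub>V\<^esub> u) =
        far H (p, q) \<cdot>\<^bsub>C\<^esub> \<kappa> (Cod V u) (fob H (Cod A p, Dom B q)) h \<cdot>\<^bsub>C\<^esub> far U u"
      using prof_mapD(6)[OF \<kappa>, of u "far H (p, q)" h] u p q h by simp
    then show "\<phi> (fob U (Dom V u)) (Dom A p) (Cod B q)
        (\<kappa> (Dom V u) (fob H (Dom A p, Cod B q)) (far (E \<circ>\<^sub>f H) (p, q) \<cdot>\<^bsub>V\<^esub> h \<cdot>\<^bsub>V\<^esub> u)) =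
      far R q \<cdot>\<^bsub>C'\<^esub> \<phi> (fob U (Cod V u)) (Cod A p) (Dom B q) (\<kappa> (Cod V u) (fob H (Cod A p, Dom B q)) h) \<cdot>\<^bsub>C'\<^esub>
        far (L \<circ>\<^sub>f (U \<times>\<^sub>f idf)) (u, p)"
      using rep_mapD(9)[OF R, of "far U u" p q "\<kappa> (Cod V u) (fob H (Cod A p, Dom B q)) h"] a u p q h
      by simp
  next
    show "is_functor (op_cat A \<times>\<^sub>c B) V (E \<circ>\<^sub>f H)" by (rule is_functor_fcomp[OF H.is_func E.is_func])
    show "is_functor (V \<times>\<^sub>c A) C' (L \<circ>\<^sub>f (U \<times>\<^sub>f idf))"
      by (rule is_functor_fcomp[OF is_functor_fprod[OF U.is_func is_functor_idf] rep_mapD(2)[OF R]])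
        (rule A.category_axioms)
    show "is_functor B C' R" by (rule R.is_func)
    show "category A" by (rule A.category_axioms)
  qed (simp_all add: rep_mapD(5-8)[OF R] a)
  then show ?thesis by (auto simp: hom_rep_def)
qed

section \<open>Cartesian categories and reflections\<close>

locale cart_cat =
  fixes C :: "('o, 'a) cat" and S :: "('o, 'a, 'z) cart_scheme"
  assumes is_cart: "cartesian C S"
begin

sublocale category C using is_cart by (simp add: cartesian_def)

lemma tm_obj [simp]: "tm S \<in> Obj C"
  using is_cart by (simp add: cartesian_def terminal_def)

lemma tm_eqI:
  assumes "f \<in> Arr C" "g \<in> Arr C" "Dom C f = Dom C g" "Cod C f = tm S" "Cod C g = tm S"
  shows "f = g"
proof -
  have "\<exists>!h. h \<in> hom C (Dom C f) (tm S)"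
    using is_cart assms(1) by (simp add: cartesian_def terminal_def)
  then show ?thesis using assms by (auto simp: in_hom)
qed

lemma bang_tm [simp]:
  assumes "a \<in> Obj C"
  shows "bang C (tm S) a \<in> Arr C" "Dom C (bang C (tm S) a) = a" "Cod C (bang C (tm S) a) = tm S"
proof -
  have "\<exists>!h. h \<in> hom C a (tm S)"
    using is_cart assms by (simp add: cartesian_def terminal_def)
  then have "bang C (tm S) a \<in> hom C a (tm S)"
    unfolding bang_def by (rule theI')
  then show "bang C (tm S) a \<in> Arr C" "Dom C (bang C (tm S) a) = a" "Cod C (bang C (tm S) a) = tm S"
    by (simp_all add: in_hom)
qed

lemma prd_simps [simp]:
  assumes "a \<in> Obj C" "b \<in> Obj C"
  shows "prd S a b \<in> Obj C" "pr1 S a b \<in> Arr C" "Dom C (pr1 S a b) = prd S a b" "Cod C (pr1 S a b) = a"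
    "pr2 S a b \<in> Arr C" "Dom C (pr2 S a b) = prd S a b" "Cod C (pr2 S a b) = b"
proof -
  have "prd S a b \<in> Obj C \<and> pr1 S a b \<in> hom C (prd S a b) a \<and> pr2 S a b \<in> hom C (prd S a b) b"
    using is_cart assms by (simp add: cartesian_def)
  then show "prd S a b \<in> Obj C" "pr1 S a b \<in> Arr C" "Dom C (pr1 S a b) = prd S a b" "Cod C (pr1 S a b) = a"
    "pr2 S a b \<in> Arr C" "Dom C (pr2 S a b) = prd S a b" "Cod C (pr2 S a b) = b"
    by (simp_all add: in_hom)
qed

lemma prd_ex1:
  assumes "f \<in> Arr C" "g \<in> Arr C" "Dom C f = Dom C g"
  shows "\<exists>!h. h \<in> hom C (Dom C f) (prd S (Cod C f) (Cod C g)) \<and>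
     pr1 S (Cod C f) (Cod C g) \<cdot>\<^bsub>C\<^esub> h = f \<and> pr2 S (Cod C f) (Cod C g) \<cdot>\<^bsub>C\<^esub> h = g"
proof -
  have "f \<in> hom C (Dom C f) (Cod C f)" "g \<in> hom C (Dom C f) (Cod C g)"
    using assms by (simp_all add: in_hom)
  moreover have "Dom C f \<in> Obj C" "Cod C f \<in> Obj C" "Cod C g \<in> Obj C" using assms by simp_all
  ultimately show ?thesis
    using is_cart unfolding cartesian_def by blast
qed

lemma prd_eqI:
  assumes "h \<in> Arr C" "h' \<in> Arr C" "Dom C h = Dom C h'" "Cod C h = prd S a b" "Cod C h' = prd S a b"
    "a \<in> Obj C" "b \<in> Obj C"
    "pr1 S a b \<cdot>\<^bsub>C\<^esub> h = pr1 S a b \<cdot>\<^bsub>C\<^esub> h'" "pr2 S a b \<cdot>\<^bsub>C\<^esub> h = pr2 S a b \<cdot>\<^bsub>C\<^esub> h'"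
  shows "h = h'"
proof -
  have "\<exists>!k. k \<in> hom C (Dom C h) (prd S a b) \<and>
      pr1 S a b \<cdot>\<^bsub>C\<^esub> k = pr1 S a b \<cdot>\<^bsub>C\<^esub> h \<and> pr2 S a b \<cdot>\<^bsub>C\<^esub> k = pr2 S a b \<cdot>\<^bsub>C\<^esub> h"
    using prd_ex1[of "pr1 S a b \<cdot>\<^bsub>C\<^esub> h" "pr2 S a b \<cdot>\<^bsub>C\<^esub> h"] assms(1-7) by simp
  then show ?thesis
    using assms by (elim ex1E) (auto simp: in_hom)
qed

lemma tup_hom:
  assumes "f \<in> Arr C" "g \<in> Arr C" "Dom C f = Dom C g"
  shows "tup C S f g \<in> hom C (Dom C f) (prd S (Cod C f) (Cod C g)) \<and>
     pr1 S (Cod C f) (Cod C g) \<cdot>\<^bsub>C\<^esub> tup C S f g = f \<and> pr2 S (Cod C f) (Cod C g) \<cdot>\<^bsub>C\<^esub> tup C S f g = g"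
  unfolding tup_def by (rule theI'[OF prd_ex1[OF assms]])

lemma tup_simps [simp]:
  assumes "f \<in> Arr C" "g \<in> Arr C" "Dom C f = Dom C g"
  shows "tup C S f g \<in> Arr C" "Dom C (tup C S f g) = Dom C g"
    "Cod C (tup C S f g) = prd S (Cod C f) (Cod C g)"
    "Cod C f = a \<Longrightarrow> Cod C g = b \<Longrightarrow> pr1 S a b \<cdot>\<^bsub>C\<^esub> tup C S f g = f"
    "Cod C f = a \<Longrightarrow> Cod C g = b \<Longrightarrow> pr2 S a b \<cdot>\<^bsub>C\<^esub> tup C S f g = g"
  using tup_hom[OF assms] assms(3) by (auto simp: in_hom)

lemma pr_tup_assoc [simp]:
  assumes "f \<in> Arr C" "g \<in> Arr C" "Dom C f = Dom C g" "Cod C f = a" "Cod C g = b" "x \<in> Arr C" "Cod C x = Dom C g"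
  shows "pr1 S a b \<cdot>\<^bsub>C\<^esub> tup C S f g \<cdot>\<^bsub>C\<^esub> x = f \<cdot>\<^bsub>C\<^esub> x"
    "pr2 S a b \<cdot>\<^bsub>C\<^esub> tup C S f g \<cdot>\<^bsub>C\<^esub> x = g \<cdot>\<^bsub>C\<^esub> x"
proof -
  have "a \<in> Obj C" "b \<in> Obj C" using assms by auto
  with assms show "pr1 S a b \<cdot>\<^bsub>C\<^esub> tup C S f g \<cdot>\<^bsub>C\<^esub> x = f \<cdot>\<^bsub>C\<^esub> x"
    "pr2 S a b \<cdot>\<^bsub>C\<^esub> tup C S f g \<cdot>\<^bsub>C\<^esub> x = g \<cdot>\<^bsub>C\<^esub> x"
    by (auto intro!: cmp_eq_assoc1)
qed

lemma tup_cmp [simp]: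
  assumes "f \<in> Arr C" "g \<in> Arr C" "Dom C f = Dom C g" "x \<in> Arr C" "Cod C x = Dom C g"
  shows "tup C S f g \<cdot>\<^bsub>C\<^esub> x = tup C S (f \<cdot>\<^bsub>C\<^esub> x) (g \<cdot>\<^bsub>C\<^esub> x)"
  by (rule prd_eqI[of _ _ "Cod C f" "Cod C g"]) (use assms in simp_all)

lemma tup_eta:
  assumes "h \<in> Arr C" "Cod C h = prd S a b" "a \<in> Obj C" "b \<in> Obj C"
  shows "tup C S (pr1 S a b \<cdot>\<^bsub>C\<^esub> h) (pr2 S a b \<cdot>\<^bsub>C\<^esub> h) = h"
  by (rule prd_eqI[of _ _ a b]) (use assms in simp_all)

lemma tup_pr [simp]: "a \<in> Obj C \<Longrightarrow> b \<in> Obj C \<Longrightarrow> tup C S (pr1 S a b) (pr2 S a b) = Idn C (prd S a b)"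
  by (rule prd_eqI[of _ _ a b]) simp_all

lemma prd_map_simps [simp]:
  assumes "f \<in> Arr C" "g \<in> Arr C"
  shows "prd_map C S f g \<in> Arr C" "Dom C (prd_map C S f g) = prd S (Dom C f) (Dom C g)"
    "Cod C (prd_map C S f g) = prd S (Cod C f) (Cod C g)"
    "Cod C f = a \<Longrightarrow> Cod C g = b \<Longrightarrow> pr1 S a b \<cdot>\<^bsub>C\<^esub> prd_map C S f g = f \<cdot>\<^bsub>C\<^esub> pr1 S (Dom C f) (Dom C g)"
    "Cod C f = a \<Longrightarrow> Cod C g = b \<Longrightarrow> pr2 S a b \<cdot>\<^bsub>C\<^esub> prd_map C S f g = g \<cdot>\<^bsub>C\<^esub> pr2 S (Dom C f) (Dom C g)"
  using assms by (auto simp: prd_map_def)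

lemma prd_map_tup [simp]:
  assumes "f \<in> Arr C" "g \<in> Arr C" "x \<in> Arr C" "y \<in> Arr C" "Dom C x = Dom C y"
    "Cod C x = Dom C f" "Cod C y = Dom C g"
  shows "prd_map C S f g \<cdot>\<^bsub>C\<^esub> tup C S x y = tup C S (f \<cdot>\<^bsub>C\<^esub> x) (g \<cdot>\<^bsub>C\<^esub> y)"
  using assms by (simp add: prd_map_def)

lemma prd_map_prd_map [simp]:
  assumes "f \<in> Arr C" "g \<in> Arr C" "x \<in> Arr C" "y \<in> Arr C"
    "Cod C x = Dom C f" "Cod C y = Dom C g"
  shows "prd_map C S f g \<cdot>\<^bsub>C\<^esub> prd_map C S x y = prd_map C S (f \<cdot>\<^bsub>C\<^esub> x) (g \<cdot>\<^bsub>C\<^esub> y)"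
  using assms by (simp add: prd_map_def)

lemma prd_map_id [simp]:
  "a \<in> Obj C \<Longrightarrow> b \<in> Obj C \<Longrightarrow> prd_map C S (Idn C a) (Idn C b) = Idn C (prd S a b)"
  by (simp add: prd_map_def)

lemma prd_fun_simps [simp]:
  "fob (prd_fun C S) (a, b) = prd S a b" "far (prd_fun C S) (f, g) = prd_map C S f g"
  by (simp_all add: prd_fun_def)

lemma is_functor_prd_fun: "is_functor (C \<times>\<^sub>c C) C (prd_fun C S)"
  by (rule is_functorI) (auto intro: category_prod_cat category_axioms)

end

definition swap_fun :: "('o \<times> 'p, 'a \<times> 'b, 'p \<times> 'o, 'b \<times> 'a) fctr" where
  "swap_fun = \<lparr>fob = prod.swap, far = prod.swap\<rparr>"

lemma swap_fun_simps [simp]: "fob swap_fun (a, b) = (b, a)" "far swap_fun (f, g) = (g, f)"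
  by (simp_all add: swap_fun_def)

lemma is_functor_swap_fun:
  assumes "category C" "category D" shows "is_functor (C \<times>\<^sub>c D) (D \<times>\<^sub>c C) swap_fun"
  by (rule is_functorI) (auto intro: assms category_prod_cat)

lemma fprod_swap_fun: "(F \<times>\<^sub>f G) \<circ>\<^sub>f swap_fun = swap_fun \<circ>\<^sub>f (G \<times>\<^sub>f F)"
  by (auto simp: fcomp_def fprod_def swap_fun_def)

text \<open>All Frobenius laws are stated with the substituted or included object as the right
  factor, whereas U v is the left factor in the representation of the hom-objects. The symmetry of
  products mediates between the two conventions.\<close>

lemma (in cart_cat) nat_isomorphic_swap:
  assumes F: "is_functor A C F" and G: "is_functor B C G"
  shows "nat_isomorphic (A \<times>\<^sub>c B) C (prd_fun C S \<circ>\<^sub>f (F \<times>\<^sub>f G)) (prd_fun C S \<circ>\<^sub>f (G \<times>\<^sub>f F) \<circ>\<^sub>f swap_fun)"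
proof -
  have "nat_isomorphic (C \<times>\<^sub>c C) C (prd_fun C S) (prd_fun C S \<circ>\<^sub>f swap_fun)"
  proof (rule nat_isomorphicI[of _ _ _ _ "\<lambda>(a, b). tup C S (pr2 S a b) (pr1 S a b)"])
    fix x assume "x \<in> Obj (C \<times>\<^sub>c C)"
    then obtain a b where "x = (a, b)" "a \<in> Obj C" "b \<in> Obj C" by auto
    then show "is_iso C (case x of (a, b) \<Rightarrow> tup C S (pr2 S a b) (pr1 S a b))"
      by (auto intro!: is_isoI[of _ _ "tup C S (pr2 S b a) (pr1 S b a)"])
  qed (auto intro!: is_functor_fcomp[OF _ is_functor_prd_fun] is_functor_swap_fun is_functor_prd_fun category_axioms)
  from nat_isomorphic_pre[OF this is_functor_fprod[OF F G]]
  show ?thesis by (simp add: fprod_swap_fun)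
qed

text \<open>The arrows x and y transpose to arrows out of F c, which are tupled in \<open>D\<close>
  and transposed back; this is why right adjoints preserve products.\<close>

lemma adjoint_unique_lift:
  assumes adj: "adjoint C D F G" and S: "cartesian C S" and T: "cartesian D T"
    and ab: "a \<in> Obj D" "b \<in> Obj D"
    and x: "x \<in> hom C c (fob G a)" and y: "y \<in> hom C c (fob G b)"
  shows "\<exists>!h. h \<in> hom C c (fob G (prd T a b)) \<and> far G (pr1 T a b) \<cdot>\<^bsub>C\<^esub> h = x \<and> far G (pr2 T a b) \<cdot>\<^bsub>C\<^esub> h = y"
proof -
  interpret F: func C D F by unfold_locales (rule adjoint_functors[OF adj])
  interpret G: func D C G by unfold_locales (rule adjoint_functors[OF adj])
  interpret T: cart_cat D T by unfold_locales fact
  obtain \<theta> \<kappa> where \<theta>: "prof_map C D D F idf C idf G \<theta>" and \<kappa>: "prof_map C D C idf G D F idf \<kappa>"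
    and i: "\<And>j k h. j \<in> Obj C \<Longrightarrow> k \<in> Obj D \<Longrightarrow> h \<in> hom D (fob F j) k \<Longrightarrow> \<kappa> j k (\<theta> j k h) = h"
    "\<And>j k h. j \<in> Obj C \<Longrightarrow> k \<in> Obj D \<Longrightarrow> h \<in> hom C j (fob G k) \<Longrightarrow> \<theta> j k (\<kappa> j k h) = h"
    using adj[unfolded adjoint_iff_prof_iso] by (rule prof_isoE) simp
  note a = prof_mapD(5)[OF \<theta>, simplified] prof_mapD(5)[OF \<kappa>, simplified] i
  have c: "c \<in> Obj C" using x by (auto simp: in_hom)
  let ?k = "tup D T (\<kappa> c a x) (\<kappa> c b y)"
  have kx: "\<kappa> c a x \<in> hom D (fob F c) a" and ky: "\<kappa> c b y \<in> hom D (fob F c) b"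
    using a c ab x y by simp_all
  then have k: "?k \<in> hom D (fob F c) (prd T a b)" using T.tup_simps by (auto simp: in_hom)
  have t: "\<theta> c (Cod D q) (q \<cdot>\<^bsub>D\<^esub> k) = far G q \<cdot>\<^bsub>C\<^esub> \<theta> c (Dom D q) k" if "q \<in> Arr D" "k \<in> hom D (fob F c) (Dom D q)" for q k
    using prof_mapD(6)[OF \<theta>, of "Idn C c" q k] that c a(1)[of c "Dom D q" k] by (simp add: in_hom)
  have t': "\<kappa> c (Cod D q) (far G q \<cdot>\<^bsub>C\<^esub> k) = q \<cdot>\<^bsub>D\<^esub> \<kappa> c (Dom D q) k" if "q \<in> Arr D" "k \<in> hom C c (fob G (Dom D q))" for q k
    using prof_mapD(6)[OF \<kappa>, of "Idn C c" q k] that c a(2)[of c "Dom D q" k] by (simp add: in_hom)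
  show ?thesis
  proof (rule ex1I[of _ "\<theta> c (prd T a b) ?k"], intro conjI)
    show "\<theta> c (prd T a b) ?k \<in> hom C c (fob G (prd T a b))" using a k c ab by simp
    show "far G (pr1 T a b) \<cdot>\<^bsub>C\<^esub> \<theta> c (prd T a b) ?k = x"
      using t[of "pr1 T a b" ?k] k ab kx ky a(4)[of c a x] x c by (simp add: in_hom)
    show "far G (pr2 T a b) \<cdot>\<^bsub>C\<^esub> \<theta> c (prd T a b) ?k = y"
      using t[of "pr2 T a b" ?k] k ab kx ky a(4)[of c b y] y c by (simp add: in_hom)
  next
    fix h assume h: "h \<in> hom C c (fob G (prd T a b)) \<and> far G (pr1 T a b) \<cdot>\<^bsub>C\<^esub> h = x \<and> far G (pr2 T a b) \<cdot>\<^bsub>C\<^esub> h = y"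
    have kh: "\<kappa> c (prd T a b) h \<in> hom D (fob F c) (prd T a b)" using a h ab c by simp
    have "\<kappa> c (prd T a b) h = ?k"
      by (rule T.prd_eqI[of _ _ a b])
        (use h kh k kx ky ab t'[of "pr1 T a b" h] t'[of "pr2 T a b" h] in \<open>simp_all add: in_hom\<close>)
    then show "h = \<theta> c (prd T a b) ?k"
      using a(4)[of c "prd T a b" h] h ab c by simp
  qed
qed

lemma adjoint_preserves_products:
  assumes adj: "adjoint C D F G" and S: "cartesian C S" and T: "cartesian D T"
  shows "nat_isomorphic (D \<times>\<^sub>c D) C (G \<circ>\<^sub>f prd_fun D T) (prd_fun C S \<circ>\<^sub>f (G \<times>\<^sub>f G))"
proof -
  interpret F: func C D F by unfold_locales (rule adjoint_functors[OF adj])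
  interpret G: func D C G by unfold_locales (rule adjoint_functors[OF adj])
  interpret S: cart_cat C S by unfold_locales fact
  interpret T: cart_cat D T by unfold_locales fact
  show ?thesis
  proof (rule nat_isomorphicI[of _ _ _ _ "\<lambda>(a, b). tup C S (far G (pr1 T a b)) (far G (pr2 T a b))"])
    fix x assume "x \<in> Obj (D \<times>\<^sub>c D)"
    then obtain a b where x: "x = (a, b)" and ab [simp]: "a \<in> Obj D" "b \<in> Obj D" by auto
    let ?P = "prd S (fob G a) (fob G b)"
    \<comment> \<open>The inverse of the comparison arrow is the lift of the two
      projections.\<close>
    obtain s where s: "s \<in> hom C ?P (fob G (prd T a b))"
      "far G (pr1 T a b) \<cdot>\<^bsub>C\<^esub> s = pr1 S (fob G a) (fob G b)" "far G (pr2 T a b) \<cdot>\<^bsub>C\<^esub> s = pr2 S (fob G a) (fob G b)"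
      using adjoint_unique_lift[OF adj S T ab, of "pr1 S (fob G a) (fob G b)" ?P "pr2 S (fob G a) (fob G b)"]
      by (auto simp: in_hom)
    let ?t = "tup C S (far G (pr1 T a b)) (far G (pr2 T a b))"
    have "s \<cdot>\<^bsub>C\<^esub> ?t = Idn C (fob G (prd T a b))"
    proof -
      have u: "\<exists>!h. h \<in> hom C (fob G (prd T a b)) (fob G (prd T a b)) \<and>
          far G (pr1 T a b) \<cdot>\<^bsub>C\<^esub> h = far G (pr1 T a b) \<and> far G (pr2 T a b) \<cdot>\<^bsub>C\<^esub> h = far G (pr2 T a b)"
        by (rule adjoint_unique_lift[OF adj S T ab]) (simp_all add: in_hom)
      have 1: "far G (pr1 T a b) \<cdot>\<^bsub>C\<^esub> s \<cdot>\<^bsub>C\<^esub> ?t = far G (pr1 T a b)"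
        using s F.C.cmp_eq_assoc1[OF s(2), of ?t] by (simp add: in_hom)
      have 2: "far G (pr2 T a b) \<cdot>\<^bsub>C\<^esub> s \<cdot>\<^bsub>C\<^esub> ?t = far G (pr2 T a b)"
        using s F.C.cmp_eq_assoc1[OF s(3), of ?t] by (simp add: in_hom)
      show ?thesis
        by (rule ex1_eqI[OF u]) (use s 1 2 in \<open>simp_all add: in_hom\<close>)
    qed
    moreover have "?t \<cdot>\<^bsub>C\<^esub> s = Idn C ?P"
      by (rule S.prd_eqI[of _ _ "fob G a" "fob G b"]) (use s in \<open>simp_all add: in_hom\<close>)
    ultimately show "is_iso C (case x of (a, b) \<Rightarrow> tup C S (far G (pr1 T a b)) (far G (pr2 T a b)))"
      using s x by (auto intro!: is_isoI[of _ _ s] simp: in_hom)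
  next
    fix x assume "x \<in> Arr (D \<times>\<^sub>c D)"
    then obtain f g where x: "x = (f, g)" and [simp]: "f \<in> Arr D" "g \<in> Arr D" by auto
    have "far G (pr1 T (Cod D f) (Cod D g)) \<cdot>\<^bsub>C\<^esub> far G (prd_map D T f g) =
        far G f \<cdot>\<^bsub>C\<^esub> far G (pr1 T (Dom D f) (Dom D g))"
      "far G (pr2 T (Cod D f) (Cod D g)) \<cdot>\<^bsub>C\<^esub> far G (prd_map D T f g) =
        far G g \<cdot>\<^bsub>C\<^esub> far G (pr2 T (Dom D f) (Dom D g))"
      by (simp_all flip: G.far_cmp)
    then show "(case Cod (D \<times>\<^sub>c D) x of (a, b) \<Rightarrow> tup C S (far G (pr1 T a b)) (far G (pr2 T a b))) \<cdot>\<^bsub>C\<^esub>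
        far (G \<circ>\<^sub>f prd_fun D T) x = far (prd_fun C S \<circ>\<^sub>f (G \<times>\<^sub>f G)) x \<cdot>\<^bsub>C\<^esub>
        (case Dom (D \<times>\<^sub>c D) x of (a, b) \<Rightarrow> tup C S (far G (pr1 T a b)) (far G (pr2 T a b)))"
      by (simp add: x)
  qed (auto intro!: is_functor_fcomp[OF _ S.is_functor_prd_fun] is_functor_fcomp[OF T.is_functor_prd_fun]
      is_functor_fprod G.is_func)
qed

lemma terminal_adjoint:
  assumes adj: "adjoint C D F G" and t: "terminal D t"
  shows "terminal C (fob G t)"
proof -
  interpret F: func C D F by unfold_locales (rule adjoint_functors[OF adj])
  interpret G: func D C G by unfold_locales (rule adjoint_functors[OF adj])
  have t: "t \<in> Obj D" "\<And>a. a \<in> Obj D \<Longrightarrow> \<exists>!f. f \<in> hom D a t" using t by (auto simp: terminal_def)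
  obtain \<theta> \<kappa> where \<theta>: "prof_map C D D F idf C idf G \<theta>" and \<kappa>: "prof_map C D C idf G D F idf \<kappa>"
    and i: "\<And>j k h. j \<in> Obj C \<Longrightarrow> k \<in> Obj D \<Longrightarrow> h \<in> hom D (fob F j) k \<Longrightarrow> \<kappa> j k (\<theta> j k h) = h"
    "\<And>j k h. j \<in> Obj C \<Longrightarrow> k \<in> Obj D \<Longrightarrow> h \<in> hom C j (fob G k) \<Longrightarrow> \<theta> j k (\<kappa> j k h) = h"
    using adj[unfolded adjoint_iff_prof_iso] by (rule prof_isoE) simp
  note a = prof_mapD(5)[OF \<theta>, simplified] prof_mapD(5)[OF \<kappa>, simplified] i
  have "\<exists>!f. f \<in> hom C c (fob G t)" if c: "c \<in> Obj C" for c
  proof -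
    obtain f where f: "f \<in> hom D (fob F c) t" and u: "\<And>g. g \<in> hom D (fob F c) t \<Longrightarrow> g = f"
      using t(2)[of "fob F c"] c by auto
    show ?thesis
    proof (rule ex1I[of _ "\<theta> c t f"])
      fix g assume g: "g \<in> hom C c (fob G t)"
      with u[of "\<kappa> c t g"] a(2) c t(1) have "\<kappa> c t g = f" by simp
      with a(4)[of c t g] g c t(1) show "g = \<theta> c t f" by simp
    qed (use a c t f in simp)
  qed
  then show ?thesis using t by (simp add: terminal_def)
qed

section \<open>Full reflective subcategories and their local objects\<close>

locale reflection =
  fixes C :: "('o, 'a) cat" and M :: "('p, 'b) cat" and L I \<eta> \<epsilon>
  assumes adj: "adjunction C M L I \<eta> \<epsilon>" and ff: "fully_faithful M C I"
begin

sublocale L: func C M L using adj by unfold_locales (simp add: adjunction_def)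
sublocale I: func M C I using adj by unfold_locales (simp add: adjunction_def)

lemma unit_nat: "nat_trans C C idf (I \<circ>\<^sub>f L) \<eta>"
  using adj by (simp add: adjunction_def)

lemmas unit_simps [simp] = nat_transD(3-5)[OF unit_nat, simplified]
lemmas unit_natural = nat_transD(6)[OF unit_nat, simplified]

lemma counit_nat: "nat_trans M M (L \<circ>\<^sub>f I) idf \<epsilon>"
  using adj by (simp add: adjunction_def)

lemmas counit_simps [simp] = nat_transD(3-5)[OF counit_nat, simplified]

lemma adjoint: "adjoint C M L I"
  using adj by (auto simp: adjoint_def)

text \<open>The local objects turn out to be those isomorphic to an object in the image of \<open>I\<close>.\<close>

definition local :: "'o \<Rightarrow> bool" where
  "local a \<longleftrightarrow> a \<in> Obj C \<and> (\<forall>c \<in> Obj C. \<forall>f \<in> hom C c a. \<exists>!g. g \<in> hom C (fob I (fob L c)) a \<and> g \<cdot>\<^bsub>C\<^esub> \<eta> c = f)"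

text \<open>Existence is transposition along the adjunction. For uniqueness, fullness writes an
  extension g as I k; naturality of the counit and a triangle identity then force k to be the
  transpose of f.\<close>

lemma local_image:
  assumes m: "m \<in> Obj M" shows "local (fob I m)"
  unfolding local_def
proof (intro conjI ballI)
  fix c f assume c: "c \<in> Obj C" and f: "f \<in> hom C c (fob I m)"
  have tri: "\<epsilon> (fob L c) \<cdot>\<^bsub>M\<^esub> far L (\<eta> c) = Idn M (fob L c)"
    "far I (\<epsilon> m) \<cdot>\<^bsub>C\<^esub> \<eta> (fob I m) = Idn C (fob I m)"
    using adj c m by (simp_all add: adjunction_def)
  show "\<exists>!g. g \<in> hom C (fob I (fob L c)) (fob I m) \<and> g \<cdot>\<^bsub>C\<^esub> \<eta> c = f"
  proof (rule ex1I[of _ "far I (\<epsilon> m \<cdot>\<^bsub>M\<^esub> far L f)"])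
    have "(far I (\<epsilon> m) \<cdot>\<^bsub>C\<^esub> \<eta> (fob I m)) \<cdot>\<^bsub>C\<^esub> f = f"
      using f m by (simp add: in_hom tri del: L.C.cmp_assoc)
    then show "far I (\<epsilon> m \<cdot>\<^bsub>M\<^esub> far L f) \<in> hom C (fob I (fob L c)) (fob I m) \<and>
      far I (\<epsilon> m \<cdot>\<^bsub>M\<^esub> far L f) \<cdot>\<^bsub>C\<^esub> \<eta> c = f"
      using f m c unit_natural[of f] by (simp add: in_hom)
  next
    fix g assume g: "g \<in> hom C (fob I (fob L c)) (fob I m) \<and> g \<cdot>\<^bsub>C\<^esub> \<eta> c = f"
    obtain k where k: "k \<in> hom M (fob L c) m" "far I k = g"
      using fully_faithfulE[OF ff, of "fob L c" m g] g c m by auto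
    have "far L f = far L g \<cdot>\<^bsub>M\<^esub> far L (\<eta> c)"
      using g c by (auto simp: in_hom simp flip: L.far_cmp)
    then have "\<epsilon> m \<cdot>\<^bsub>M\<^esub> far L f = \<epsilon> m \<cdot>\<^bsub>M\<^esub> far L (far I k) \<cdot>\<^bsub>M\<^esub> far L (\<eta> c)"
      using k by simp
    also have "\<dots> = k \<cdot>\<^bsub>M\<^esub> \<epsilon> (fob L c) \<cdot>\<^bsub>M\<^esub> far L (\<eta> c)"
      using k g c m L.D.cmp_eq_assoc[OF nat_transD(6)[OF counit_nat, of k], of "far L (\<eta> c)"] by (simp add: in_hom)
    also have "\<dots> = k" using k c by (simp add: tri in_hom)
    finally show "g = far I (\<epsilon> m \<cdot>\<^bsub>M\<^esub> far L f)" using k by simp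
  qed
qed (use m in simp)

lemma local_iso:
  assumes a: "local a" and t: "is_iso C t" "Dom C t = a" shows "local (Cod C t)"
  unfolding local_def
proof (intro conjI ballI)
  obtain s where s: "s \<in> Arr C" "t \<in> Arr C" "Dom C s = Cod C t" "Cod C s = a"
    "s \<cdot>\<^bsub>C\<^esub> t = Idn C a" "t \<cdot>\<^bsub>C\<^esub> s = Idn C (Cod C t)" using t by (auto elim!: is_isoE)
  show "Cod C t \<in> Obj C" using s by simp
  fix c f assume c: "c \<in> Obj C" and f: "f \<in> hom C c (Cod C t)"
  have "s \<cdot>\<^bsub>C\<^esub> f \<in> hom C c a" using f s by (simp add: in_hom)
  then obtain g where g: "g \<in> hom C (fob I (fob L c)) a" "g \<cdot>\<^bsub>C\<^esub> \<eta> c = s \<cdot>\<^bsub>C\<^esub> f"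
    and u: "\<And>g'. g' \<in> hom C (fob I (fob L c)) a \<Longrightarrow> g' \<cdot>\<^bsub>C\<^esub> \<eta> c = s \<cdot>\<^bsub>C\<^esub> f \<Longrightarrow> g' = g"
    using a c unfolding local_def by metis
  show "\<exists>!g. g \<in> hom C (fob I (fob L c)) (Cod C t) \<and> g \<cdot>\<^bsub>C\<^esub> \<eta> c = f"
  proof (rule ex1I[of _ "t \<cdot>\<^bsub>C\<^esub> g"])
    show "t \<cdot>\<^bsub>C\<^esub> g \<in> hom C (fob I (fob L c)) (Cod C t) \<and> (t \<cdot>\<^bsub>C\<^esub> g) \<cdot>\<^bsub>C\<^esub> \<eta> c = f"
      using g s t c f L.C.cmp_eq_assoc1[OF s(6), of f] by (simp add: in_hom)
  next
    fix k assume k: "k \<in> hom C (fob I (fob L c)) (Cod C t) \<and> k \<cdot>\<^bsub>C\<^esub> \<eta> c = f"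
    have "s \<cdot>\<^bsub>C\<^esub> k = g" using u[of "s \<cdot>\<^bsub>C\<^esub> k"] k s c by (auto simp: in_hom)
    then show "k = t \<cdot>\<^bsub>C\<^esub> g"
      using k s t L.C.cmp_eq_assoc1[OF s(6), of k] by (auto simp: in_hom)
  qed
qed

text \<open>Locality is a condition on arrows into the object, so it can be checked componentwise:
  the unique extensions of the two components form the unique extension of their tuple.\<close>

lemma local_prd:
  assumes S: "cartesian C S" and a: "local a" and b: "local b"
  shows "local (prd S a b)"
  unfolding local_def
proof (intro conjI ballI)
  interpret S: cart_cat C S by unfold_locales fact
  have [simp]: "a \<in> Obj C" "b \<in> Obj C" using a b by (simp_all add: local_def)
  show "prd S a b \<in> Obj C" by simp
  fix c f assume c: "c \<in> Obj C" and f: "f \<in> hom C c (prd S a b)"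
  have 1: "pr1 S a b \<cdot>\<^bsub>C\<^esub> f \<in> hom C c a" and 2: "pr2 S a b \<cdot>\<^bsub>C\<^esub> f \<in> hom C c b"
    using f by (simp_all add: in_hom)
  obtain g where g: "g \<in> hom C (fob I (fob L c)) a" "g \<cdot>\<^bsub>C\<^esub> \<eta> c = pr1 S a b \<cdot>\<^bsub>C\<^esub> f"
    and ug: "\<And>g'. g' \<in> hom C (fob I (fob L c)) a \<Longrightarrow> g' \<cdot>\<^bsub>C\<^esub> \<eta> c = pr1 S a b \<cdot>\<^bsub>C\<^esub> f \<Longrightarrow> g' = g"
    using a c 1 unfolding local_def by metis
  obtain h where h: "h \<in> hom C (fob I (fob L c)) b" "h \<cdot>\<^bsub>C\<^esub> \<eta> c = pr2 S a b \<cdot>\<^bsub>C\<^esub> f"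
    and uh: "\<And>h'. h' \<in> hom C (fob I (fob L c)) b \<Longrightarrow> h' \<cdot>\<^bsub>C\<^esub> \<eta> c = pr2 S a b \<cdot>\<^bsub>C\<^esub> f \<Longrightarrow> h' = h"
    using b c 2 unfolding local_def by metis
  show "\<exists>!g. g \<in> hom C (fob I (fob L c)) (prd S a b) \<and> g \<cdot>\<^bsub>C\<^esub> \<eta> c = f"
  proof (rule ex1I[of _ "tup C S g h"])
    show "tup C S g h \<in> hom C (fob I (fob L c)) (prd S a b) \<and> tup C S g h \<cdot>\<^bsub>C\<^esub> \<eta> c = f"
      using g h c f by (simp add: in_hom S.tup_eta)
  next
    fix k assume k: "k \<in> hom C (fob I (fob L c)) (prd S a b) \<and> k \<cdot>\<^bsub>C\<^esub> \<eta> c = f"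
    have "pr1 S a b \<cdot>\<^bsub>C\<^esub> k = g" using ug[of "pr1 S a b \<cdot>\<^bsub>C\<^esub> k"] k c by (auto simp: in_hom)
    moreover have "pr2 S a b \<cdot>\<^bsub>C\<^esub> k = h" using uh[of "pr2 S a b \<cdot>\<^bsub>C\<^esub> k"] k c by (auto simp: in_hom)
    ultimately show "k = tup C S g h"
      using S.tup_eta[of k a b] k by (simp add: in_hom)
  qed
qed

lemma local_terminal:
  assumes S: "cartesian C S" shows "local (tm S)"
  unfolding local_def
proof (intro conjI ballI)
  interpret S: cart_cat C S by unfold_locales fact
  fix c f assume c: "c \<in> Obj C" and f: "f \<in> hom C c (tm S)"
  then show "\<exists>!g. g \<in> hom C (fob I (fob L c)) (tm S) \<and> g \<cdot>\<^bsub>C\<^esub> \<eta> c = f"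
    by (intro ex1I[of _ "bang C (tm S) (fob I (fob L c))"])
      (auto simp: in_hom intro: S.tm_eqI)
next
  interpret S: cart_cat C S by unfold_locales fact
  show "tm S \<in> Obj C" by simp
qed

text \<open>Extending the identity of a along the unit gives a retraction r. Then \<eta> a \<cdot> r
  and the identity of I (L a) both extend \<eta> a along itself, so they coincide because I (L a) is
  local.\<close>

lemma is_iso_unit:
  assumes a: "local a" shows "is_iso C (\<eta> a)"
proof -
  have [simp]: "a \<in> Obj C" using a by (simp add: local_def)
  have "\<exists>r. r \<in> hom C (fob I (fob L a)) a \<and> r \<cdot>\<^bsub>C\<^esub> \<eta> a = Idn C a"
    using a L.C.id_hom[of a] unfolding local_def by blast
  then obtain r where r: "r \<in> hom C (fob I (fob L a)) a" "r \<cdot>\<^bsub>C\<^esub> \<eta> a = Idn C a" by blast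
  have u: "\<exists>!g. g \<in> hom C (fob I (fob L a)) (fob I (fob L a)) \<and> g \<cdot>\<^bsub>C\<^esub> \<eta> a = \<eta> a"
    using local_image[of "fob L a"] unfolding local_def by (simp add: in_hom)
  have "\<eta> a \<cdot>\<^bsub>C\<^esub> r = Idn C (fob I (fob L a))"
    by (rule ex1_eqI[OF u]) (use r in \<open>simp_all add: in_hom\<close>)
  then show ?thesis using r by (intro is_isoI[of _ _ r]) (simp_all add: in_hom)
qed

text \<open>The values of \<open>K\<close> are isomorphic to products of objects in the image of
  \<open>I\<close>, hence local, so that the units at these values are invertible. Arrows out of
  \<open>K\<close> thereby become accessible to the full faithfulness of \<open>I\<close>.\<close>

lemma nat_isomorphic_reflect:
  assumes S: "cartesian C S" and F: "is_functor A M F" and G: "is_functor B M G"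
    and K: "nat_isomorphic (A \<times>\<^sub>c B) C (prd_fun C S \<circ>\<^sub>f ((I \<circ>\<^sub>f F) \<times>\<^sub>f (I \<circ>\<^sub>f G))) K"
  shows "nat_isomorphic (A \<times>\<^sub>c B) C K (I \<circ>\<^sub>f L \<circ>\<^sub>f K)"
proof -
  interpret S: cart_cat C S by unfold_locales fact
  interpret F: func A M F by unfold_locales fact
  interpret G: func B M G by unfold_locales fact
  interpret K: func "A \<times>\<^sub>c B" C K using nat_isomorphicD[OF K] by unfold_locales
  obtain \<tau> where \<tau>: "nat_trans (A \<times>\<^sub>c B) C (prd_fun C S \<circ>\<^sub>f ((I \<circ>\<^sub>f F) \<times>\<^sub>f (I \<circ>\<^sub>f G))) K \<tau>"
    and i: "\<And>x. x \<in> Obj (A \<times>\<^sub>c B) \<Longrightarrow> is_iso C (\<tau> x)"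
    using K by (rule nat_isomorphicE) blast
  have l: "local (fob K x)" if x: "x \<in> Obj (A \<times>\<^sub>c B)" for x
  proof -
    obtain a b where ab: "x = (a, b)" "a \<in> Obj A" "b \<in> Obj B" using x by auto
    have "local (prd S (fob I (fob F a)) (fob I (fob G b)))"
      using ab by (intro local_prd[OF S] local_image) simp_all
    from local_iso[OF this i[OF x]] show ?thesis
      using nat_transD(4,5)[OF \<tau> x] ab by simp
  qed
  show ?thesis
  proof (rule nat_isomorphicI[of _ _ _ _ "\<lambda>x. \<eta> (fob K x)"])
    fix x assume x: "x \<in> Obj (A \<times>\<^sub>c B)"
    show "is_iso C (\<eta> (fob K x))" by (rule is_iso_unit[OF l[OF x]])
  next
    fix f assume f: "f \<in> Arr (A \<times>\<^sub>c B)"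
    show "\<eta> (fob K (Cod (A \<times>\<^sub>c B) f)) \<cdot>\<^bsub>C\<^esub> far K f = far (I \<circ>\<^sub>f L \<circ>\<^sub>f K) f \<cdot>\<^bsub>C\<^esub> \<eta> (fob K (Dom (A \<times>\<^sub>c B) f))"
      using unit_natural[of "far K f"] f by simp
  qed (auto intro!: K.is_func is_functor_fcomp[OF is_functor_fcomp[OF K.is_func L.is_func] I.is_func])
qed

text \<open>The product of a and b is the reflection of I a \<times> I b, which is already local;
  likewise for the terminal object. Its purpose is the cartesian structure on the category of
  hom-objects, which the definition of enrichment requires.\<close>

lemma ex_cartesian:
  assumes S: "cartesian C S" shows "\<exists>T :: ('p, 'b) cart. cartesian M T"
proof -
  interpret S: cart_cat C S by unfold_locales fact
  let ?P = "\<lambda>a b. prd S (fob I a) (fob I b)"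
  let ?p = "\<lambda>a b. fob L (?P a b)"
  \<comment> \<open>\<open>s\<close> inverts the unit at the local object I a \<times> I b. The
    projections in \<open>M\<close> are the preimages under \<open>I\<close> of the projections in
    \<open>C\<close> preceded by \<open>s\<close>.\<close>
  have "\<exists>s. s \<in> hom C (fob I (?p a b)) (?P a b) \<and> s \<cdot>\<^bsub>C\<^esub> \<eta> (?P a b) = Idn C (?P a b) \<and>
      \<eta> (?P a b) \<cdot>\<^bsub>C\<^esub> s = Idn C (fob I (?p a b))" if "a \<in> Obj M" "b \<in> Obj M" for a b
    by (rule is_isoE[OF is_iso_unit[OF local_prd[OF S local_image local_image], OF that]])
      (use that in \<open>auto simp: in_hom\<close>)
  then obtain s where s: "\<And>a b. a \<in> Obj M \<Longrightarrow> b \<in> Obj M \<Longrightarrow>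
      s a b \<in> hom C (fob I (?p a b)) (?P a b) \<and> s a b \<cdot>\<^bsub>C\<^esub> \<eta> (?P a b) = Idn C (?P a b) \<and>
      \<eta> (?P a b) \<cdot>\<^bsub>C\<^esub> s a b = Idn C (fob I (?p a b))" by metis
  have "\<exists>q. q \<in> hom M (?p a b) a \<and> far I q = pr1 S (fob I a) (fob I b) \<cdot>\<^bsub>C\<^esub> s a b"
    if "a \<in> Obj M" "b \<in> Obj M" for a b
    by (rule fully_faithfulE[OF ff, of "?p a b" a "pr1 S (fob I a) (fob I b) \<cdot>\<^bsub>C\<^esub> s a b"])
      (use s[OF that] that in \<open>auto simp: in_hom\<close>)
  then obtain q1 where q1: "\<And>a b. a \<in> Obj M \<Longrightarrow> b \<in> Obj M \<Longrightarrow>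
    q1 a b \<in> hom M (?p a b) a \<and> far I (q1 a b) = pr1 S (fob I a) (fob I b) \<cdot>\<^bsub>C\<^esub> s a b" by metis
  have "\<exists>q. q \<in> hom M (?p a b) b \<and> far I q = pr2 S (fob I a) (fob I b) \<cdot>\<^bsub>C\<^esub> s a b"
    if "a \<in> Obj M" "b \<in> Obj M" for a b
    by (rule fully_faithfulE[OF ff, of "?p a b" b "pr2 S (fob I a) (fob I b) \<cdot>\<^bsub>C\<^esub> s a b"])
      (use s[OF that] that in \<open>auto simp: in_hom\<close>)
  then obtain q2 where q2: "\<And>a b. a \<in> Obj M \<Longrightarrow> b \<in> Obj M \<Longrightarrow>
    q2 a b \<in> hom M (?p a b) b \<and> far I (q2 a b) = pr2 S (fob I a) (fob I b) \<cdot>\<^bsub>C\<^esub> s a b" by metis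
  let ?T = "\<lparr>tm = fob L (tm S), prd = ?p, pr1 = q1, pr2 = q2\<rparr>"
  have tmM: "terminal M (fob L (tm S))"
    unfolding terminal_def
  proof (intro conjI ballI)
    fix a assume a: "a \<in> Obj M"
    obtain r where r: "r \<in> Arr C" "Dom C r = fob I (fob L (tm S))" "Cod C r = tm S"
      "\<eta> (tm S) \<cdot>\<^bsub>C\<^esub> r = Idn C (fob I (fob L (tm S)))"
      using is_iso_unit[OF local_terminal[OF S]] by (auto elim!: is_isoE)
    let ?g = "\<eta> (tm S) \<cdot>\<^bsub>C\<^esub> bang C (tm S) (fob I a)"
    obtain f where f: "f \<in> hom M a (fob L (tm S))" "far I f = ?g"
      by (rule fully_faithfulE[OF ff, of a "fob L (tm S)" ?g]) (use a in \<open>auto simp: in_hom\<close>)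
    show "\<exists>!f. f \<in> hom M a (fob L (tm S))"
    proof (rule ex1I[of _ f])
      fix f' assume f': "f' \<in> hom M a (fob L (tm S))"
      \<comment> \<open>Arrows into I (L 1) can be compared after composing with \<open>r\<close>,
        where they end in the terminal object of \<open>C\<close>; the unit undoes
        \<open>r\<close>.\<close>
      have e: "\<eta> (tm S) \<cdot>\<^bsub>C\<^esub> r \<cdot>\<^bsub>C\<^esub> far I h = far I h" if "h \<in> hom M a (fob L (tm S))" for h
        using that r L.C.cmp_eq_assoc1[OF r(4), of "far I h"] by (simp add: in_hom)
      have "r \<cdot>\<^bsub>C\<^esub> far I f' = r \<cdot>\<^bsub>C\<^esub> far I f"
        by (rule S.tm_eqI) (use f(1) f' r a in \<open>simp_all add: in_hom\<close>)
      then have "\<eta> (tm S) \<cdot>\<^bsub>C\<^esub> r \<cdot>\<^bsub>C\<^esub> far I f' = \<eta> (tm S) \<cdot>\<^bsub>C\<^esub> r \<cdot>\<^bsub>C\<^esub> far I f"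
        by (simp only:)
      then have "far I f' = far I f" by (simp only: e[OF f(1)] e[OF f'])
      then show "f' = f" using f f' by (intro fully_faithful_eqI[OF ff]) (simp_all add: in_hom)
    qed fact
  qed simp
  have "\<exists>!h. h \<in> hom M c (?p a b) \<and> q1 a b \<cdot>\<^bsub>M\<^esub> h = f \<and> q2 a b \<cdot>\<^bsub>M\<^esub> h = g"
    if ab [simp]: "a \<in> Obj M" "b \<in> Obj M" and c [simp]: "c \<in> Obj M" and f: "f \<in> hom M c a" and g: "g \<in> hom M c b"
    for a b c f g
  proof -
    let ?k = "\<eta> (?P a b) \<cdot>\<^bsub>C\<^esub> tup C S (far I f) (far I g)"
    note sab = s[OF ab, unfolded in_hom] and q1ab = q1[OF ab, unfolded in_hom] and q2ab = q2[OF ab, unfolded in_hom]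
    have fg: "f \<in> Arr M" "Dom M f = c" "Cod M f = a" "g \<in> Arr M" "Dom M g = c" "Cod M g = b"
      using f g by (simp_all add: in_hom)
    obtain h where h: "h \<in> hom M c (?p a b)" "far I h = ?k"
      by (rule fully_faithfulE[OF ff, of c "?p a b" ?k]) (use fg in \<open>auto simp: in_hom\<close>)
    have sk: "s a b \<cdot>\<^bsub>C\<^esub> ?k = tup C S (far I f) (far I g)"
      using L.C.cmp_eq_assoc1[of "s a b" "\<eta> (?P a b)" _ "tup C S (far I f) (far I g)"] sab fg by simp
    show ?thesis
    proof (rule ex1I[of _ h], intro conjI)
      show "h \<in> hom M c (?p a b)" by fact
      have "far I (q1 a b \<cdot>\<^bsub>M\<^esub> h) = far I f"
        using h(1) q1ab sab fg sk by (simp add: in_hom h(2))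
      then show "q1 a b \<cdot>\<^bsub>M\<^esub> h = f"
        using h q1ab fg by (intro fully_faithful_eqI[OF ff]) (simp_all add: in_hom)
      have "far I (q2 a b \<cdot>\<^bsub>M\<^esub> h) = far I g"
        using h(1) q2ab sab fg sk by (simp add: in_hom h(2))
      then show "q2 a b \<cdot>\<^bsub>M\<^esub> h = g"
        using h q2ab fg by (intro fully_faithful_eqI[OF ff]) (simp_all add: in_hom)
    next
      fix h' assume h': "h' \<in> hom M c (?p a b) \<and> q1 a b \<cdot>\<^bsub>M\<^esub> h' = f \<and> q2 a b \<cdot>\<^bsub>M\<^esub> h' = g"
      have 1: "pr1 S (fob I a) (fob I b) \<cdot>\<^bsub>C\<^esub> s a b \<cdot>\<^bsub>C\<^esub> far I h' = far I f"
        using I.far_cmp[of h' "q1 a b"] h' q1ab sab by (simp add: in_hom)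
      have 2: "pr2 S (fob I a) (fob I b) \<cdot>\<^bsub>C\<^esub> s a b \<cdot>\<^bsub>C\<^esub> far I h' = far I g"
        using I.far_cmp[of h' "q2 a b"] h' q2ab sab by (simp add: in_hom)
      have "s a b \<cdot>\<^bsub>C\<^esub> far I h' = tup C S (far I f) (far I g)"
        by (rule S.prd_eqI[of _ _ "fob I a" "fob I b"])
          (use h' sab fg 1 2 in \<open>simp_all add: in_hom\<close>)
      then have "far I h' = ?k"
        using L.C.cmp_eq_assoc1[of "\<eta> (?P a b)" "s a b" _ "far I h'"] sab h' by (simp add: in_hom)
      then show "h' = h"
        using h h' by (intro fully_faithful_eqI[OF ff]) (simp_all add: in_hom)
    qed
  qed
  then have "cartesian M ?T"
    unfolding cartesian_def using tmM q1 q2 L.D.category_axioms by simp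
  then show ?thesis by blast
qed

end

text \<open>The law (B2) only says that the canonical arrow is invertible at each pair of objects.
  The arrow is natural, in the second variable because the counit is, so the law yields an
  isomorphism of functors.\<close>

lemma frobenius_nat_isomorphic:
  assumes adj: "adjunction C D F G \<eta> \<epsilon>" and S: "cartesian C S" and T: "cartesian D T"
    and iso: "\<And>p q. p \<in> Obj C \<Longrightarrow> q \<in> Obj D \<Longrightarrow>
      is_iso D (tup D T (far F (pr1 S p (fob G q))) (\<epsilon> q \<cdot>\<^bsub>D\<^esub> far F (pr2 S p (fob G q))))"
  shows "nat_isomorphic (C \<times>\<^sub>c D) D (F \<circ>\<^sub>f prd_fun C S \<circ>\<^sub>f (idf \<times>\<^sub>f G)) (prd_fun D T \<circ>\<^sub>f (F \<times>\<^sub>f idf))"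
proof -
  interpret F: func C D F using adj by unfold_locales (simp add: adjunction_def)
  interpret G: func D C G using adj by unfold_locales (simp add: adjunction_def)
  interpret S: cart_cat C S by unfold_locales fact
  interpret T: cart_cat D T by unfold_locales fact
  have \<epsilon>: "nat_trans D D (F \<circ>\<^sub>f G) idf \<epsilon>" using adj by (simp add: adjunction_def)
  note [simp] = nat_transD(3-5)[OF \<epsilon>, simplified]
  let ?t = "\<lambda>(p, q). tup D T (far F (pr1 S p (fob G q))) (\<epsilon> q \<cdot>\<^bsub>D\<^esub> far F (pr2 S p (fob G q)))"
  show ?thesis
  proof (rule nat_isomorphicI[of _ _ _ _ ?t])
    fix x assume "x \<in> Arr (C \<times>\<^sub>c D)"
    then obtain u v where x: "x = (u, v)" and [simp]: "u \<in> Arr C" "v \<in> Arr D" by auto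
    let ?m = "prd_map C S u (far G v)"
    have "far F (pr1 S (Cod C u) (fob G (Cod D v))) \<cdot>\<^bsub>D\<^esub> far F ?m =
        far F u \<cdot>\<^bsub>D\<^esub> far F (pr1 S (Dom C u) (fob G (Dom D v)))"
      by (simp flip: F.far_cmp)
    moreover have "\<epsilon> (Cod D v) \<cdot>\<^bsub>D\<^esub> far F (pr2 S (Cod C u) (fob G (Cod D v))) \<cdot>\<^bsub>D\<^esub> far F ?m =
        v \<cdot>\<^bsub>D\<^esub> \<epsilon> (Dom D v) \<cdot>\<^bsub>D\<^esub> far F (pr2 S (Dom C u) (fob G (Dom D v)))"
    proof -
      have "far F (pr2 S (Cod C u) (fob G (Cod D v))) \<cdot>\<^bsub>D\<^esub> far F ?m =
          far F (far G v) \<cdot>\<^bsub>D\<^esub> far F (pr2 S (Dom C u) (fob G (Dom D v)))"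
        by (simp flip: F.far_cmp)
      then show ?thesis
        using F.D.cmp_eq_assoc[OF nat_transD(6)[OF \<epsilon>, of v], of "far F (pr2 S (Dom C u) (fob G (Dom D v)))"]
        by simp
    qed
    ultimately show "?t (Cod (C \<times>\<^sub>c D) x) \<cdot>\<^bsub>D\<^esub> far (F \<circ>\<^sub>f prd_fun C S \<circ>\<^sub>f (idf \<times>\<^sub>f G)) x =
        far (prd_fun D T \<circ>\<^sub>f (F \<times>\<^sub>f idf)) x \<cdot>\<^bsub>D\<^esub> ?t (Dom (C \<times>\<^sub>c D) x)"
      by (simp add: x)
  qed (auto simp: iso intro!: is_functor_fcomp[OF _ T.is_functor_prd_fun] is_functor_fprod F.is_func G.is_func
      is_functor_idf is_functor_fcomp[OF is_functor_fcomp[OF _ S.is_functor_prd_fun] F.is_func]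
      F.C.category_axioms F.D.category_axioms)
qed

section \<open>Exponentials as represented hom-objects\<close>

locale ccc =
  fixes C :: "('o, 'a) cat" and S :: "('o, 'a) ccart"
  assumes is_ccc: "cartesian_closed C S"
begin

sublocale cart_cat C S using is_ccc by unfold_locales (simp add: cartesian_closed_def)

lemma ev_simps [simp]:
  assumes "a \<in> Obj C" "b \<in> Obj C"
  shows "expo S a b \<in> Obj C" "ev S a b \<in> Arr C" "Dom C (ev S a b) = prd S (expo S a b) a" "Cod C (ev S a b) = b"
proof -
  have "expo S a b \<in> Obj C \<and> ev S a b \<in> hom C (prd S (expo S a b) a) b"
    using is_ccc assms by (simp add: cartesian_closed_def)
  then show "expo S a b \<in> Obj C" "ev S a b \<in> Arr C" "Dom C (ev S a b) = prd S (expo S a b) a" "Cod C (ev S a b) = b"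
    by (simp_all add: in_hom)
qed

lemma curry_ex1:
  assumes "a \<in> Obj C" "c \<in> Obj C" "f \<in> Arr C" "Dom C f = prd S c a"
  shows "\<exists>!h. h \<in> hom C c (expo S a (Cod C f)) \<and> ev S a (Cod C f) \<cdot>\<^bsub>C\<^esub> prd_map C S h (Idn C a) = f"
proof -
  have "f \<in> hom C (prd S c a) (Cod C f)" "Cod C f \<in> Obj C" using assms by (simp_all add: in_hom)
  then show ?thesis using is_ccc assms(1,2) unfolding cartesian_closed_def by blast
qed

lemma curry_hom:
  assumes "a \<in> Obj C" "c \<in> Obj C" "f \<in> Arr C" "Dom C f = prd S c a"
  shows "curry_arr C S c a f \<in> hom C c (expo S a (Cod C f)) \<and>
    ev S a (Cod C f) \<cdot>\<^bsub>C\<^esub> prd_map C S (curry_arr C S c a f) (Idn C a) = f"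
  unfolding curry_arr_def by (rule theI'[OF curry_ex1[OF assms]])

lemma curry_simps [simp]:
  assumes "a \<in> Obj C" "c \<in> Obj C" "f \<in> Arr C" "Dom C f = prd S c a"
  shows "curry_arr C S c a f \<in> Arr C" "Dom C (curry_arr C S c a f) = c"
    "Cod C (curry_arr C S c a f) = expo S a (Cod C f)"
    "Cod C f = b \<Longrightarrow> ev S a b \<cdot>\<^bsub>C\<^esub> prd_map C S (curry_arr C S c a f) (Idn C a) = f"
  using curry_hom[OF assms] by (auto simp: in_hom)

lemma expo_eqI:
  assumes "h \<in> Arr C" "h' \<in> Arr C" "Dom C h = Dom C h'" "Cod C h = expo S a b" "Cod C h' = expo S a b"
    "a \<in> Obj C" "b \<in> Obj C"
    "ev S a b \<cdot>\<^bsub>C\<^esub> prd_map C S h (Idn C a) = ev S a b \<cdot>\<^bsub>C\<^esub> prd_map C S h' (Idn C a)"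
  shows "h = h'"
proof -
  have "\<exists>!k. k \<in> hom C (Dom C h) (expo S a b) \<and>
      ev S a b \<cdot>\<^bsub>C\<^esub> prd_map C S k (Idn C a) = ev S a b \<cdot>\<^bsub>C\<^esub> prd_map C S h (Idn C a)"
    using curry_ex1[of a "Dom C h" "ev S a b \<cdot>\<^bsub>C\<^esub> prd_map C S h (Idn C a)"] assms(1-7) by simp
  then show ?thesis using assms by (elim ex1E) (auto simp: in_hom)
qed

lemma exp_fun_fob [simp]: "fob (exp_fun C S) (a, b) = expo S a b"
  by (simp add: exp_fun_def)

lemma exp_fun_far [simp]:
  assumes "p \<in> Arr C" "q \<in> Arr C"
  shows "far (exp_fun C S) (p, q) \<in> Arr C" "Dom C (far (exp_fun C S) (p, q)) = expo S (Cod C p) (Dom C q)"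
    "Cod C (far (exp_fun C S) (p, q)) = expo S (Dom C p) (Cod C q)"
  using assms by (simp_all add: exp_fun_def Let_def)

lemma ev_exp_fun:
  assumes "p \<in> Arr C" "q \<in> Arr C"
  shows "ev S (Dom C p) (Cod C q) \<cdot>\<^bsub>C\<^esub> prd_map C S (far (exp_fun C S) (p, q)) (Idn C (Dom C p)) =
    q \<cdot>\<^bsub>C\<^esub> ev S (Cod C p) (Dom C q) \<cdot>\<^bsub>C\<^esub> prd_map C S (Idn C (expo S (Cod C p) (Dom C q))) p"
  using assms by (simp add: exp_fun_def Let_def)

lemma ev_exp_fun_cmp:
  assumes "p \<in> Arr C" "q \<in> Arr C" "x \<in> Arr C" "y \<in> Arr C" "Cod C x = expo S (Cod C p) (Dom C q)"
    "Cod C y = Dom C p"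
  shows "ev S (Dom C p) (Cod C q) \<cdot>\<^bsub>C\<^esub> prd_map C S (far (exp_fun C S) (p, q) \<cdot>\<^bsub>C\<^esub> x) y =
    q \<cdot>\<^bsub>C\<^esub> ev S (Cod C p) (Dom C q) \<cdot>\<^bsub>C\<^esub> prd_map C S x (p \<cdot>\<^bsub>C\<^esub> y)"
  using cmp_eq_assoc[OF ev_exp_fun[OF assms(1,2)], of "prd_map C S x y"] assms by simp

lemma is_functor_exp_fun: "is_functor (op_cat C \<times>\<^sub>c C) C (exp_fun C S)"
proof (rule is_functorI)
  fix x assume "x \<in> Obj (op_cat C \<times>\<^sub>c C)"
  then obtain a b where x: "x = (a, b)" "a \<in> Obj C" "b \<in> Obj C" by auto
  show "far (exp_fun C S) (Idn (op_cat C \<times>\<^sub>c C) x) = Idn C (fob (exp_fun C S) x)"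
    by (simp only: x(1) prod_cat_simps op_cat_simps exp_fun_fob, rule expo_eqI[of _ _ a b])
      (use x ev_exp_fun[of "Idn C a" "Idn C b"] in simp_all)
next
  fix x y assume *: "x \<in> Arr (op_cat C \<times>\<^sub>c C)" "y \<in> Arr (op_cat C \<times>\<^sub>c C)"
    "Cod (op_cat C \<times>\<^sub>c C) x = Dom (op_cat C \<times>\<^sub>c C) y"
  obtain p q where x: "x = (p, q)" "p \<in> Arr C" "q \<in> Arr C" using * by auto
  obtain p' q' where y: "y = (p', q')" "p' \<in> Arr C" "q' \<in> Arr C" using * by auto
  have [simp]: "Dom C p = Cod C p'" "Cod C q = Dom C q'" using * x y by auto
  have "far (exp_fun C S) (p \<cdot>\<^bsub>C\<^esub> p', q' \<cdot>\<^bsub>C\<^esub> q) = far (exp_fun C S) (p', q') \<cdot>\<^bsub>C\<^esub> far (exp_fun C S) (p, q)"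
  proof (rule expo_eqI[of _ _ "Dom C p'" "Cod C q'"])
    have "ev S (Cod C p') (Dom C q') \<cdot>\<^bsub>C\<^esub> prd_map C S (far (exp_fun C S) (p, q)) p' =
      q \<cdot>\<^bsub>C\<^esub> ev S (Cod C p) (Dom C q) \<cdot>\<^bsub>C\<^esub> prd_map C S (Idn C (expo S (Cod C p) (Dom C q))) (p \<cdot>\<^bsub>C\<^esub> p')"
      using ev_exp_fun_cmp[of p q "Idn C (expo S (Cod C p) (Dom C q))" p'] x y by simp
    then show "ev S (Dom C p') (Cod C q') \<cdot>\<^bsub>C\<^esub> prd_map C S (far (exp_fun C S) (p \<cdot>\<^bsub>C\<^esub> p', q' \<cdot>\<^bsub>C\<^esub> q)) (Idn C (Dom C p')) =
      ev S (Dom C p') (Cod C q') \<cdot>\<^bsub>C\<^esub> prd_map C S (far (exp_fun C S) (p', q') \<cdot>\<^bsub>C\<^esub> far (exp_fun C S) (p, q)) (Idn C (Dom C p'))"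
      using x y ev_exp_fun[of "p \<cdot>\<^bsub>C\<^esub> p'" "q' \<cdot>\<^bsub>C\<^esub> q"]
        ev_exp_fun_cmp[of p' q' "far (exp_fun C S) (p, q)" "Idn C (Dom C p')"]
      by simp
  qed (use x y in simp_all)
  then show "far (exp_fun C S) (y \<cdot>\<^bsub>op_cat C \<times>\<^sub>c C\<^esub> x) = far (exp_fun C S) y \<cdot>\<^bsub>C\<^esub> far (exp_fun C S) x"
    using x y by simp
qed (auto intro: category_prod_cat category_op_cat category_axioms)

text \<open>This is the universal property of the exponential, put in the form from which
  \<open>hom_rep_adjoint\<close> derives the representation of \<open>homs\<close>.\<close>

lemma hom_rep_exp_fun: "hom_rep C C C (exp_fun C S) C (prd_fun C S) idf"
proof -
  have "rep_map C C C (exp_fun C S) C (prd_fun C S) idf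
    (\<lambda>v a b h. ev S a b \<cdot>\<^bsub>C\<^esub> prd_map C S h (Idn C a)) (\<lambda>v a b. curry_arr C S v a)"
    unfolding rep_map_def
  proof (intro conjI ballI)
    fix u p q h assume u: "u \<in> Arr C" and p: "p \<in> Arr C" and q: "q \<in> Arr C"
      and h: "h \<in> hom C (Cod C u) (fob (exp_fun C S) (Cod C p, Dom C q))"
    show "ev S (Dom C p) (Cod C q) \<cdot>\<^bsub>C\<^esub> prd_map C S (far (exp_fun C S) (p, q) \<cdot>\<^bsub>C\<^esub> h \<cdot>\<^bsub>C\<^esub> u) (Idn C (Dom C p)) =
        far idf q \<cdot>\<^bsub>C\<^esub> (ev S (Cod C p) (Dom C q) \<cdot>\<^bsub>C\<^esub> prd_map C S h (Idn C (Cod C p))) \<cdot>\<^bsub>C\<^esub> far (prd_fun C S) (u, p)"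
      using ev_exp_fun_cmp[of p q "h \<cdot>\<^bsub>C\<^esub> u" "Idn C (Dom C p)"] u p q h by (simp add: in_hom)
  next
    fix v a b h assume v: "v \<in> Obj C" and a: "a \<in> Obj C" and b: "b \<in> Obj C"
      and h: "h \<in> hom C v (fob (exp_fun C S) (a, b))"
    show "curry_arr C S v a (ev S a b \<cdot>\<^bsub>C\<^esub> prd_map C S h (Idn C a)) = h"
      by (rule expo_eqI[of _ _ a b]) (use v a b h in \<open>simp_all add: in_hom\<close>)
  qed (auto simp: in_hom is_functor_exp_fun is_functor_prd_fun is_functor_idf category_axioms)
  then show ?thesis by (auto simp: hom_rep_def)
qed

end

section \<open>Enrichment from a representation\<close>

text \<open>Composition in the enriched category is composition in the coKleisli categories of the
  comonads \<open>U v \<times> _\<close>: arrows \<open>v \<rightarrow> H (b, c)\<close> and \<open>v \<rightarrow> H (a, b)\<close> correspond to arrows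
  \<open>U v \<times> b \<rightarrow> c\<close> and \<open>U v \<times> a \<rightarrow> b\<close>.\<close>

locale rep_enrichment =
  V: cart_cat V S + C: cart_cat C T + U: func V C U
  for V :: "('v, 'w) cat" and S :: "('v, 'w) cart" and C :: "('o, 'a) cat"
    and T :: "('o, 'a, 'z) cart_scheme" and U :: "('v, 'w, 'o, 'a) fctr" +
  fixes H :: "('o \<times> 'o, 'a \<times> 'a, 'v, 'w) fctr" and \<phi> \<psi>
  assumes rep: "rep_map V C C H C (prd_fun C T \<circ>\<^sub>f (U \<times>\<^sub>f idf)) idf \<phi> \<psi>"
    and terminal_U: "terminal C (fob U (tm S))"
begin

sublocale H: func "op_cat C \<times>\<^sub>c C" V H by unfold_locales (rule rep_mapD(1)[OF rep])

abbreviation "hm a b \<equiv> fob H (a, b)"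

lemma \<phi>_simps [simp]:
  assumes "h \<in> Arr V" "Dom V h = v" "Cod V h = hm a b" "a \<in> Obj C" "b \<in> Obj C"
  shows "\<phi> v a b h \<in> Arr C" "Dom C (\<phi> v a b h) = prd T (fob U v) a" "Cod C (\<phi> v a b h) = b"
    "\<psi> v a b (\<phi> v a b h) = h"
  using rep_mapD(5,6)[OF rep, of v a b h] assms by (auto simp: in_hom)

lemma \<psi>_simps [simp]:
  assumes "g \<in> Arr C" "Dom C g = prd T (fob U v) a" "Cod C g = b" "v \<in> Obj V" "a \<in> Obj C"
  shows "\<psi> v a b g \<in> Arr V" "Dom V (\<psi> v a b g) = v" "Cod V (\<psi> v a b g) = hm a b"
    "\<phi> v a b (\<psi> v a b g) = g"
  using rep_mapD(7,8)[OF rep, of v a b g] assms by (auto simp: in_hom)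

lemma \<phi>_eqI:
  assumes "\<phi> v a b h = \<phi> v a b h'" "h \<in> Arr V" "Dom V h = v" "Cod V h = hm a b"
    "h' \<in> Arr V" "Dom V h' = v" "Cod V h' = hm a b" "a \<in> Obj C" "b \<in> Obj C"
  shows "h = h'"
  using assms \<phi>_simps(4) by metis

lemma \<phi>_cmp:
  assumes "h \<in> Arr V" "u \<in> Arr V" "Cod V u = Dom V h" "Cod V h = hm a b" "a \<in> Obj C" "b \<in> Obj C"
  shows "\<phi> (Dom V u) a b (h \<cdot>\<^bsub>V\<^esub> u) = \<phi> (Cod V u) a b h \<cdot>\<^bsub>C\<^esub> prd_map C T (far U u) (Idn C a)"
proof -
  have "far H (Idn C a, Idn C b) = Idn V (hm a b)"
    using H.far_id[of "(a, b)"] assms by simp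
  then show ?thesis
    using rep_mapD(9)[OF rep, of u "Idn C a" "Idn C b" h] assms by (simp add: in_hom)
qed

lemma \<phi>_far:
  assumes "p \<in> Arr C" "q \<in> Arr C" "h \<in> Arr V" "Dom V h = v" "Cod V h = hm (Cod C p) (Dom C q)"
  shows "\<phi> v (Dom C p) (Cod C q) (far H (p, q) \<cdot>\<^bsub>V\<^esub> h) =
    q \<cdot>\<^bsub>C\<^esub> \<phi> v (Cod C p) (Dom C q) h \<cdot>\<^bsub>C\<^esub> prd_map C T (Idn C (fob U v)) p"
  using rep_mapD(9)[OF rep, of "Idn V v" p q h] assms by (auto simp: in_hom)

text \<open>Composition of generalized elements at the stage \<open>v\<close>: x and y stand for
  arrows U v \<times> b \<rightarrow> c and U v \<times> a \<rightarrow> b, and the tuple passes the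
  parameter in U v on to x.\<close>

definition star :: "'v \<Rightarrow> 'o \<Rightarrow> 'o \<Rightarrow> 'o \<Rightarrow> 'w \<Rightarrow> 'w \<Rightarrow> 'w" where
  "star v a b c x y = \<psi> v a c (\<phi> v b c x \<cdot>\<^bsub>C\<^esub> tup C T (pr1 T (fob U v) a) (\<phi> v a b y))"

text \<open>The composite of the generic composable pair: the two projections, taken at the stage
  H(b, c) \<times> H(a, b).\<close>

definition m :: "'o \<Rightarrow> 'o \<Rightarrow> 'o \<Rightarrow> 'w" where
  "m a b c = star (prd S (hm b c) (hm a b)) a b c (pr1 S (hm b c) (hm a b)) (pr2 S (hm b c) (hm a b))"

text \<open>Since U 1 is terminal, arrows U 1 \<times> a \<rightarrow> b amount to arrows a
  \<rightarrow> b; \<theta> is this correspondence followed by the representation at the stage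
  1.\<close>

definition \<theta> :: "'a \<Rightarrow> 'w" where
  "\<theta> f = \<psi> (tm S) (Dom C f) (Cod C f) (f \<cdot>\<^bsub>C\<^esub> pr2 T (fob U (tm S)) (Dom C f))"

lemma star_simps [simp]:
  assumes "x \<in> Arr V" "Dom V x = v" "Cod V x = hm b c" "y \<in> Arr V" "Dom V y = v" "Cod V y = hm a b"
    "a \<in> Obj C" "b \<in> Obj C" "c \<in> Obj C"
  shows "star v a b c x y \<in> Arr V" "Dom V (star v a b c x y) = v" "Cod V (star v a b c x y) = hm a c"
    "\<phi> v a c (star v a b c x y) = \<phi> v b c x \<cdot>\<^bsub>C\<^esub> tup C T (pr1 T (fob U v) a) (\<phi> v a b y)"
proof -
  have "v \<in> Obj V" using assms by auto
  then show "star v a b c x y \<in> Arr V" "Dom V (star v a b c x y) = v" "Cod V (star v a b c x y) = hm a c"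
    "\<phi> v a c (star v a b c x y) = \<phi> v b c x \<cdot>\<^bsub>C\<^esub> tup C T (pr1 T (fob U v) a) (\<phi> v a b y)"
    unfolding star_def using assms by simp_all
qed

text \<open>After \<phi> this is associativity of coKleisli composition: on both sides z is tupled
  with the projection to U v, then fed to y, and the result to x, always with the same
  parameter.\<close>

lemma star_assoc:
  assumes "x \<in> Arr V" "Dom V x = v" "Cod V x = hm c d" "y \<in> Arr V" "Dom V y = v" "Cod V y = hm b c"
    "z \<in> Arr V" "Dom V z = v" "Cod V z = hm a b" "a \<in> Obj C" "b \<in> Obj C" "c \<in> Obj C" "d \<in> Obj C"
  shows "star v a b d (star v b c d x y) z = star v a c d x (star v a b c y z)"
proof -
  have "v \<in> Obj V" using assms by auto
  then show ?thesis by (intro \<phi>_eqI[of v a d]) (use assms in simp_all)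
qed

lemma m_simps [simp]:
  assumes "a \<in> Obj C" "b \<in> Obj C" "c \<in> Obj C"
  shows "m a b c \<in> Arr V" "Dom V (m a b c) = prd S (hm b c) (hm a b)" "Cod V (m a b c) = hm a c"
  unfolding m_def using assms by simp_all

text \<open>\<open>star\<close> is stable under change of stage, and x, y arise from the generic
  pair by the change of stage along their tuple. So \<open>m\<close> computes \<open>star\<close> at
  every stage, and laws for \<open>m\<close> may be checked on generalized elements.\<close>

lemma m_tup:
  assumes "x \<in> Arr V" "Dom V x = v" "Cod V x = hm b c" "y \<in> Arr V" "Dom V y = v" "Cod V y = hm a b"
    "a \<in> Obj C" "b \<in> Obj C" "c \<in> Obj C"
  shows "m a b c \<cdot>\<^bsub>V\<^esub> tup V S x y = star v a b c x y"
proof (rule \<phi>_eqI[of v a c])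
  have v [simp]: "v \<in> Obj V" using assms by auto
  let ?t = "tup V S x y" and ?P = "prd S (hm b c) (hm a b)"
  let ?p = "pr1 S (hm b c) (hm a b)" and ?q = "pr2 S (hm b c) (hm a b)"
  note [simp] = assms
  have x: "\<phi> ?P b c ?p \<cdot>\<^bsub>C\<^esub> prd_map C T (far U ?t) (Idn C b) = \<phi> v b c x"
    using \<phi>_cmp[of ?p ?t b c] by simp
  have y: "\<phi> ?P a b ?q \<cdot>\<^bsub>C\<^esub> prd_map C T (far U ?t) (Idn C a) = \<phi> v a b y"
    using \<phi>_cmp[of ?q ?t a b] by simp
  have "\<phi> v a c (m a b c \<cdot>\<^bsub>V\<^esub> ?t) = \<phi> ?P a c (m a b c) \<cdot>\<^bsub>C\<^esub> prd_map C T (far U ?t) (Idn C a)"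
    using \<phi>_cmp[of "m a b c" ?t a c] by simp
  also have "\<dots> = \<phi> ?P b c ?p \<cdot>\<^bsub>C\<^esub> tup C T (far U ?t \<cdot>\<^bsub>C\<^esub> pr1 T (fob U v) a) (\<phi> v a b y)"
    using y by (simp add: m_def)
  also have "\<dots> = \<phi> ?P b c ?p \<cdot>\<^bsub>C\<^esub> prd_map C T (far U ?t) (Idn C b) \<cdot>\<^bsub>C\<^esub> tup C T (pr1 T (fob U v) a) (\<phi> v a b y)"
    by simp
  also have "\<dots> = \<phi> v b c x \<cdot>\<^bsub>C\<^esub> tup C T (pr1 T (fob U v) a) (\<phi> v a b y)"
    by (rule C.cmp_eq_assoc1[OF x]) simp_all
  finally show "\<phi> v a c (m a b c \<cdot>\<^bsub>V\<^esub> ?t) = \<phi> v a c (star v a b c x y)"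
    by simp
qed (use assms in simp_all)

lemma \<theta>_simps [simp]:
  assumes "f \<in> Arr C"
  shows "\<theta> f \<in> Arr V" "Dom V (\<theta> f) = tm S" "Cod V (\<theta> f) = hm (Dom C f) (Cod C f)"
  using assms by (simp_all add: \<theta>_def)

lemma \<phi>_\<theta>_cmp:
  assumes "f \<in> Arr C" "t \<in> Arr V" "Dom V t = v" "Cod V t = tm S" "Dom C f = a" "Cod C f = b"
  shows "\<phi> v a b (\<theta> f \<cdot>\<^bsub>V\<^esub> t) = f \<cdot>\<^bsub>C\<^esub> pr2 T (fob U v) a"
  using \<phi>_cmp[of "\<theta> f" t a b] assms by (auto simp: \<theta>_def)

lemma \<phi>_\<theta>:
  assumes "f \<in> Arr C" "Dom C f = a" "Cod C f = b"
  shows "\<phi> (tm S) a b (\<theta> f) = f \<cdot>\<^bsub>C\<^esub> pr2 T (fob U (tm S)) a"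
  using assms by (auto simp: \<theta>_def)

lemma bij_\<theta>:
  assumes [simp]: "a \<in> Obj C" "b \<in> Obj C"
  shows "bij_betw \<theta> (hom C a b) (hom V (tm S) (hm a b))"
proof -
  have "\<exists>!t. t \<in> hom C a (fob U (tm S))" using terminal_U by (simp add: terminal_def)
  then obtain t where t: "t \<in> Arr C" "Dom C t = a" "Cod C t = fob U (tm S)" by (auto simp: in_hom)
  \<comment> \<open>\<open>?s\<close> is inverse to the second projection of U 1 \<times> a: its
    first component causes no obstruction, since any two parallel arrows into U 1 agree.\<close>
  let ?s = "tup C T t (Idn C a)"
  have "\<exists>!k. k \<in> hom C (prd T (fob U (tm S)) a) (fob U (tm S))"
    using terminal_U by (simp add: terminal_def)
  then have "t \<cdot>\<^bsub>C\<^esub> pr2 T (fob U (tm S)) a = pr1 T (fob U (tm S)) a"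
    by (rule ex1_eqI) (use t in \<open>simp_all add: in_hom\<close>)
  then have s: "?s \<cdot>\<^bsub>C\<^esub> pr2 T (fob U (tm S)) a = Idn C (prd T (fob U (tm S)) a)"
    using t by simp
  show ?thesis
  proof (rule bij_betw_byWitness[where f' = "\<lambda>h. \<phi> (tm S) a b h \<cdot>\<^bsub>C\<^esub> ?s"]; (intro ballI subsetI)?)
    fix f assume "f \<in> hom C a b"
    then show "\<phi> (tm S) a b (\<theta> f) \<cdot>\<^bsub>C\<^esub> ?s = f"
      using t by (simp add: in_hom \<phi>_\<theta>)
  next
    fix h assume "h \<in> hom V (tm S) (hm a b)"
    then show "\<theta> (\<phi> (tm S) a b h \<cdot>\<^bsub>C\<^esub> ?s) = h"
      using t s by (intro \<phi>_eqI[of "tm S" a b]) (simp_all add: in_hom \<phi>_\<theta> del: C.tup_cmp)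
  qed (use t in \<open>auto simp: in_hom\<close>)
qed

text \<open>Each equation of the enrichment is one between arrows into a hom-object. With
  \<open>m_tup\<close>, composites become \<open>star\<close> of arrows with a common source, and
  the injectivity of \<phi> moves the equation to \<open>C\<close>, where it concerns projections
  and tuples.\<close>

lemma enriches: "enriches V C H"
proof -
  have unit1: "m a b b \<cdot>\<^bsub>V\<^esub> prd_map V S (\<theta> (Idn C b)) (Idn V (hm a b)) = pr2 S (tm S) (hm a b)"
    if [simp]: "a \<in> Obj C" "b \<in> Obj C" for a b
  proof -
    let ?x = "\<theta> (Idn C b) \<cdot>\<^bsub>V\<^esub> pr1 S (tm S) (hm a b)" and ?y = "pr2 S (tm S) (hm a b)"
    have "m a b b \<cdot>\<^bsub>V\<^esub> prd_map V S (\<theta> (Idn C b)) (Idn V (hm a b)) = star (prd S (tm S) (hm a b)) a b b ?x ?y"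
      by (simp add: prd_map_def m_tup)
    also have "\<dots> = ?y"
      by (rule \<phi>_eqI[of "prd S (tm S) (hm a b)" a b]) (simp_all add: \<phi>_\<theta>_cmp)
    finally show ?thesis .
  qed
  have unit2: "m a a b \<cdot>\<^bsub>V\<^esub> prd_map V S (Idn V (hm a b)) (\<theta> (Idn C a)) = pr1 S (hm a b) (tm S)"
    if [simp]: "a \<in> Obj C" "b \<in> Obj C" for a b
  proof -
    let ?x = "pr1 S (hm a b) (tm S)" and ?y = "\<theta> (Idn C a) \<cdot>\<^bsub>V\<^esub> pr2 S (hm a b) (tm S)"
    have "m a a b \<cdot>\<^bsub>V\<^esub> prd_map V S (Idn V (hm a b)) (\<theta> (Idn C a)) = star (prd S (hm a b) (tm S)) a a b ?x ?y"
      by (simp add: prd_map_def m_tup)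
    also have "\<dots> = ?x"
      by (rule \<phi>_eqI[of "prd S (hm a b) (tm S)" a b]) (simp_all add: \<phi>_\<theta>_cmp)
    finally show ?thesis .
  qed
  have assoc: "m a b d \<cdot>\<^bsub>V\<^esub> prd_map V S (m b c d) (Idn V (hm a b)) =
      m a c d \<cdot>\<^bsub>V\<^esub> prd_map V S (Idn V (hm c d)) (m a b c) \<cdot>\<^bsub>V\<^esub>
        tup V S (pr1 S (hm c d) (hm b c) \<cdot>\<^bsub>V\<^esub> pr1 S (prd S (hm c d) (hm b c)) (hm a b))
          (tup V S (pr2 S (hm c d) (hm b c) \<cdot>\<^bsub>V\<^esub> pr1 S (prd S (hm c d) (hm b c)) (hm a b))
            (pr2 S (prd S (hm c d) (hm b c)) (hm a b)))"
    if [simp]: "a \<in> Obj C" "b \<in> Obj C" "c \<in> Obj C" "d \<in> Obj C" for a b c d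
  proof -
    let ?Q = "prd S (hm c d) (hm b c)"
    let ?P = "prd S ?Q (hm a b)"
    let ?x = "pr1 S (hm c d) (hm b c) \<cdot>\<^bsub>V\<^esub> pr1 S ?Q (hm a b)"
    let ?y = "pr2 S (hm c d) (hm b c) \<cdot>\<^bsub>V\<^esub> pr1 S ?Q (hm a b)"
    let ?z = "pr2 S ?Q (hm a b)"
    \<comment> \<open>So the inner composition is \<open>star\<close> at the stage \<open>?P\<close>
      of all three arguments, where \<open>star_assoc\<close> applies.\<close>
    have "tup V S ?x ?y = pr1 S ?Q (hm a b)" by (rule V.tup_eta) simp_all
    then have "m b c d \<cdot>\<^bsub>V\<^esub> pr1 S ?Q (hm a b) = star ?P b c d ?x ?y"
      using m_tup[of ?x ?P c d ?y b] by simp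
    then have "m a b d \<cdot>\<^bsub>V\<^esub> prd_map V S (m b c d) (Idn V (hm a b)) = star ?P a b d (star ?P b c d ?x ?y) ?z"
      by (simp add: prd_map_def m_tup)
    also have "\<dots> = star ?P a c d ?x (star ?P a b c ?y ?z)"
      by (rule star_assoc) simp_all
    also have "\<dots> = m a c d \<cdot>\<^bsub>V\<^esub> prd_map V S (Idn V (hm c d)) (m a b c) \<cdot>\<^bsub>V\<^esub> tup V S ?x (tup V S ?y ?z)"
      using m_tup[of ?x ?P c d "star ?P a b c ?y ?z" a] m_tup[of ?y ?P b c ?z a] by simp
    finally show ?thesis .
  qed
  have comp: "\<theta> (g \<cdot>\<^bsub>C\<^esub> f) = m a b c \<cdot>\<^bsub>V\<^esub> tup V S (\<theta> g) (\<theta> f)"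
    if "f \<in> hom C a b" "g \<in> hom C b c" for a b c f g
  proof -
    have [simp]: "f \<in> Arr C" "Dom C f = a" "Cod C f = b" "g \<in> Arr C" "Dom C g = b" "Cod C g = c"
      using that by (simp_all add: in_hom)
    have [simp]: "a \<in> Obj C" "b \<in> Obj C" "c \<in> Obj C"
      using C.dom_obj[of f] C.cod_obj[of f] C.cod_obj[of g] by simp_all
    have "\<theta> (g \<cdot>\<^bsub>C\<^esub> f) = star (tm S) a b c (\<theta> g) (\<theta> f)"
      by (rule \<phi>_eqI[of "tm S" a c]) (simp_all add: \<phi>_\<theta>)
    then show ?thesis by (simp add: m_tup)
  qed
  \<comment> \<open>The identity of H(a, b) is the generic element h at the stage H(a, b); the
    equation says that \<open>far H (p, q)\<close> sends it to the composite of q, h and p in the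
    enriched category.\<close>
  have far: "far H (p, q) = m a' a b' \<cdot>\<^bsub>V\<^esub>
      tup V S (m a b b' \<cdot>\<^bsub>V\<^esub> tup V S (\<theta> q \<cdot>\<^bsub>V\<^esub> bang V (tm S) (hm a b)) (Idn V (hm a b)))
        (\<theta> p \<cdot>\<^bsub>V\<^esub> bang V (tm S) (hm a b))"
    if "p \<in> hom C a' a" "q \<in> hom C b b'" for a' a b b' p q
  proof -
    have pq [simp]: "p \<in> Arr C" "Dom C p = a'" "Cod C p = a" "q \<in> Arr C" "Dom C q = b" "Cod C q = b'"
      using that by (simp_all add: in_hom)
    have [simp]: "a' \<in> Obj C" "a \<in> Obj C" "b \<in> Obj C" "b' \<in> Obj C"
      using C.dom_obj[of p] C.cod_obj[of p] C.dom_obj[of q] C.cod_obj[of q] by simp_all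
    have Hpq [simp]: "far H (p, q) \<in> Arr V" "Dom V (far H (p, q)) = hm a b" "Cod V (far H (p, q)) = hm a' b'"
      by simp_all
    let ?v = "hm a b" and ?t = "bang V (tm S) (hm a b)"
    have "far H (p, q) = star ?v a' a b' (star ?v a b b' (\<theta> q \<cdot>\<^bsub>V\<^esub> ?t) (Idn V ?v)) (\<theta> p \<cdot>\<^bsub>V\<^esub> ?t)"
      using \<phi>_far[of p q "Idn V ?v" ?v]
      by (intro \<phi>_eqI[of ?v a' b']) (simp_all add: \<phi>_\<theta>_cmp prd_map_def)
    then show ?thesis by (simp add: m_tup)
  qed
  have "enriched_category V S (Obj C) hm m (\<lambda>a. \<theta> (Idn C a))"
    unfolding enriched_category_def Let_def
    using unit1 unit2 assoc V.is_cart by (auto simp: in_hom)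
  then show ?thesis
    unfolding enriches_def Let_def
    using H.is_func bij_\<theta> comp far
    by (intro conjI exI[of _ S] exI[of _ m] exI[of _ "\<lambda>a. \<theta> (Idn C a)"] exI[of _ \<theta>]) blast+
qed

end

text \<open>\<open>U\<close> takes the terminal object of \<open>V\<close> to a terminal object
  because it is a right adjoint; this is what makes \<open>C\<close> the underlying
  category.\<close>

lemma enriches_if_hom_rep:
  fixes S :: "('v, 'w) cart"
  assumes R: "hom_rep V C C H C (prd_fun C T \<circ>\<^sub>f (U \<times>\<^sub>f idf)) idf"
    and S: "cartesian V S" and T: "cartesian C T" and U: "adjoint C V F U"
  shows "enriches V C H"
proof -
  obtain \<phi> \<psi> where "rep_map V C C H C (prd_fun C T \<circ>\<^sub>f (U \<times>\<^sub>f idf)) idf \<phi> \<psi>"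
    using R by (auto simp: hom_rep_def)
  moreover have "terminal C (fob U (tm S))"
    using terminal_adjoint[OF U] S by (simp add: cartesian_def)
  ultimately interpret rep_enrichment V S C T U H \<phi> \<psi>
    using S T adjoint_functors(2)[OF U] by unfold_locales
  show ?thesis by (rule enriches)
qed

text \<open>The image of \<open>I\<close> carries a full enriched subcategory: compositions and
  identities are restricted along \<open>I\<close>, and full faithfulness keeps the correspondence
  between arrows and elements of hom-objects bijective.\<close>

lemma enriches_restrict:
  assumes A: "enriches V A H" and ff: "fully_faithful M A I"
  shows "enriches V M (H \<circ>\<^sub>f (I \<times>\<^sub>f I))"
proof -
  interpret I: func M A I using ff by unfold_locales (simp add: fully_faithful_def)
  obtain S m e \<theta> where H: "is_functor (op_cat A \<times>\<^sub>c A) V H"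
    and E: "enriched_category V S (Obj A) (\<lambda>a b. fob H (a, b)) m e"
    and bij: "\<And>a b. a \<in> Obj A \<Longrightarrow> b \<in> Obj A \<Longrightarrow> bij_betw \<theta> (hom A a b) (hom V (tm S) (fob H (a, b)))"
    and ids: "\<And>a. a \<in> Obj A \<Longrightarrow> \<theta> (Idn A a) = e a"
    and comp: "\<And>a b c f g. f \<in> hom A a b \<Longrightarrow> g \<in> hom A b c \<Longrightarrow> \<theta> (g \<cdot>\<^bsub>A\<^esub> f) = m a b c \<cdot>\<^bsub>V\<^esub> tup V S (\<theta> g) (\<theta> f)"
    and far: "\<And>a' a b b' p q. p \<in> hom A a' a \<Longrightarrow> q \<in> hom A b b' \<Longrightarrow> far H (p, q) = m a' a b' \<cdot>\<^bsub>V\<^esub>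
      tup V S (m a b b' \<cdot>\<^bsub>V\<^esub> tup V S (\<theta> q \<cdot>\<^bsub>V\<^esub> bang V (tm S) (fob H (a, b))) (Idn V (fob H (a, b))))
        (\<theta> p \<cdot>\<^bsub>V\<^esub> bang V (tm S) (fob H (a, b)))"
    using A unfolding enriches_def Let_def by metis
  have I: "far I f \<in> hom A (fob I a) (fob I b)" if "f \<in> hom M a b" for f a b
    using that by (auto simp: in_hom)
  have "enriched_category V S (Obj M) (\<lambda>a b. fob (H \<circ>\<^sub>f (I \<times>\<^sub>f I)) (a, b))
      (\<lambda>a b c. m (fob I a) (fob I b) (fob I c)) (\<lambda>a. e (fob I a))"
    using E unfolding enriched_category_def Let_def by simp
  moreover have "bij_betw (\<lambda>f. \<theta> (far I f)) (hom M a b) (hom V (tm S) (fob (H \<circ>\<^sub>f (I \<times>\<^sub>f I)) (a, b)))"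
    if "a \<in> Obj M" "b \<in> Obj M" for a b
    using bij_betw_trans[of "far I" "hom M a b" "hom A (fob I a) (fob I b)" \<theta>] bij[of "fob I a" "fob I b"] ff that
    by (simp add: fully_faithful_def comp_def)
  moreover have "\<theta> (far I (Idn M a)) = e (fob I a)" if "a \<in> Obj M" for a
    using that ids by simp
  moreover have "\<theta> (far I (g \<cdot>\<^bsub>M\<^esub> f)) = m (fob I a) (fob I b) (fob I c) \<cdot>\<^bsub>V\<^esub> tup V S (\<theta> (far I g)) (\<theta> (far I f))"
    if "f \<in> hom M a b" "g \<in> hom M b c" for a b c f g
    using comp[OF I[OF that(1)] I[OF that(2)]] that by (auto simp: in_hom)
  moreover have "is_functor (op_cat M \<times>\<^sub>c M) V (H \<circ>\<^sub>f (I \<times>\<^sub>f I))"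
    by (intro is_functor_fcomp[OF _ H] is_functor_fprod is_functor_op I.is_func)
  moreover have "far (H \<circ>\<^sub>f (I \<times>\<^sub>f I)) (p, q) = m (fob I a') (fob I a) (fob I b') \<cdot>\<^bsub>V\<^esub>
      tup V S (m (fob I a) (fob I b) (fob I b') \<cdot>\<^bsub>V\<^esub>
          tup V S (\<theta> (far I q) \<cdot>\<^bsub>V\<^esub> bang V (tm S) (fob (H \<circ>\<^sub>f (I \<times>\<^sub>f I)) (a, b))) (Idn V (fob (H \<circ>\<^sub>f (I \<times>\<^sub>f I)) (a, b))))
        (\<theta> (far I p) \<cdot>\<^bsub>V\<^esub> bang V (tm S) (fob (H \<circ>\<^sub>f (I \<times>\<^sub>f I)) (a, b)))"
    if "p \<in> hom M a' a" "q \<in> hom M b b'" for a' a b b' p q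
    using far[OF I[OF that(1)] I[OF that(2)]] by simp
  ultimately show ?thesis
    unfolding enriches_def Let_def
    by (intro conjI exI[of _ S] exI[of _ "\<lambda>a b c. m (fob I a) (fob I b) (fob I c)"]
        exI[of _ "\<lambda>a. e (fob I a)"] exI[of _ "\<lambda>f. \<theta> (far I f)"]) blast+
qed

section \<open>Hom-objects over one fibre and change of fibre\<close>

text \<open>Here \<open>U\<close> stands for \<open>X\<^sup>* b\<^sub>1\<close>, and \<open>M\<close>, \<open>N\<close> stand for \<open>\<M>X\<close>, \<open>\<M>'X\<close> or, by the symmetry of the
  axioms, for \<open>\<M>'X\<close>, \<open>\<M>X\<close>.\<close>

locale fibre =
  refl: reflection P M L I \<eta> \<epsilon> + cart: cart_cat P S
  for P :: "('p, 'q) cat" and M :: "('m, 'n) cat" and L I \<eta> \<epsilon> and S :: "('p, 'q, 'z) cart_scheme" +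
  fixes N :: "('k, 'l) cat" and I' :: "('k, 'l, 'p, 'q) fctr" and Bx :: "('p, 'q, 'm, 'n) fctr"
    and V :: "('v, 'w) cat" and U :: "('v, 'w, 'p, 'q) fctr" and W :: "('v, 'w, 'm, 'n) fctr"
    and W' :: "('v, 'w, 'k, 'l) fctr" and coend :: "('p, 'q, 'v, 'w) fctr"
  assumes I': "is_functor N P I'" and W: "is_functor V M W" and W': "is_functor V N W'"
    and Bx: "adjoint M P I Bx" and coend: "adjoint P V coend U"
    and UW: "nat_isomorphic V P U (I \<circ>\<^sub>f W)" and UW': "nat_isomorphic V P U (I' \<circ>\<^sub>f W')"
    and mixed: "\<And>p n. p \<in> Obj P \<Longrightarrow> n \<in> Obj N \<Longrightarrow>
      is_iso M (far L (prd_map P S (\<eta> p) (Idn P (fob I' n))))"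
begin

lemmas functors = refl.L.is_func refl.I.is_func adjoint_functors[OF coend] adjoint_functors[OF Bx]
  I' W W' cart.is_functor_prd_fun
lemmas idfs = is_functor_idf[OF refl.L.C.category_axioms] is_functor_idf[OF refl.L.D.category_axioms]

text \<open>The mixed law is assumed object by object; naturality of the unit \<eta> makes its
  arrows a natural isomorphism.\<close>

lemma mixed_nat_isomorphic:
  "nat_isomorphic (P \<times>\<^sub>c N) M (L \<circ>\<^sub>f prd_fun P S \<circ>\<^sub>f (idf \<times>\<^sub>f I')) (L \<circ>\<^sub>f prd_fun P S \<circ>\<^sub>f ((I \<circ>\<^sub>f L) \<times>\<^sub>f I'))"
proof -
  interpret I': func N P I' by unfold_locales (rule I')
  have L': "is_functor (P \<times>\<^sub>c P) M (L \<circ>\<^sub>f prd_fun P S)"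
    by (rule is_functor_fcomp[OF cart.is_functor_prd_fun refl.L.is_func])
  let ?t = "\<lambda>(p, n). far L (prd_map P S (\<eta> p) (Idn P (fob I' n)))"
  show ?thesis
  proof (rule nat_isomorphicI[of _ _ _ _ ?t])
    show "is_functor (P \<times>\<^sub>c N) M (L \<circ>\<^sub>f prd_fun P S \<circ>\<^sub>f (idf \<times>\<^sub>f I'))"
      using is_functor_fcomp[OF is_functor_fprod[OF idfs(1) I'] L'] by simp
    show "is_functor (P \<times>\<^sub>c N) M (L \<circ>\<^sub>f prd_fun P S \<circ>\<^sub>f ((I \<circ>\<^sub>f L) \<times>\<^sub>f I'))"
      using is_functor_fcomp[OF is_functor_fprod[OF is_functor_fcomp[OF refl.L.is_func refl.I.is_func] I'] L']
      by simp
    fix x assume "x \<in> Arr (P \<times>\<^sub>c N)"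
    then obtain u v where x: "x = (u, v)" and [simp]: "u \<in> Arr P" "v \<in> Arr N" by auto
    have "prd_map P S (\<eta> (Cod P u)) (Idn P (fob I' (Cod N v))) \<cdot>\<^bsub>P\<^esub> prd_map P S u (far I' v) =
        prd_map P S (far I (far L u)) (far I' v) \<cdot>\<^bsub>P\<^esub> prd_map P S (\<eta> (Dom P u)) (Idn P (fob I' (Dom N v)))"
      using refl.unit_natural[of u] by simp
    from refl.L.far_square[OF this]
    show "?t (Cod (P \<times>\<^sub>c N) x) \<cdot>\<^bsub>M\<^esub> far (L \<circ>\<^sub>f prd_fun P S \<circ>\<^sub>f (idf \<times>\<^sub>f I')) x =
        far (L \<circ>\<^sub>f prd_fun P S \<circ>\<^sub>f ((I \<circ>\<^sub>f L) \<times>\<^sub>f I')) x \<cdot>\<^bsub>M\<^esub> ?t (Dom (P \<times>\<^sub>c N) x)"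
      by (simp add: x)
  qed (auto simp: mixed)
qed

text \<open>As U v \<cong> I' (W' v), the factor U v has the form that the mixed law requires,
  except that the law expects it on the right.\<close>

lemma reflect_left:
  "nat_isomorphic (V \<times>\<^sub>c P) M (L \<circ>\<^sub>f prd_fun P S \<circ>\<^sub>f (U \<times>\<^sub>f idf)) (L \<circ>\<^sub>f prd_fun P S \<circ>\<^sub>f (U \<times>\<^sub>f (I \<circ>\<^sub>f L)))"
proof -
  have L': "is_functor (P \<times>\<^sub>c P) M (L \<circ>\<^sub>f prd_fun P S)" and IL: "is_functor P P (I \<circ>\<^sub>f L)"
    by (rule is_functor_fcomp functors)+
  \<comment> \<open>This brings U v \<times> K p into the form K p \<times> I' (W' v). It is used
    twice, with the identity and with the reflection as \<open>K\<close>.\<close>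
  have step: "nat_isomorphic (V \<times>\<^sub>c P) M (L \<circ>\<^sub>f prd_fun P S \<circ>\<^sub>f (U \<times>\<^sub>f K))
      (L \<circ>\<^sub>f prd_fun P S \<circ>\<^sub>f (K \<times>\<^sub>f I') \<circ>\<^sub>f swap_fun \<circ>\<^sub>f (W' \<times>\<^sub>f idf))"
    if K: "is_functor P P K" for K
  proof -
    have "nat_isomorphic (V \<times>\<^sub>c P) M (L \<circ>\<^sub>f prd_fun P S \<circ>\<^sub>f (U \<times>\<^sub>f K))
        (L \<circ>\<^sub>f prd_fun P S \<circ>\<^sub>f ((I' \<circ>\<^sub>f W') \<times>\<^sub>f K))"
      using nat_isomorphic_fprod_post[OF UW' nat_isomorphic_refl[OF K] L'] by simp
    also have "nat_isomorphic (V \<times>\<^sub>c P) M (L \<circ>\<^sub>f prd_fun P S \<circ>\<^sub>f ((I' \<circ>\<^sub>f W') \<times>\<^sub>f K))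
        (L \<circ>\<^sub>f prd_fun P S \<circ>\<^sub>f (K \<times>\<^sub>f I') \<circ>\<^sub>f swap_fun \<circ>\<^sub>f (W' \<times>\<^sub>f idf))"
      using nat_isomorphic_post[OF nat_isomorphic_pre[OF cart.nat_isomorphic_swap[OF I' K]
            is_functor_fprod[OF W' idfs(1)]] refl.L.is_func] by simp
    finally show ?thesis .
  qed
  have "nat_isomorphic (V \<times>\<^sub>c P) M (L \<circ>\<^sub>f prd_fun P S \<circ>\<^sub>f (idf \<times>\<^sub>f I') \<circ>\<^sub>f swap_fun \<circ>\<^sub>f (W' \<times>\<^sub>f idf))
      (L \<circ>\<^sub>f prd_fun P S \<circ>\<^sub>f ((I \<circ>\<^sub>f L) \<times>\<^sub>f I') \<circ>\<^sub>f swap_fun \<circ>\<^sub>f (W' \<times>\<^sub>f idf))"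
    using nat_isomorphic_pre[OF mixed_nat_isomorphic is_functor_fcomp[OF is_functor_fprod[OF W' idfs(1)]
        is_functor_swap_fun[OF is_functorD(1)[OF I'] refl.L.C.category_axioms]]] by simp
  from nat_isomorphic_trans[OF step[OF idfs(1)] nat_isomorphic_trans[OF this nat_isomorphic_sym[OF step[OF IL]]]]
  show ?thesis .
qed

text \<open>P(U v \<times> p, I m) \<cong> M(L (U v \<times> p), m) \<cong> M(L (U v \<times> I (L
  p)), m) \<cong> P(U v \<times> I (L p), I m). The middle step is the mixed law; the others
  transpose along L \<stileturn> I.\<close>

lemma prof_iso_Dia:
  "prof_iso (V \<times>\<^sub>c P) M P (prd_fun P S \<circ>\<^sub>f (U \<times>\<^sub>f idf)) I P (prd_fun P S \<circ>\<^sub>f (U \<times>\<^sub>f (I \<circ>\<^sub>f L))) I"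
proof -
  have K: "is_functor (V \<times>\<^sub>c P) P (prd_fun P S \<circ>\<^sub>f (U \<times>\<^sub>f idf))"
    and K': "is_functor (V \<times>\<^sub>c P) P (prd_fun P S \<circ>\<^sub>f (U \<times>\<^sub>f (I \<circ>\<^sub>f L)))"
    by (rule is_functor_fcomp is_functor_fprod functors idfs)+
  have "prof_iso (V \<times>\<^sub>c P) M P (prd_fun P S \<circ>\<^sub>f (U \<times>\<^sub>f idf)) I M (L \<circ>\<^sub>f prd_fun P S \<circ>\<^sub>f (U \<times>\<^sub>f idf)) idf"
    using prof_iso_sym[OF prof_iso_adjoint[OF refl.adjoint K idfs(2)]] by simp
  also have "prof_iso (V \<times>\<^sub>c P) M M (L \<circ>\<^sub>f prd_fun P S \<circ>\<^sub>f (U \<times>\<^sub>f idf)) idf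
      M (L \<circ>\<^sub>f prd_fun P S \<circ>\<^sub>f (U \<times>\<^sub>f (I \<circ>\<^sub>f L))) idf"
    by (rule prof_iso_cong[OF reflect_left nat_isomorphic_refl[OF idfs(2)]])
  also have "prof_iso (V \<times>\<^sub>c P) M M (L \<circ>\<^sub>f prd_fun P S \<circ>\<^sub>f (U \<times>\<^sub>f (I \<circ>\<^sub>f L))) idf
      P (prd_fun P S \<circ>\<^sub>f (U \<times>\<^sub>f (I \<circ>\<^sub>f L))) I"
    using prof_iso_adjoint[OF refl.adjoint K' idfs(2)] by simp
  finally show ?thesis .
qed

text \<open>By U v \<cong> I (W v), the object K = U v \<times> I m is isomorphic to I (L K). Hence
  P(K, I (Bx q)) \<cong> M(L K, Bx q) \<cong> P(I (L K), q) \<cong> P(K, q), by full faithfulness of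
  \<open>I\<close> and then by I \<stileturn> Bx.\<close>

lemma prof_iso_Box:
  "prof_iso (V \<times>\<^sub>c M) P P (prd_fun P S \<circ>\<^sub>f (U \<times>\<^sub>f I)) (I \<circ>\<^sub>f Bx) P (prd_fun P S \<circ>\<^sub>f (U \<times>\<^sub>f I)) idf"
proof -
  let ?K = "prd_fun P S \<circ>\<^sub>f (U \<times>\<^sub>f I)"
  have K: "is_functor (V \<times>\<^sub>c M) P ?K"
    by (rule is_functor_fcomp is_functor_fprod functors idfs)+
  have LK: "is_functor (V \<times>\<^sub>c M) M (L \<circ>\<^sub>f ?K)"
    by (rule is_functor_fcomp[OF K refl.L.is_func])
  have "nat_isomorphic (V \<times>\<^sub>c M) P (prd_fun P S \<circ>\<^sub>f ((I \<circ>\<^sub>f W) \<times>\<^sub>f (I \<circ>\<^sub>f idf))) ?K"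
    using nat_isomorphic_fprod_post[OF nat_isomorphic_sym[OF UW] nat_isomorphic_refl[OF refl.I.is_func]
        cart.is_functor_prd_fun] by simp
  from refl.nat_isomorphic_reflect[OF cart.is_cart W idfs(2) this]
  have r: "nat_isomorphic (V \<times>\<^sub>c M) P ?K (I \<circ>\<^sub>f L \<circ>\<^sub>f ?K)" .
  have IBx: "is_functor P P (I \<circ>\<^sub>f Bx)" by (rule is_functor_fcomp functors)+
  have "prof_iso (V \<times>\<^sub>c M) P P ?K (I \<circ>\<^sub>f Bx) P (I \<circ>\<^sub>f L \<circ>\<^sub>f ?K) (I \<circ>\<^sub>f Bx)"
    by (rule prof_iso_cong[OF r nat_isomorphic_refl[OF IBx]])
  also have "prof_iso (V \<times>\<^sub>c M) P P (I \<circ>\<^sub>f L \<circ>\<^sub>f ?K) (I \<circ>\<^sub>f Bx) M (L \<circ>\<^sub>f ?K) Bx"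
    by (rule prof_iso_sym[OF prof_iso_fully_faithful[OF refl.ff LK adjoint_functors(2)[OF Bx]]])
  also have "prof_iso (V \<times>\<^sub>c M) P M (L \<circ>\<^sub>f ?K) Bx P (I \<circ>\<^sub>f L \<circ>\<^sub>f ?K) idf"
    using prof_iso_sym[OF prof_iso_adjoint[OF Bx LK idfs(1)]] by simp
  also have "prof_iso (V \<times>\<^sub>c M) P P (I \<circ>\<^sub>f L \<circ>\<^sub>f ?K) idf P ?K idf"
    by (rule prof_iso_cong[OF nat_isomorphic_sym[OF r] nat_isomorphic_refl[OF idfs(1)]])
  finally show ?thesis .
qed

text \<open>The right adjoint \<open>U\<close> of \<open>coend\<close> factors through
  \<open>I\<close>, so arrows from p to U v are determined by the reflection of p; hence
  \<open>coend\<close> only sees that reflection.\<close>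

lemma coend_reflect: "nat_isomorphic P V coend (coend \<circ>\<^sub>f I \<circ>\<^sub>f L)"
proof (rule nat_isomorphic_if_prof_iso)
  have IL: "is_functor P P (I \<circ>\<^sub>f L)" and V: "is_functor V V idf"
    by (rule is_functor_fcomp functors is_functor_idf is_functorD(1)[OF W])+
  have "prof_iso P V V coend idf P idf U"
    using coend by (simp add: adjoint_iff_prof_iso)
  also have "prof_iso P V P idf U P idf (I \<circ>\<^sub>f W)"
    by (rule prof_iso_cong[OF nat_isomorphic_refl[OF idfs(1)] UW])
  also have "prof_iso P V P idf (I \<circ>\<^sub>f W) M L W"
    using prof_iso_sym[OF prof_iso_adjoint[OF refl.adjoint idfs(1) W]] by simp
  also have "prof_iso P V M L W P (I \<circ>\<^sub>f L) (I \<circ>\<^sub>f W)"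
    by (rule prof_iso_fully_faithful[OF refl.ff refl.L.is_func W])
  also have "prof_iso P V P (I \<circ>\<^sub>f L) (I \<circ>\<^sub>f W) P (I \<circ>\<^sub>f L) U"
    by (rule prof_iso_cong[OF nat_isomorphic_refl[OF IL] nat_isomorphic_sym[OF UW]])
  also have "prof_iso P V P (I \<circ>\<^sub>f L) U V (coend \<circ>\<^sub>f I \<circ>\<^sub>f L) idf"
    using prof_iso_sym[OF prof_iso_adjoint[OF coend IL V]] by simp
  finally show "prof_iso P V V coend idf V (coend \<circ>\<^sub>f I \<circ>\<^sub>f L) idf" .
qed

text \<open>The mixed law gives an isomorphism only after \<open>L\<close> has been applied. By
  \<open>coend_reflect\<close> this is enough, since \<open>coend\<close> factors through
  \<open>L\<close>.\<close>

lemma coend_mixed: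
  "nat_isomorphic (P \<times>\<^sub>c N) V (coend \<circ>\<^sub>f prd_fun P S \<circ>\<^sub>f (idf \<times>\<^sub>f I')) (coend \<circ>\<^sub>f prd_fun P S \<circ>\<^sub>f ((I \<circ>\<^sub>f L) \<times>\<^sub>f I'))"
proof -
  have K: "is_functor (P \<times>\<^sub>c N) P (prd_fun P S \<circ>\<^sub>f (idf \<times>\<^sub>f I'))"
    and K': "is_functor (P \<times>\<^sub>c N) P (prd_fun P S \<circ>\<^sub>f ((I \<circ>\<^sub>f L) \<times>\<^sub>f I'))"
    and cI: "is_functor M V (coend \<circ>\<^sub>f I)"
    by (rule is_functor_fcomp is_functor_fprod functors idfs)+
  have "nat_isomorphic (P \<times>\<^sub>c N) V (coend \<circ>\<^sub>f prd_fun P S \<circ>\<^sub>f (idf \<times>\<^sub>f I'))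
      (coend \<circ>\<^sub>f I \<circ>\<^sub>f L \<circ>\<^sub>f prd_fun P S \<circ>\<^sub>f (idf \<times>\<^sub>f I'))"
    using nat_isomorphic_pre[OF coend_reflect K] by simp
  also have "nat_isomorphic (P \<times>\<^sub>c N) V (coend \<circ>\<^sub>f I \<circ>\<^sub>f L \<circ>\<^sub>f prd_fun P S \<circ>\<^sub>f (idf \<times>\<^sub>f I'))
      (coend \<circ>\<^sub>f I \<circ>\<^sub>f L \<circ>\<^sub>f prd_fun P S \<circ>\<^sub>f ((I \<circ>\<^sub>f L) \<times>\<^sub>f I'))"
    using nat_isomorphic_post[OF mixed_nat_isomorphic cI] by simp
  also have "nat_isomorphic (P \<times>\<^sub>c N) V (coend \<circ>\<^sub>f I \<circ>\<^sub>f L \<circ>\<^sub>f prd_fun P S \<circ>\<^sub>f ((I \<circ>\<^sub>f L) \<times>\<^sub>f I'))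
      (coend \<circ>\<^sub>f prd_fun P S \<circ>\<^sub>f ((I \<circ>\<^sub>f L) \<times>\<^sub>f I'))"
    using nat_isomorphic_sym[OF nat_isomorphic_pre[OF coend_reflect K']] by simp
  finally show ?thesis .
qed

lemma coend_mixed_swap:
  "nat_isomorphic (N \<times>\<^sub>c P) V (coend \<circ>\<^sub>f prd_fun P S \<circ>\<^sub>f (I' \<times>\<^sub>f (I \<circ>\<^sub>f L))) (coend \<circ>\<^sub>f prd_fun P S \<circ>\<^sub>f (I' \<times>\<^sub>f idf))"
proof -
  have swap: "nat_isomorphic (N \<times>\<^sub>c P) V (coend \<circ>\<^sub>f prd_fun P S \<circ>\<^sub>f (I' \<times>\<^sub>f K))
      (coend \<circ>\<^sub>f prd_fun P S \<circ>\<^sub>f (K \<times>\<^sub>f I') \<circ>\<^sub>f swap_fun)" if "is_functor P P K" for K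
    using nat_isomorphic_post[OF cart.nat_isomorphic_swap[OF I' that] adjoint_functors(1)[OF coend]] by simp
  have IL: "is_functor P P (I \<circ>\<^sub>f L)" by (rule is_functor_fcomp functors)+
  have "nat_isomorphic (N \<times>\<^sub>c P) V (coend \<circ>\<^sub>f prd_fun P S \<circ>\<^sub>f ((I \<circ>\<^sub>f L) \<times>\<^sub>f I') \<circ>\<^sub>f swap_fun)
      (coend \<circ>\<^sub>f prd_fun P S \<circ>\<^sub>f (idf \<times>\<^sub>f I') \<circ>\<^sub>f swap_fun)"
    using nat_isomorphic_pre[OF nat_isomorphic_sym[OF coend_mixed]
        is_functor_swap_fun[OF is_functorD(1)[OF I'] refl.L.C.category_axioms]] by simp
  from nat_isomorphic_trans[OF swap[OF IL] nat_isomorphic_trans[OF this nat_isomorphic_sym[OF swap[OF idfs(1)]]]]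
  show ?thesis .
qed

lemma nat_Box_nat_isomorphic:
  assumes H: "hom_rep V P P H P (prd_fun P S \<circ>\<^sub>f (U \<times>\<^sub>f idf)) idf"
  shows "nat_isomorphic (op_cat M \<times>\<^sub>c P) V (H \<circ>\<^sub>f (I \<times>\<^sub>f (I \<circ>\<^sub>f Bx))) (H \<circ>\<^sub>f (I \<times>\<^sub>f idf))"
proof (rule hom_rep_unique)
  have IBx: "is_functor P P (I \<circ>\<^sub>f Bx)" by (rule is_functor_fcomp functors)+
  show "hom_rep V M P (H \<circ>\<^sub>f (I \<times>\<^sub>f (I \<circ>\<^sub>f Bx))) P (prd_fun P S \<circ>\<^sub>f (U \<times>\<^sub>f I)) idf"
    using hom_rep_prof_iso[OF _ prof_iso_Box] hom_rep_fcomp[OF H refl.I.is_func IBx] by simp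
  show "hom_rep V M P (H \<circ>\<^sub>f (I \<times>\<^sub>f idf)) P (prd_fun P S \<circ>\<^sub>f (U \<times>\<^sub>f I)) idf"
    using hom_rep_fcomp[OF H refl.I.is_func idfs(1)] by simp
qed

lemma nat_Dia_nat_isomorphic:
  assumes H: "hom_rep V P P H P (prd_fun P S \<circ>\<^sub>f (U \<times>\<^sub>f idf)) idf"
  shows "nat_isomorphic (op_cat P \<times>\<^sub>c M) V (H \<circ>\<^sub>f ((I \<circ>\<^sub>f L) \<times>\<^sub>f I)) (H \<circ>\<^sub>f (idf \<times>\<^sub>f I))"
proof (rule hom_rep_unique)
  have IL: "is_functor P P (I \<circ>\<^sub>f L)" by (rule is_functor_fcomp functors)+
  show "hom_rep V P M (H \<circ>\<^sub>f ((I \<circ>\<^sub>f L) \<times>\<^sub>f I)) P (prd_fun P S \<circ>\<^sub>f (U \<times>\<^sub>f idf)) I"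
    using hom_rep_prof_iso[OF _ prof_iso_sym[OF prof_iso_Dia]] hom_rep_fcomp[OF H IL refl.I.is_func] by simp
  show "hom_rep V P M (H \<circ>\<^sub>f (idf \<times>\<^sub>f I)) P (prd_fun P S \<circ>\<^sub>f (U \<times>\<^sub>f idf)) I"
    using hom_rep_fcomp[OF H idfs(1) refl.I.is_func] by simp
qed

end

text \<open>Change of fibre along \<open>f : X \<rightarrow> Y\<close>: here \<open>F \<stileturn> G \<stileturn> R\<close> stands for \<open>\<Sigma>\<^sub>f \<stileturn> f\<^sup>* \<stileturn> \<Pi>\<^sub>f\<close>.\<close>

locale base_change =
  S: cart_cat P S + T: cart_cat Q T
  for P :: "('p, 'q) cat" and S :: "('p, 'q, 'z) cart_scheme"
    and Q :: "('p2, 'q2) cat" and T :: "('p2, 'q2, 'z2) cart_scheme" +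
  fixes F :: "('p, 'q, 'p2, 'q2) fctr" and G :: "('p2, 'q2, 'p, 'q) fctr" and R :: "('p, 'q, 'p2, 'q2) fctr"
    and V :: "('v, 'w) cat" and U :: "('v, 'w, 'p, 'q) fctr" and U' :: "('v, 'w, 'p2, 'q2) fctr"
    and coend :: "('p, 'q, 'v, 'w) fctr" and coend' :: "('p2, 'q2, 'v, 'w) fctr"
  assumes FG: "adjoint P Q F G" and GR: "adjoint Q P G R"
    and frob: "nat_isomorphic (P \<times>\<^sub>c Q) Q (F \<circ>\<^sub>f prd_fun P S \<circ>\<^sub>f (idf \<times>\<^sub>f G)) (prd_fun Q T \<circ>\<^sub>f (F \<times>\<^sub>f idf))"
    and coend: "adjoint P V coend U" and coend': "adjoint Q V coend' U'"
    and UU': "nat_isomorphic V P U (G \<circ>\<^sub>f U')"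
begin

lemmas functors = adjoint_functors[OF FG] adjoint_functors[OF GR] adjoint_functors[OF coend]
  adjoint_functors[OF coend'] S.is_functor_prd_fun T.is_functor_prd_fun
lemmas idfs = is_functor_idf[OF S.category_axioms] is_functor_idf[OF T.category_axioms]

lemma frob_swap:
  "nat_isomorphic (Q \<times>\<^sub>c P) Q (F \<circ>\<^sub>f prd_fun P S \<circ>\<^sub>f (G \<times>\<^sub>f idf)) (prd_fun Q T \<circ>\<^sub>f (idf \<times>\<^sub>f F))"
proof -
  have "nat_isomorphic (Q \<times>\<^sub>c P) Q (F \<circ>\<^sub>f prd_fun P S \<circ>\<^sub>f (G \<times>\<^sub>f idf))
      (F \<circ>\<^sub>f prd_fun P S \<circ>\<^sub>f (idf \<times>\<^sub>f G) \<circ>\<^sub>f swap_fun)"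
    using nat_isomorphic_post[OF S.nat_isomorphic_swap[OF functors(2) idfs(1)] functors(1)] by simp
  also have "nat_isomorphic (Q \<times>\<^sub>c P) Q (F \<circ>\<^sub>f prd_fun P S \<circ>\<^sub>f (idf \<times>\<^sub>f G) \<circ>\<^sub>f swap_fun)
      (prd_fun Q T \<circ>\<^sub>f (F \<times>\<^sub>f idf) \<circ>\<^sub>f swap_fun)"
    using nat_isomorphic_pre[OF frob is_functor_swap_fun[OF T.category_axioms S.category_axioms]] by simp
  also have "nat_isomorphic (Q \<times>\<^sub>c P) Q (prd_fun Q T \<circ>\<^sub>f (F \<times>\<^sub>f idf) \<circ>\<^sub>f swap_fun)
      (prd_fun Q T \<circ>\<^sub>f (idf \<times>\<^sub>f F))"
    by (rule nat_isomorphic_sym[OF T.nat_isomorphic_swap[OF idfs(2) functors(1)]])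
  finally show ?thesis .
qed

text \<open>By U \<cong> G U', both sides are left adjoint to \<open>U\<close>. No formula for
  \<open>coend\<close> is available, so uniqueness of adjoints is the means of comparison.\<close>

lemma coend_nat_isomorphic: "nat_isomorphic P V coend (coend' \<circ>\<^sub>f F)"
  by (rule adjoint_nat_isomorphic_left[OF coend adjoint_fcomp[OF FG coend'] UU'])

lemma meets_nat_isomorphic:
  "nat_isomorphic (Q \<times>\<^sub>c P) V (coend \<circ>\<^sub>f prd_fun P S \<circ>\<^sub>f (G \<times>\<^sub>f idf)) (coend' \<circ>\<^sub>f prd_fun Q T \<circ>\<^sub>f (idf \<times>\<^sub>f F))"
  "nat_isomorphic (P \<times>\<^sub>c Q) V (coend \<circ>\<^sub>f prd_fun P S \<circ>\<^sub>f (idf \<times>\<^sub>f G)) (coend' \<circ>\<^sub>f prd_fun Q T \<circ>\<^sub>f (F \<times>\<^sub>f idf))"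
proof -
  have K: "is_functor (Q \<times>\<^sub>c P) P (prd_fun P S \<circ>\<^sub>f (G \<times>\<^sub>f idf))"
    and K': "is_functor (P \<times>\<^sub>c Q) P (prd_fun P S \<circ>\<^sub>f (idf \<times>\<^sub>f G))"
    by (rule is_functor_fcomp is_functor_fprod functors idfs)+
  show "nat_isomorphic (Q \<times>\<^sub>c P) V (coend \<circ>\<^sub>f prd_fun P S \<circ>\<^sub>f (G \<times>\<^sub>f idf)) (coend' \<circ>\<^sub>f prd_fun Q T \<circ>\<^sub>f (idf \<times>\<^sub>f F))"
    using nat_isomorphic_trans[OF nat_isomorphic_pre[OF coend_nat_isomorphic K, simplified]
        nat_isomorphic_post[OF frob_swap adjoint_functors(1)[OF coend']]] by simp
  show "nat_isomorphic (P \<times>\<^sub>c Q) V (coend \<circ>\<^sub>f prd_fun P S \<circ>\<^sub>f (idf \<times>\<^sub>f G)) (coend' \<circ>\<^sub>f prd_fun Q T \<circ>\<^sub>f (F \<times>\<^sub>f idf))"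
    using nat_isomorphic_trans[OF nat_isomorphic_pre[OF coend_nat_isomorphic K', simplified]
        nat_isomorphic_post[OF frob adjoint_functors(1)[OF coend']]] by simp
qed

lemma hom_nat_isomorphic:
  assumes H: "hom_rep V P P H P (prd_fun P S \<circ>\<^sub>f (U \<times>\<^sub>f idf)) idf"
    and H': "hom_rep V Q Q H' Q (prd_fun Q T \<circ>\<^sub>f (U' \<times>\<^sub>f idf)) idf"
  shows "nat_isomorphic (op_cat Q \<times>\<^sub>c P) V (H \<circ>\<^sub>f (G \<times>\<^sub>f idf)) (H' \<circ>\<^sub>f (idf \<times>\<^sub>f R))"
    and "nat_isomorphic (op_cat P \<times>\<^sub>c Q) V (H \<circ>\<^sub>f (idf \<times>\<^sub>f G)) (H' \<circ>\<^sub>f (F \<times>\<^sub>f idf))"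
proof -
  have K: "is_functor (V \<times>\<^sub>c Q) Q (prd_fun Q T \<circ>\<^sub>f (U' \<times>\<^sub>f idf))"
    and K2: "is_functor (V \<times>\<^sub>c P) P (prd_fun P S \<circ>\<^sub>f (U \<times>\<^sub>f idf))"
    and FS: "is_functor (P \<times>\<^sub>c P) Q (F \<circ>\<^sub>f prd_fun P S)"
    by (rule is_functor_fcomp is_functor_fprod functors idfs)+
  \<comment> \<open>\<open>G\<close> preserves products as a right adjoint, so U \<cong> G U' gives
    U v \<times> G q \<cong> G (U' v \<times> q). Then G \<stileturn> R applies.\<close>
  have "nat_isomorphic (V \<times>\<^sub>c Q) P (prd_fun P S \<circ>\<^sub>f (U \<times>\<^sub>f G)) (prd_fun P S \<circ>\<^sub>f ((G \<circ>\<^sub>f U') \<times>\<^sub>f G))"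
    by (rule nat_isomorphic_fprod_post[OF UU' nat_isomorphic_refl[OF functors(2)] functors(9)])
  also have "nat_isomorphic (V \<times>\<^sub>c Q) P (prd_fun P S \<circ>\<^sub>f ((G \<circ>\<^sub>f U') \<times>\<^sub>f G)) (G \<circ>\<^sub>f prd_fun Q T \<circ>\<^sub>f (U' \<times>\<^sub>f idf))"
    using nat_isomorphic_sym[OF nat_isomorphic_pre[OF adjoint_preserves_products[OF FG S.is_cart T.is_cart]
          is_functor_fprod[OF adjoint_functors(2)[OF coend'] idfs(2)]]] by simp
  finally have 1: "nat_isomorphic (V \<times>\<^sub>c Q) P (prd_fun P S \<circ>\<^sub>f (U \<times>\<^sub>f G)) (G \<circ>\<^sub>f prd_fun Q T \<circ>\<^sub>f (U' \<times>\<^sub>f idf))" .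
  have "prof_iso (V \<times>\<^sub>c Q) P P (prd_fun P S \<circ>\<^sub>f (U \<times>\<^sub>f G)) idf P (G \<circ>\<^sub>f prd_fun Q T \<circ>\<^sub>f (U' \<times>\<^sub>f idf)) idf"
    by (rule prof_iso_cong[OF 1 nat_isomorphic_refl[OF idfs(1)]])
  also have "prof_iso (V \<times>\<^sub>c Q) P P (G \<circ>\<^sub>f prd_fun Q T \<circ>\<^sub>f (U' \<times>\<^sub>f idf)) idf Q (prd_fun Q T \<circ>\<^sub>f (U' \<times>\<^sub>f idf)) R"
    using prof_iso_adjoint[OF GR K idfs(1)] by simp
  finally have 2: "prof_iso (V \<times>\<^sub>c Q) P P (prd_fun P S \<circ>\<^sub>f (U \<times>\<^sub>f G)) idf Q (prd_fun Q T \<circ>\<^sub>f (U' \<times>\<^sub>f idf)) R" .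
  show "nat_isomorphic (op_cat Q \<times>\<^sub>c P) V (H \<circ>\<^sub>f (G \<times>\<^sub>f idf)) (H' \<circ>\<^sub>f (idf \<times>\<^sub>f R))"
  proof (rule hom_rep_unique)
    show "hom_rep V Q P (H \<circ>\<^sub>f (G \<times>\<^sub>f idf)) Q (prd_fun Q T \<circ>\<^sub>f (U' \<times>\<^sub>f idf)) R"
      using hom_rep_prof_iso[OF _ 2] hom_rep_fcomp[OF H functors(2) idfs(1)] by simp
    show "hom_rep V Q P (H' \<circ>\<^sub>f (idf \<times>\<^sub>f R)) Q (prd_fun Q T \<circ>\<^sub>f (U' \<times>\<^sub>f idf)) R"
      using hom_rep_fcomp[OF H' idfs(2) adjoint_functors(2)[OF GR]] by simp
  qed
  \<comment> \<open>This direction needs the Frobenius law: F (U v \<times> p) \<cong> F (G (U' v)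
    \<times> p) \<cong> U' v \<times> F p. It is then combined with transposition along F
    \<stileturn> G.\<close>
  have "nat_isomorphic (V \<times>\<^sub>c P) Q (F \<circ>\<^sub>f prd_fun P S \<circ>\<^sub>f (U \<times>\<^sub>f idf)) (F \<circ>\<^sub>f prd_fun P S \<circ>\<^sub>f ((G \<circ>\<^sub>f U') \<times>\<^sub>f idf))"
    using nat_isomorphic_fprod_post[OF UU' nat_isomorphic_refl[OF idfs(1)] FS] by simp
  also have "nat_isomorphic (V \<times>\<^sub>c P) Q (F \<circ>\<^sub>f prd_fun P S \<circ>\<^sub>f ((G \<circ>\<^sub>f U') \<times>\<^sub>f idf)) (prd_fun Q T \<circ>\<^sub>f (U' \<times>\<^sub>f F))"
    using nat_isomorphic_pre[OF frob_swap is_functor_fprod[OF adjoint_functors(2)[OF coend'] idfs(1)]] by simp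
  finally have 3: "nat_isomorphic (V \<times>\<^sub>c P) Q (F \<circ>\<^sub>f prd_fun P S \<circ>\<^sub>f (U \<times>\<^sub>f idf)) (prd_fun Q T \<circ>\<^sub>f (U' \<times>\<^sub>f F))" .
  have "prof_iso (V \<times>\<^sub>c P) Q P (prd_fun P S \<circ>\<^sub>f (U \<times>\<^sub>f idf)) G Q (F \<circ>\<^sub>f prd_fun P S \<circ>\<^sub>f (U \<times>\<^sub>f idf)) idf"
    using prof_iso_sym[OF prof_iso_adjoint[OF FG K2 idfs(2)]] by simp
  also have "prof_iso (V \<times>\<^sub>c P) Q Q (F \<circ>\<^sub>f prd_fun P S \<circ>\<^sub>f (U \<times>\<^sub>f idf)) idf Q (prd_fun Q T \<circ>\<^sub>f (U' \<times>\<^sub>f F)) idf"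
    by (rule prof_iso_cong[OF 3 nat_isomorphic_refl[OF idfs(2)]])
  finally have 4: "prof_iso (V \<times>\<^sub>c P) Q P (prd_fun P S \<circ>\<^sub>f (U \<times>\<^sub>f idf)) G Q (prd_fun Q T \<circ>\<^sub>f (U' \<times>\<^sub>f F)) idf" .
  show "nat_isomorphic (op_cat P \<times>\<^sub>c Q) V (H \<circ>\<^sub>f (idf \<times>\<^sub>f G)) (H' \<circ>\<^sub>f (F \<times>\<^sub>f idf))"
  proof (rule hom_rep_unique)
    show "hom_rep V P Q (H \<circ>\<^sub>f (idf \<times>\<^sub>f G)) Q (prd_fun Q T \<circ>\<^sub>f (U' \<times>\<^sub>f F)) idf"
      using hom_rep_prof_iso[OF _ 4] hom_rep_fcomp[OF H idfs(1) functors(2)] by simp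
    show "hom_rep V P Q (H' \<circ>\<^sub>f (F \<times>\<^sub>f idf)) Q (prd_fun Q T \<circ>\<^sub>f (U' \<times>\<^sub>f F)) idf"
      using hom_rep_fcomp[OF H' functors(1) idfs(2)] by simp
  qed
qed

end

section \<open>Temporal doctrines\<close>

lemma indexed_category_functor:
  assumes "indexed_category C M" "f \<in> hom C X Y"
  shows "is_functor (fib M Y) (fib M X) (sub M f)"
proof -
  have "\<forall>X Y. \<forall>f \<in> hom C X Y. is_functor (fib M Y) (fib M X) (sub M f)"
    using assms(1) unfolding indexed_category_def by (elim conjE)
  then show ?thesis using assms(2) by blast
qed

lemma indexed_category_cmp:
  assumes "indexed_category C M" "f \<in> hom C X Y" "g \<in> hom C Y Z"
  shows "nat_isomorphic (fib M Z) (fib M X) (sub M f \<circ>\<^sub>f sub M g) (sub M (g \<cdot>\<^bsub>C\<^esub> f))"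
proof -
  have "\<forall>X Y Z. \<forall>f \<in> hom C X Y. \<forall>g \<in> hom C Y Z.
      nat_iso (fib M Z) (fib M X) (sub M f \<circ>\<^sub>f sub M g) (sub M (g \<cdot>\<^bsub>C\<^esub> f)) (ccell M f g)"
    using assms(1) unfolding indexed_category_def by (elim conjE)
  then show ?thesis using assms(2,3) unfolding nat_isomorphic_def by blast
qed

lemma indexed_functor_functor:
  "indexed_functor C M P I \<Longrightarrow> X \<in> Obj C \<Longrightarrow> is_functor (fib M X) (fib P X) (at_ob I X)"
  unfolding indexed_functor_def by (elim conjE) simp

lemma indexed_functor_nat_isomorphic:
  assumes "indexed_functor C M P I" "f \<in> hom C X Y"
  shows "nat_isomorphic (fib M Y) (fib P X) (at_ob I X \<circ>\<^sub>f sub M f) (sub P f \<circ>\<^sub>f at_ob I Y)"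
proof -
  have "\<forall>X Y. \<forall>f \<in> hom C X Y.
      nat_iso (fib M Y) (fib P X) (at_ob I X \<circ>\<^sub>f sub M f) (sub P f \<circ>\<^sub>f at_ob I Y) (scell I f)"
    using assms(1) unfolding indexed_functor_def by (elim conjE)
  then show ?thesis using assms(2) unfolding nat_isomorphic_def by blast
qed

context temporal_doctrine
begin

section \<open>Substitution, the two inclusions and the functor from hom-objects to a fibre\<close>

lemma base_objs: "f \<in> hom (base D) X Y \<Longrightarrow> X \<in> Obj (base D)" "f \<in> hom (base D) X Y \<Longrightarrow> Y \<in> Obj (base D)"
  using category.dom_obj[OF base_category] category.cod_obj[OF base_category] by (auto simp: in_hom)

lemma one_obj: "one_ob D \<in> Obj (base D)"
  using A1 by (simp add: terminal_def)

abbreviation "to_one X \<equiv> bang (base D) (one_ob D) X"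

lemma bang_hom:
  assumes "X \<in> Obj (base D)" shows "to_one X \<in> hom (base D) X (one_ob D)"
proof -
  have "\<exists>!f. f \<in> hom (base D) X (one_ob D)" using A1 assms by (simp add: terminal_def)
  then show ?thesis unfolding bang_def by (rule theI')
qed

lemma bang_cmp:
  assumes f: "f \<in> hom (base D) X Y" shows "to_one Y \<cdot>\<^bsub>base D\<^esub> f = to_one X"
proof -
  have u: "\<exists>!f. f \<in> hom (base D) X (one_ob D)" using A1 base_objs[OF f] by (simp add: terminal_def)
  show ?thesis
    by (rule ex1_eqI[OF u])
      (use category.cmp_hom[OF base_category f bang_hom] bang_hom base_objs[OF f] in auto)
qed

lemma indexed_functors:
  assumes f: "f \<in> hom (base D) X Y"
  shows "is_functor (PP D Y) (PP D X) (pull D f)" "is_functor (MM D Y) (MM D X) (act D f)"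
    "is_functor (MM' D Y) (MM' D X) (act' D f)"
  by (rule indexed_category_functor P_indexed M_indexed M'_indexed f)+

lemma inc_functors:
  assumes "X \<in> Obj (base D)"
  shows "is_functor (MM D X) (PP D X) (i_fun D X)" "is_functor (MM' D X) (PP D X) (i'_fun D X)"
  by (rule indexed_functor_functor[OF i_indexed assms] indexed_functor_functor[OF i'_indexed assms])+

lemma inc_nat_isomorphic:
  assumes f: "f \<in> hom (base D) X Y"
  shows "nat_isomorphic (MM D Y) (PP D X) (i_fun D X \<circ>\<^sub>f act D f) (pull D f \<circ>\<^sub>f i_fun D Y)"
    "nat_isomorphic (MM' D Y) (PP D X) (i'_fun D X \<circ>\<^sub>f act' D f) (pull D f \<circ>\<^sub>f i'_fun D Y)"
  by (rule indexed_functor_nat_isomorphic[OF i_indexed f] indexed_functor_nat_isomorphic[OF i'_indexed f])+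

lemma pull_nat_isomorphic:
  assumes f: "f \<in> hom (base D) X Y" and g: "g \<in> hom (base D) Y Z"
  shows "nat_isomorphic (PP D Z) (PP D X) (pull D f \<circ>\<^sub>f pull D g) (pull D (g \<cdot>\<^bsub>base D\<^esub> f))"
  by (rule indexed_category_cmp[OF P_indexed f g])

lemma j_functors:
  "is_functor (B_one D) (MM D (one_ob D)) j_fun" "is_functor (B_one D) (MM' D (one_ob D)) j'_fun"
  using B4 B4' by (simp_all add: equivalence_def)

text \<open>The third component of an object of the pseudo-pullback is the required isomorphism, and
  the condition imposed on arrows of the pseudo-pullback is its naturality.\<close>

lemma b_nat_isomorphic:
  "nat_isomorphic (B_one D) (PP D (one_ob D)) (b_fun D (one_ob D)) (i'_fun D (one_ob D) \<circ>\<^sub>f j'_fun)"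
  unfolding b_fun_def
proof (rule nat_isomorphicI[of _ _ _ _ "\<lambda>(m, n, \<phi>). \<phi>"])
  show "is_functor (B_one D) (PP D (one_ob D)) (i_fun D (one_ob D) \<circ>\<^sub>f j_fun)"
    "is_functor (B_one D) (PP D (one_ob D)) (i'_fun D (one_ob D) \<circ>\<^sub>f j'_fun)"
    by (rule is_functor_fcomp j_functors inc_functors one_obj)+
qed (auto simp: BB_def pseudo_pullback_def Let_def in_hom j_fun_def j'_fun_def)

text \<open>Pseudonaturality of i and i' moves substitution along X \<rightarrow> 1 past the
  inclusions; for i' the two legs of the pullback are first exchanged. The resulting functors into
  the two subcategories become \<open>W\<close> and \<open>W'\<close> of the locale
  \<open>fibre\<close>.\<close>

lemma Xb_nat_isomorphic:
  assumes X: "X \<in> Obj (base D)"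
  shows "nat_isomorphic (B_one D) (PP D X) (Xb D X) (i_fun D X \<circ>\<^sub>f act D (to_one X) \<circ>\<^sub>f j_fun)"
    and "nat_isomorphic (B_one D) (PP D X) (Xb D X) (i'_fun D X \<circ>\<^sub>f act' D (to_one X) \<circ>\<^sub>f j'_fun)"
proof -
  note t = bang_hom[OF X]
  show "nat_isomorphic (B_one D) (PP D X) (Xb D X) (i_fun D X \<circ>\<^sub>f act D (to_one X) \<circ>\<^sub>f j_fun)"
    using nat_isomorphic_sym[OF nat_isomorphic_pre[OF inc_nat_isomorphic(1)[OF t] j_functors(1)]]
    by (simp add: Xb_def b_fun_def)
  have "nat_isomorphic (B_one D) (PP D X) (Xb D X) (pull D (to_one X) \<circ>\<^sub>f i'_fun D (one_ob D) \<circ>\<^sub>f j'_fun)"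
    unfolding Xb_def by (rule nat_isomorphic_post[OF b_nat_isomorphic indexed_functors(1)[OF t]])
  also have "nat_isomorphic (B_one D) (PP D X) (pull D (to_one X) \<circ>\<^sub>f i'_fun D (one_ob D) \<circ>\<^sub>f j'_fun)
      (i'_fun D X \<circ>\<^sub>f act' D (to_one X) \<circ>\<^sub>f j'_fun)"
    using nat_isomorphic_sym[OF nat_isomorphic_pre[OF inc_nat_isomorphic(2)[OF t] j_functors(2)]] by simp
  finally show "nat_isomorphic (B_one D) (PP D X) (Xb D X) (i'_fun D X \<circ>\<^sub>f act' D (to_one X) \<circ>\<^sub>f j'_fun)" .
qed

text \<open>The arrow X \<rightarrow> 1 is f followed by Y \<rightarrow> 1, so the coherence
  isomorphism of \<open>PI D\<close> for this composite suffices.\<close>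

lemma Xb_base_change:
  assumes f: "f \<in> hom (base D) X Y"
  shows "nat_isomorphic (B_one D) (PP D X) (Xb D X) (pull D f \<circ>\<^sub>f Xb D Y)"
proof -
  have b: "is_functor (B_one D) (PP D (one_ob D)) (b_fun D (one_ob D))"
    by (rule nat_isomorphicD(1)[OF b_nat_isomorphic])
  show ?thesis
    using nat_isomorphic_sym[OF nat_isomorphic_pre[OF pull_nat_isomorphic[OF f bang_hom[OF base_objs(2)[OF f]]] b]]
    by (simp add: Xb_def bang_cmp[OF f])
qed

section \<open>Coends, ends, hom-objects and the enrichment\<close>

lemma adjoints:
  assumes "X \<in> Obj (base D)"
  shows "adjoint (PP D X) (MM D X) (Dia D X) (i_fun D X)" "adjoint (PP D X) (MM' D X) (Dia' D X) (i'_fun D X)"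
  using A4_Dia[OF assms] A4_Dia'[OF assms] by (auto simp: adjoint_def)

lemma Sig_adjoint: "f \<in> hom (base D) X Y \<Longrightarrow> adjoint (PP D X) (PP D Y) (Sig D f) (pull D f)"
  unfolding adjoint_def by (blast dest: A3_Sig)

text \<open>The choice made by \<open>SOME\<close> is justified by exhibiting one adjoint: \<Sigma>
  along X \<rightarrow> 1, then \<Diamond> over 1, then a left adjoint of the equivalence
  \<open>j_fun\<close>.\<close>

lemma coend_adjoint:
  assumes X: "X \<in> Obj (base D)" shows "adjoint (PP D X) (B_one D) (coend_fun D X) (Xb D X)"
proof -
  obtain K where "adjoint (MM D (one_ob D)) (B_one D) K j_fun"
    using equivalence_adjoints[OF B4] by blast
  from adjoint_fcomp[OF Sig_adjoint[OF bang_hom[OF X]] adjoint_fcomp[OF adjoints(1)[OF one_obj] this]]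
  have "\<exists>F. adjoint (PP D X) (B_one D) F (Xb D X)"
    by (auto simp: Xb_def b_fun_def)
  then show ?thesis unfolding coend_fun_def by (rule someI_ex)
qed

text \<open>Dually, one adjoint is \<Pi> along X \<rightarrow> 1, then \<box> over 1, then a right
  adjoint of \<open>j_fun\<close>.\<close>

lemma end_adjoint:
  assumes X: "X \<in> Obj (base D)" shows "adjoint (B_one D) (PP D X) (Xb D X) (end_fun D X)"
proof -
  obtain K where "adjoint (B_one D) (MM D (one_ob D)) j_fun K"
    using equivalence_adjoints[OF B4] by blast
  from adjoint_fcomp[OF adjoint_fcomp[OF this A4_Box[OF one_obj]] A3_Pi[OF bang_hom[OF X]]]
  have "\<exists>G. adjoint (B_one D) (PP D X) (Xb D X) G"
    by (auto simp: Xb_def b_fun_def)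
  then show ?thesis unfolding end_fun_def by (rule someI_ex)
qed

lemma PP_cart: "X \<in> Obj (base D) \<Longrightarrow> cartesian (PP D X) (cc D X)"
  using A2 by (simp add: cartesian_closed_def)

lemma hom_rep_homs:
  assumes X: "X \<in> Obj (base D)"
  shows "hom_rep (B_one D) (PP D X) (PP D X) (homs D X) (PP D X) (prd_fun (PP D X) (cc D X) \<circ>\<^sub>f (Xb D X \<times>\<^sub>f idf)) idf"
proof -
  interpret ccc "PP D X" "cc D X" by unfold_locales (rule A2[OF X])
  show ?thesis
    unfolding homs_def by (rule hom_rep_adjoint[OF hom_rep_exp_fun end_adjoint[OF X]])
qed

text \<open>The composite of \<open>j_fun\<close> and i over 1 is fully faithful and has a left
  adjoint. Up to equivalence it presents \<open>B_one D\<close> as a full reflective subcategory of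
  a cartesian category, from which products are inherited.\<close>

lemma ex_cartesian_B_one: "\<exists>S :: (_, _) cart. cartesian (B_one D) S"
proof -
  obtain K where "adjoint (MM D (one_ob D)) (B_one D) K j_fun"
    using equivalence_adjoints[OF B4] by blast
  from adjoint_fcomp[OF adjoints(1)[OF one_obj] this]
  obtain \<eta> \<epsilon> where "adjunction (PP D (one_ob D)) (B_one D) (K \<circ>\<^sub>f Dia D (one_ob D)) (i_fun D (one_ob D) \<circ>\<^sub>f j_fun) \<eta> \<epsilon>"
    by (auto simp: adjoint_def)
  then interpret reflection "PP D (one_ob D)" "B_one D" "K \<circ>\<^sub>f Dia D (one_ob D)" "i_fun D (one_ob D) \<circ>\<^sub>f j_fun" \<eta> \<epsilon>
    by unfold_locales (assumption, rule fully_faithful_fcomp[OF equivalence_fully_faithful[OF B4] B1[OF one_obj]])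
  show ?thesis by (rule ex_cartesian[OF PP_cart[OF one_obj]])
qed

lemma enriches_fibres:
  assumes X: "X \<in> Obj (base D)"
  shows "enriches (B_one D) (PP D X) (homs D X)" "enriches (B_one D) (MM D X) (nats D X)"
    "enriches (B_one D) (MM' D X) (nats' D X)"
proof -
  show P: "enriches (B_one D) (PP D X) (homs D X)"
    using ex_cartesian_B_one enriches_if_hom_rep[OF hom_rep_homs[OF X] _ PP_cart[OF X] coend_adjoint[OF X]]
    by blast
  show "enriches (B_one D) (MM D X) (nats D X)" "enriches (B_one D) (MM' D X) (nats' D X)"
    unfolding nats_def nats'_def by (rule enriches_restrict[OF P] B1[OF X] B1'[OF X])+
qed

section \<open>The isomorphisms over a fixed object and along a map of the base\<close>

lemma fibre:
  assumes X: "X \<in> Obj (base D)"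
  shows "fibre (PP D X) (MM D X) (Dia D X) (i_fun D X) (Dia_unit D X) (Dia_counit D X) (cc D X) (MM' D X)
    (i'_fun D X) (Box D X) (B_one D) (Xb D X) (act D (to_one X) \<circ>\<^sub>f j_fun) (act' D (to_one X) \<circ>\<^sub>f j'_fun) (coend_fun D X)"
  by unfold_locales
    (rule A4_Dia[OF X] B1[OF X] PP_cart[OF X] inc_functors[OF X] A4_Box[OF X] coend_adjoint[OF X]
      Xb_nat_isomorphic[OF X] B3[OF X] is_functor_fcomp[OF j_functors(1) indexed_functors(2)[OF bang_hom[OF X]]]
      is_functor_fcomp[OF j_functors(2) indexed_functors(3)[OF bang_hom[OF X]]] | assumption)+

lemma fibre':
  assumes X: "X \<in> Obj (base D)"
  shows "fibre (PP D X) (MM' D X) (Dia' D X) (i'_fun D X) (Dia'_unit D X) (Dia'_counit D X) (cc D X) (MM D X)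
    (i_fun D X) (Box' D X) (B_one D) (Xb D X) (act' D (to_one X) \<circ>\<^sub>f j'_fun) (act D (to_one X) \<circ>\<^sub>f j_fun) (coend_fun D X)"
  by unfold_locales
    (rule A4_Dia'[OF X] B1'[OF X] PP_cart[OF X] inc_functors[OF X] A4_Box'[OF X] coend_adjoint[OF X]
      Xb_nat_isomorphic[OF X] B3'[OF X] is_functor_fcomp[OF j_functors(1) indexed_functors(2)[OF bang_hom[OF X]]]
      is_functor_fcomp[OF j_functors(2) indexed_functors(3)[OF bang_hom[OF X]]] | assumption)+

lemma fibre_isomorphisms:
  assumes X: "X \<in> Obj (base D)"
  shows "nat_isomorphic (op_cat (MM D X) \<times>\<^sub>c PP D X) (B_one D)
          (nats D X \<circ>\<^sub>f (idf \<times>\<^sub>f Box D X)) (homs D X \<circ>\<^sub>f (i_fun D X \<times>\<^sub>f idf))"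
    and "nat_isomorphic (op_cat (MM' D X) \<times>\<^sub>c PP D X) (B_one D)
          (nats' D X \<circ>\<^sub>f (idf \<times>\<^sub>f Box' D X)) (homs D X \<circ>\<^sub>f (i'_fun D X \<times>\<^sub>f idf))"
    and "nat_isomorphic (op_cat (PP D X) \<times>\<^sub>c MM D X) (B_one D)
          (nats D X \<circ>\<^sub>f (Dia D X \<times>\<^sub>f idf)) (homs D X \<circ>\<^sub>f (idf \<times>\<^sub>f i_fun D X))"
    and "nat_isomorphic (op_cat (PP D X) \<times>\<^sub>c MM' D X) (B_one D)
          (nats' D X \<circ>\<^sub>f (Dia' D X \<times>\<^sub>f idf)) (homs D X \<circ>\<^sub>f (idf \<times>\<^sub>f i'_fun D X))"
    and "nat_isomorphic (MM' D X \<times>\<^sub>c PP D X) (B_one D)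
          (ten D X \<circ>\<^sub>f (idf \<times>\<^sub>f Dia D X)) (meets D X \<circ>\<^sub>f (i'_fun D X \<times>\<^sub>f idf))"
    and "nat_isomorphic (PP D X \<times>\<^sub>c MM D X) (B_one D)
          (ten D X \<circ>\<^sub>f (Dia' D X \<times>\<^sub>f idf)) (meets D X \<circ>\<^sub>f (idf \<times>\<^sub>f i_fun D X))"
proof -
  note H = hom_rep_homs[OF X]
  show "nat_isomorphic (op_cat (MM D X) \<times>\<^sub>c PP D X) (B_one D)
      (nats D X \<circ>\<^sub>f (idf \<times>\<^sub>f Box D X)) (homs D X \<circ>\<^sub>f (i_fun D X \<times>\<^sub>f idf))"
    using fibre.nat_Box_nat_isomorphic[OF fibre[OF X] H] by (simp add: nats_def)
  show "nat_isomorphic (op_cat (MM' D X) \<times>\<^sub>c PP D X) (B_one D)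
      (nats' D X \<circ>\<^sub>f (idf \<times>\<^sub>f Box' D X)) (homs D X \<circ>\<^sub>f (i'_fun D X \<times>\<^sub>f idf))"
    using fibre.nat_Box_nat_isomorphic[OF fibre'[OF X] H] by (simp add: nats'_def)
  show "nat_isomorphic (op_cat (PP D X) \<times>\<^sub>c MM D X) (B_one D)
      (nats D X \<circ>\<^sub>f (Dia D X \<times>\<^sub>f idf)) (homs D X \<circ>\<^sub>f (idf \<times>\<^sub>f i_fun D X))"
    using fibre.nat_Dia_nat_isomorphic[OF fibre[OF X] H] by (simp add: nats_def)
  show "nat_isomorphic (op_cat (PP D X) \<times>\<^sub>c MM' D X) (B_one D)
      (nats' D X \<circ>\<^sub>f (Dia' D X \<times>\<^sub>f idf)) (homs D X \<circ>\<^sub>f (idf \<times>\<^sub>f i'_fun D X))"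
    using fibre.nat_Dia_nat_isomorphic[OF fibre'[OF X] H] by (simp add: nats'_def)
  show "nat_isomorphic (MM' D X \<times>\<^sub>c PP D X) (B_one D)
      (ten D X \<circ>\<^sub>f (idf \<times>\<^sub>f Dia D X)) (meets D X \<circ>\<^sub>f (i'_fun D X \<times>\<^sub>f idf))"
    using fibre.coend_mixed_swap[OF fibre[OF X]] by (simp add: ten_def meets_def)
  show "nat_isomorphic (PP D X \<times>\<^sub>c MM D X) (B_one D)
      (ten D X \<circ>\<^sub>f (Dia' D X \<times>\<^sub>f idf)) (meets D X \<circ>\<^sub>f (idf \<times>\<^sub>f i_fun D X))"
    using nat_isomorphic_sym[OF fibre.coend_mixed[OF fibre'[OF X]]] by (simp add: ten_def meets_def)
qed

lemma base_change:
  assumes f: "f \<in> hom (base D) X Y"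
  shows "base_change (PP D X) (cc D X) (PP D Y) (cc D Y) (Sig D f) (pull D f) (Pii D f)
    (B_one D) (Xb D X) (Xb D Y) (coend_fun D X) (coend_fun D Y)"
proof -
  note X = base_objs(1)[OF f] and Y = base_objs(2)[OF f]
  have d: "Dom (base D) f = X" "Cod (base D) f = Y" using f by (simp_all add: in_hom)
  have frob: "nat_isomorphic (PP D X \<times>\<^sub>c PP D Y) (PP D Y)
      (Sig D f \<circ>\<^sub>f prd_fun (PP D X) (cc D X) \<circ>\<^sub>f (idf \<times>\<^sub>f pull D f)) (prd_fun (PP D Y) (cc D Y) \<circ>\<^sub>f (Sig D f \<times>\<^sub>f idf))"
    by (rule frobenius_nat_isomorphic[OF A3_Sig[OF f] PP_cart[OF X] PP_cart[OF Y]])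
      (use B2[OF f] in \<open>simp add: frobenius_def Let_def d\<close>)
  show ?thesis
    by unfold_locales
      (rule PP_cart X Y Sig_adjoint[OF f] A3_Pi[OF f] frob coend_adjoint Xb_base_change[OF f])+
qed

lemma base_change_isomorphisms:
  assumes f: "f \<in> hom (base D) X Y"
  shows "nat_isomorphic (op_cat (PP D Y) \<times>\<^sub>c PP D X) (B_one D)
          (homs D X \<circ>\<^sub>f (pull D f \<times>\<^sub>f idf)) (homs D Y \<circ>\<^sub>f (idf \<times>\<^sub>f Pii D f))"
    and "nat_isomorphic (op_cat (PP D X) \<times>\<^sub>c PP D Y) (B_one D)
          (homs D X \<circ>\<^sub>f (idf \<times>\<^sub>f pull D f)) (homs D Y \<circ>\<^sub>f (Sig D f \<times>\<^sub>f idf))"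
    and "nat_isomorphic (PP D Y \<times>\<^sub>c PP D X) (B_one D)
          (meets D X \<circ>\<^sub>f (pull D f \<times>\<^sub>f idf)) (meets D Y \<circ>\<^sub>f (idf \<times>\<^sub>f Sig D f))"
    and "nat_isomorphic (PP D X \<times>\<^sub>c PP D Y) (B_one D)
          (meets D X \<circ>\<^sub>f (idf \<times>\<^sub>f pull D f)) (meets D Y \<circ>\<^sub>f (Sig D f \<times>\<^sub>f idf))"
proof -
  interpret base_change "PP D X" "cc D X" "PP D Y" "cc D Y" "Sig D f" "pull D f" "Pii D f"
    "B_one D" "Xb D X" "Xb D Y" "coend_fun D X" "coend_fun D Y"
    by (rule base_change[OF f])
  note H = hom_rep_homs[OF base_objs(1)[OF f]] hom_rep_homs[OF base_objs(2)[OF f]]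
  show "nat_isomorphic (op_cat (PP D Y) \<times>\<^sub>c PP D X) (B_one D)
      (homs D X \<circ>\<^sub>f (pull D f \<times>\<^sub>f idf)) (homs D Y \<circ>\<^sub>f (idf \<times>\<^sub>f Pii D f))"
    "nat_isomorphic (op_cat (PP D X) \<times>\<^sub>c PP D Y) (B_one D)
      (homs D X \<circ>\<^sub>f (idf \<times>\<^sub>f pull D f)) (homs D Y \<circ>\<^sub>f (Sig D f \<times>\<^sub>f idf))"
    by (rule hom_nat_isomorphic[OF H])+
  show "nat_isomorphic (PP D Y \<times>\<^sub>c PP D X) (B_one D)
      (meets D X \<circ>\<^sub>f (pull D f \<times>\<^sub>f idf)) (meets D Y \<circ>\<^sub>f (idf \<times>\<^sub>f Sig D f))"
    "nat_isomorphic (PP D X \<times>\<^sub>c PP D Y) (B_one D)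
      (meets D X \<circ>\<^sub>f (idf \<times>\<^sub>f pull D f)) (meets D Y \<circ>\<^sub>f (Sig D f \<times>\<^sub>f idf))"
    using meets_nat_isomorphic by (simp_all add: meets_def)
qed

text \<open>Each chain has three links: pseudonaturality of an inclusion, change of fibre, and an
  isomorphism over Y read backwards. For \<forall>, writing M for an object over Y and L for one
  over X: nat(f \<cdot> M, L) \<cong> hom(\<open>pull D f\<close> (i M), i L) \<cong> hom(i M, \<Pi>
  (i L)) \<cong> nat(M, \<box> (\<Pi> (i L))), where the first two terms are formed over X and the
  others over Y.\<close>

lemma quantifier_isomorphisms:
  assumes f: "f \<in> hom (base D) X Y"
  shows "nat_isomorphic (op_cat (MM D Y) \<times>\<^sub>c MM D X) (B_one D)
          (nats D X \<circ>\<^sub>f (act D f \<times>\<^sub>f idf)) (nats D Y \<circ>\<^sub>f (idf \<times>\<^sub>f Allf D f))"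
    and "nat_isomorphic (op_cat (MM' D Y) \<times>\<^sub>c MM' D X) (B_one D)
          (nats' D X \<circ>\<^sub>f (act' D f \<times>\<^sub>f idf)) (nats' D Y \<circ>\<^sub>f (idf \<times>\<^sub>f Allf' D f))"
    and "nat_isomorphic (op_cat (MM D X) \<times>\<^sub>c MM D Y) (B_one D)
          (nats D X \<circ>\<^sub>f (idf \<times>\<^sub>f act D f)) (nats D Y \<circ>\<^sub>f (Exf D f \<times>\<^sub>f idf))"
    and "nat_isomorphic (op_cat (MM' D X) \<times>\<^sub>c MM' D Y) (B_one D)
          (nats' D X \<circ>\<^sub>f (idf \<times>\<^sub>f act' D f)) (nats' D Y \<circ>\<^sub>f (Exf' D f \<times>\<^sub>f idf))"
    and "nat_isomorphic (MM' D Y \<times>\<^sub>c MM D X) (B_one D)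
          (ten D X \<circ>\<^sub>f (act' D f \<times>\<^sub>f idf)) (ten D Y \<circ>\<^sub>f (idf \<times>\<^sub>f Exf D f))"
    and "nat_isomorphic (MM' D X \<times>\<^sub>c MM D Y) (B_one D)
          (ten D X \<circ>\<^sub>f (idf \<times>\<^sub>f act D f)) (ten D Y \<circ>\<^sub>f (Exf' D f \<times>\<^sub>f idf))"
proof -
  note X = base_objs(1)[OF f] and Y = base_objs(2)[OF f]
  have d [simp]: "Dom (base D) f = X" "Cod (base D) f = Y" using f by (simp_all add: in_hom)
  note H = hom_repD(1)[OF hom_rep_homs[OF X]]
  have M: "is_functor (PP D X \<times>\<^sub>c PP D X) (B_one D) (meets D X)"
    unfolding meets_def
    by (rule is_functor_fcomp[OF cart_cat.is_functor_prd_fun adjoint_functors(1)[OF coend_adjoint[OF X]]])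
      (rule cart_cat.intro[OF PP_cart[OF X]])
  note iX = inc_functors[OF X] and iY = inc_functors[OF Y]
  note rX = iX[THEN nat_isomorphic_refl]
  note opX = rX[THEN nat_isomorphic_op]
  note s = inc_nat_isomorphic[OF f]
  note Sf = adjoint_functors(1)[OF Sig_adjoint[OF f]] and Rf = adjoint_functors(2)[OF A3_Pi[OF f]]
  note id = is_functor_idf[OF is_functorD(1)[OF iX(1)]] is_functor_idf[OF is_functorD(1)[OF iX(2)]]
    is_functor_idf[OF is_functorD(1)[OF iY(1)]] is_functor_idf[OF is_functorD(1)[OF iY(2)]]
  note bc = base_change_isomorphisms[OF f] and fi = fibre_isomorphisms[OF Y]
  note pre = nat_isomorphic_pre[OF _ is_functor_fprod]
  show "nat_isomorphic (op_cat (MM D Y) \<times>\<^sub>c MM D X) (B_one D)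
      (nats D X \<circ>\<^sub>f (act D f \<times>\<^sub>f idf)) (nats D Y \<circ>\<^sub>f (idf \<times>\<^sub>f Allf D f))"
    using nat_isomorphic_trans[OF nat_isomorphic_fprod_post[OF nat_isomorphic_op[OF s(1)] rX(1) H]
        nat_isomorphic_trans[OF pre[OF bc(1) is_functor_op[OF iY(1)] iX(1), simplified]
          pre[OF nat_isomorphic_sym[OF fi(1)] is_functor_op[OF id(3)] is_functor_fcomp[OF iX(1) Rf], simplified]]]
    by (simp add: nats_def Allf_def)
  show "nat_isomorphic (op_cat (MM' D Y) \<times>\<^sub>c MM' D X) (B_one D)
      (nats' D X \<circ>\<^sub>f (act' D f \<times>\<^sub>f idf)) (nats' D Y \<circ>\<^sub>f (idf \<times>\<^sub>f Allf' D f))"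
    using nat_isomorphic_trans[OF nat_isomorphic_fprod_post[OF nat_isomorphic_op[OF s(2)] rX(2) H]
        nat_isomorphic_trans[OF pre[OF bc(1) is_functor_op[OF iY(2)] iX(2), simplified]
          pre[OF nat_isomorphic_sym[OF fi(2)] is_functor_op[OF id(4)] is_functor_fcomp[OF iX(2) Rf], simplified]]]
    by (simp add: nats'_def Allf'_def)
  show "nat_isomorphic (op_cat (MM D X) \<times>\<^sub>c MM D Y) (B_one D)
      (nats D X \<circ>\<^sub>f (idf \<times>\<^sub>f act D f)) (nats D Y \<circ>\<^sub>f (Exf D f \<times>\<^sub>f idf))"
    using nat_isomorphic_trans[OF nat_isomorphic_fprod_post[OF opX(1) s(1) H]
        nat_isomorphic_trans[OF pre[OF bc(2) is_functor_op[OF iX(1)] iY(1), simplified]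
          pre[OF nat_isomorphic_sym[OF fi(3)] is_functor_op[OF is_functor_fcomp[OF iX(1) Sf]] id(3), simplified]]]
    by (simp add: nats_def Exf_def)
  show "nat_isomorphic (op_cat (MM' D X) \<times>\<^sub>c MM' D Y) (B_one D)
      (nats' D X \<circ>\<^sub>f (idf \<times>\<^sub>f act' D f)) (nats' D Y \<circ>\<^sub>f (Exf' D f \<times>\<^sub>f idf))"
    using nat_isomorphic_trans[OF nat_isomorphic_fprod_post[OF opX(2) s(2) H]
        nat_isomorphic_trans[OF pre[OF bc(2) is_functor_op[OF iX(2)] iY(2), simplified]
          pre[OF nat_isomorphic_sym[OF fi(4)] is_functor_op[OF is_functor_fcomp[OF iX(2) Sf]] id(4), simplified]]]
    by (simp add: nats'_def Exf'_def)
  show "nat_isomorphic (MM' D Y \<times>\<^sub>c MM D X) (B_one D)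
      (ten D X \<circ>\<^sub>f (act' D f \<times>\<^sub>f idf)) (ten D Y \<circ>\<^sub>f (idf \<times>\<^sub>f Exf D f))"
    using nat_isomorphic_trans[OF nat_isomorphic_fprod_post[OF s(2) rX(1) M]
        nat_isomorphic_trans[OF pre[OF bc(3) iY(2) iX(1), simplified]
          pre[OF nat_isomorphic_sym[OF fi(5)] id(4) is_functor_fcomp[OF iX(1) Sf], simplified]]]
    by (simp add: ten_def Exf_def)
  show "nat_isomorphic (MM' D X \<times>\<^sub>c MM D Y) (B_one D)
      (ten D X \<circ>\<^sub>f (idf \<times>\<^sub>f act D f)) (ten D Y \<circ>\<^sub>f (Exf' D f \<times>\<^sub>f idf))"
    using nat_isomorphic_trans[OF nat_isomorphic_fprod_post[OF rX(2) s(1) M]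
        nat_isomorphic_trans[OF pre[OF bc(4) iX(2) iY(1), simplified]
          pre[OF nat_isomorphic_sym[OF fi(6)] is_functor_fcomp[OF iX(2) Sf] id(3), simplified]]]
    by (simp add: ten_def Exf'_def)
qed

end

theorem proposition6p2:
  fixes D :: "('c, 'h, 'p, 'q, 'm, 'n, 'k, 'l) doctrine"
  assumes "temporal_doctrine D"
  shows
    "(\<forall>X \<in> Obj (base D).
        enriches (B_one D) (PP D X) (homs D X) \<and>
        enriches (B_one D) (MM D X) (nats D X) \<and>
        enriches (B_one D) (MM' D X) (nats' D X)) \<and>
     (\<forall>X \<in> Obj (base D).
        nat_isomorphic (op_cat (MM D X) \<times>\<^sub>c PP D X) (B_one D)
          (nats D X \<circ>\<^sub>f (idf \<times>\<^sub>f Box D X)) (homs D X \<circ>\<^sub>f (i_fun D X \<times>\<^sub>f idf)) \<and>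
        nat_isomorphic (op_cat (MM' D X) \<times>\<^sub>c PP D X) (B_one D)
          (nats' D X \<circ>\<^sub>f (idf \<times>\<^sub>f Box' D X)) (homs D X \<circ>\<^sub>f (i'_fun D X \<times>\<^sub>f idf)) \<and>
        nat_isomorphic (op_cat (PP D X) \<times>\<^sub>c MM D X) (B_one D)
          (nats D X \<circ>\<^sub>f (Dia D X \<times>\<^sub>f idf)) (homs D X \<circ>\<^sub>f (idf \<times>\<^sub>f i_fun D X)) \<and>
        nat_isomorphic (op_cat (PP D X) \<times>\<^sub>c MM' D X) (B_one D)
          (nats' D X \<circ>\<^sub>f (Dia' D X \<times>\<^sub>f idf)) (homs D X \<circ>\<^sub>f (idf \<times>\<^sub>f i'_fun D X)) \<and>
        nat_isomorphic (MM' D X \<times>\<^sub>c PP D X) (B_one D)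
          (ten D X \<circ>\<^sub>f (idf \<times>\<^sub>f Dia D X)) (meets D X \<circ>\<^sub>f (i'_fun D X \<times>\<^sub>f idf)) \<and>
        nat_isomorphic (PP D X \<times>\<^sub>c MM D X) (B_one D)
          (ten D X \<circ>\<^sub>f (Dia' D X \<times>\<^sub>f idf)) (meets D X \<circ>\<^sub>f (idf \<times>\<^sub>f i_fun D X))) \<and>
     (\<forall>X Y. \<forall>f \<in> hom (base D) X Y.
        nat_isomorphic (op_cat (PP D Y) \<times>\<^sub>c PP D X) (B_one D)
          (homs D X \<circ>\<^sub>f (pull D f \<times>\<^sub>f idf)) (homs D Y \<circ>\<^sub>f (idf \<times>\<^sub>f Pii D f)) \<and>
        nat_isomorphic (op_cat (PP D X) \<times>\<^sub>c PP D Y) (B_one D)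
          (homs D X \<circ>\<^sub>f (idf \<times>\<^sub>f pull D f)) (homs D Y \<circ>\<^sub>f (Sig D f \<times>\<^sub>f idf)) \<and>
        nat_isomorphic (PP D Y \<times>\<^sub>c PP D X) (B_one D)
          (meets D X \<circ>\<^sub>f (pull D f \<times>\<^sub>f idf)) (meets D Y \<circ>\<^sub>f (idf \<times>\<^sub>f Sig D f)) \<and>
        nat_isomorphic (PP D X \<times>\<^sub>c PP D Y) (B_one D)
          (meets D X \<circ>\<^sub>f (idf \<times>\<^sub>f pull D f)) (meets D Y \<circ>\<^sub>f (Sig D f \<times>\<^sub>f idf)) \<and>
        nat_isomorphic (op_cat (MM D Y) \<times>\<^sub>c MM D X) (B_one D)
          (nats D X \<circ>\<^sub>f (act D f \<times>\<^sub>f idf)) (nats D Y \<circ>\<^sub>f (idf \<times>\<^sub>f Allf D f)) \<and>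
        nat_isomorphic (op_cat (MM' D Y) \<times>\<^sub>c MM' D X) (B_one D)
          (nats' D X \<circ>\<^sub>f (act' D f \<times>\<^sub>f idf)) (nats' D Y \<circ>\<^sub>f (idf \<times>\<^sub>f Allf' D f)) \<and>
        nat_isomorphic (op_cat (MM D X) \<times>\<^sub>c MM D Y) (B_one D)
          (nats D X \<circ>\<^sub>f (idf \<times>\<^sub>f act D f)) (nats D Y \<circ>\<^sub>f (Exf D f \<times>\<^sub>f idf)) \<and>
        nat_isomorphic (op_cat (MM' D X) \<times>\<^sub>c MM' D Y) (B_one D)
          (nats' D X \<circ>\<^sub>f (idf \<times>\<^sub>f act' D f)) (nats' D Y \<circ>\<^sub>f (Exf' D f \<times>\<^sub>f idf)) \<and>
        nat_isomorphic (MM' D Y \<times>\<^sub>c MM D X) (B_one D)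
          (ten D X \<circ>\<^sub>f (act' D f \<times>\<^sub>f idf)) (ten D Y \<circ>\<^sub>f (idf \<times>\<^sub>f Exf D f)) \<and>
        nat_isomorphic (MM' D X \<times>\<^sub>c MM D Y) (B_one D)
          (ten D X \<circ>\<^sub>f (idf \<times>\<^sub>f act D f)) (ten D Y \<circ>\<^sub>f (Exf' D f \<times>\<^sub>f idf)))"
proof -
  interpret temporal_doctrine D by fact
  show ?thesis
    by (intro conjI ballI allI enriches_fibres fibre_isomorphisms base_change_isomorphisms
        quantifier_isomorphisms)
qed

end
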